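(* Let $(\bm u^-,\bm B^-)\in\bm V_h\times H_0^h(\mathrm{div},\Omega)$ be given. For every $\bm h\in\bm X_h^*$ and $\bm g\in\bm Y_h^*$ there exists a unique pair $(\mathfrak U,\bm x)\in\bm X_h\times\bm Y_h$ such that for all $(\mathfrak V,\bm y)\in\bm X_h\times\bm Y_h$, $$\bm a_{s,L}(\mathfrak U,\mathfrak V)+\bm b_s(\mathfrak V,\bm x)=\langle\bm h,\mathfrak V\rangle,\qquad\bm b_s(\mathfrak U,\bm y)=\langle\bm g,\bm y\rangle,$$ and there is a constant $C>0$ independent of $\bm h,\bm g$ with $\|\mathfrak U\|_{\bm X}+\|\bm x\|_{\bm Y}\le C(\|\bm h\|_{\bm X_h^*}+\|\bm g\|_{\bm Y_h^*})$; that is, the problem is well-posed with the norms $\|\cdot\|_{\bm X}$, $\|\cdot\|_{\bm Y}$. Consequently, each step of the Picard iteration is well-posed: given $(\bm u^{n-1},\bm B^{n-1})\in\bm V_h\times H_0^h(\mathrm{div},\Omega)$, there is a unique $(\bm u^n,\bm E^n,\bm B^n)\in\bm X_h$, $(p^n,r^n)\in\bm Y_h$ such that for all $(\bm v,\bm F,\bm C)\in\bm X_h$, $(q,s)\in\bm Y_h$, $$L(\bm u^{n-1};\bm u^n,\bm v)+R_e^{-1}(\nabla\bm u^n,\nabla\bm v)-S(\bm j^n_{n-1}\times\bm B^{n-1},\bm v)-(p^n,\nabla\cdot\bm v)=\langle\bm f,\bm v\rangle,$$ $$S(\bm j^n_{n-1},\bm F)-\alpha(\bm B^n,\nabla\times\bm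 F)=0,\qquad\alpha(\nabla\times\bm E^n,\bm C)+(r^n,\nabla\cdot\bm C)=0,$$ $$-(\nabla\cdot\bm u^n,q)=0,\qquad(\nabla\cdot\bm B^n,s)=0,$$ where $\bm j^n_{n-1}=\bm E^n+\bm u^n\times\bm B^{n-1}$.
   Context: $\Omega\subset\mathbb R^3$ is a bounded contractible Lipschitz polyhedron. $(\cdot,\cdot)$, $\|\cdot\|$: $L^2(\Omega)$ inner product and norm. $R_e,R_m,S>0$ are constants, $\alpha:=SR_m^{-1}$, $\bm f\in[H^{-1}(\Omega)]^3$. $L(\bm w;\bm u,\bm v):=\frac12[((\bm w\cdot\nabla)\bm u,\bm v)-((\bm w\cdot\nabla)\bm v,\bm u)]$. $\mathcal T_h$ belongs to a shape-regular, quasi-uniform family of simplicial triangulations of $\Omega$. $H_0^h(\mathrm{grad},\Omega)\xrightarrow{\nabla}H_0^h(\mathrm{curl},\Omega)\xrightarrow{\nabla\times}H_0^h(\mathrm{div},\Omega)\xrightarrow{\nabla\cdot}L_0^{2,h}(\Omega)$ is a standard conforming finite element de Rham complex on $\mathcal T_h$ (Lagrange, Nédélec, Raviart–Thomas or BDM, discontinuous elements) with homogeneous boundary conditions; it is exact. $\bm V_h\subset[H_0^1(\Omega)]^3$, $Q_h\subset L_0^2(\Omega)$ are an inf-sup stable Stokes finite element pair. $\bm X_h:=\bm V_h\times H_0^h(\mathrm{curl},\Omega)\times H_0^h(\mathrm{div},\Omega)$, $\bm Y_h:=Q_h\times L_0^{2,h}(\Omega)$. For $\mathfrak U=(\bm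 u,\bm E,\bm B)$, $\mathfrak V=(\bm v,\bm F,\bm C)\in\bm X_h$ and $\bm y=(q,s)\in\bm Y_h$: $$\bm a_{s,L}(\mathfrak U,\mathfrak V):=L(\bm u^-;\bm u,\bm v)+R_e^{-1}(\nabla\bm u,\nabla\bm v)+S(\bm E+\bm u\times\bm B^-,\bm F+\bm v\times\bm B^-)-\alpha(\bm B,\nabla\times\bm F)+\alpha(\nabla\times\bm E,\bm C),$$ $$\bm b_s(\mathfrak V,\bm y):=-(\nabla\cdot\bm v,q)+(\nabla\cdot\bm C,s).$$ Norms: $\|(\bm v,\bm F,\bm C)\|_{\bm X}^2:=\|\bm v\|^2+\|\nabla\bm v\|^2+\|\nabla\times\bm F\|^2+\|\bm F+\bm v\times\bm B^-\|^2+\|\bm C\|^2+\|\nabla\cdot\bm C\|^2$ and $\|(q,r)\|_{\bm Y}^2:=\|q\|^2+\|r\|^2$; dual spaces carry the dual norms. *)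

theory Defs
  imports "HOL-Analysis.Analysis" "HOL-Library.Function_Algebras"
begin

unbundle no cross3_syntax

type_synonym sfield = "real^3 \<Rightarrow> real"
type_synonym vfield = "real^3 \<Rightarrow> real^3"

text \<open>Pointwise real vector space structure on functions, so that \<open>span\<close>, \<open>subspace\<close> and
  sums of (tuples of) fields are the library notions.\<close>

instantiation "fun" :: (type, scaleR) scaleR
begin
definition "scaleR c f = (\<lambda>x. scaleR c (f x))"
instance ..
end

instance "fun" :: (type, real_vector) real_vector
  by standard (auto simp: scaleR_fun_def fun_eq_iff scaleR_add_right scaleR_add_left)


section \<open>Lebesgue spaces\<close>

text \<open>Elements of \<open>L\<^sup>2\<close> are represented by functions on \<open>\<real>\<^sup>3\<close> whose values outside \<open>\<Omega>\<close> are
  irrelevant; equality of elements is \<open>ae_eq \<Omega>\<close>.\<close>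

definition ae_eq :: "(real^3) set \<Rightarrow> (real^3 \<Rightarrow> 'b) \<Rightarrow> (real^3 \<Rightarrow> 'b) \<Rightarrow> bool" where
  "ae_eq \<Omega> f g \<longleftrightarrow> (AE x in lebesgue_on \<Omega>. f x = g x)"

definition L2 :: "(real^3) set \<Rightarrow> (real^3 \<Rightarrow> 'b::euclidean_space) set" where
  "L2 \<Omega> = {f \<in> borel_measurable (lebesgue_on \<Omega>). integrable (lebesgue_on \<Omega>) (\<lambda>x. (norm (f x))\<^sup>2)}"

definition L2_inner ::
    "(real^3) set \<Rightarrow> (real^3 \<Rightarrow> 'b::euclidean_space) \<Rightarrow> (real^3 \<Rightarrow> 'b) \<Rightarrow> real" where
  "L2_inner \<Omega> f g = (LINT x|lebesgue_on \<Omega>. f x \<bullet> g x)"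

definition L2_norm :: "(real^3) set \<Rightarrow> (real^3 \<Rightarrow> 'b::euclidean_space) \<Rightarrow> real" where
  "L2_norm \<Omega> f = sqrt (L2_inner \<Omega> f f)"

definition L2_0 :: "(real^3) set \<Rightarrow> sfield set" where
  "L2_0 \<Omega> = {q \<in> L2 \<Omega>. (LINT x|lebesgue_on \<Omega>. q x) = 0}"


section \<open>Test functions and weak derivatives\<close>

definition partial :: "3 \<Rightarrow> sfield \<Rightarrow> sfield" where
  "partial i \<phi> = (\<lambda>x. frechet_derivative \<phi> (at x) (axis i 1))"

text \<open>All iterated partial derivatives are differentiable everywhere.\<close>

definition smooth :: "sfield \<Rightarrow> bool" where
  "smooth \<phi> \<longleftrightarrow> (\<forall>is x. foldr partial is \<phi> differentiable (at x))"

definition test_funs :: "(real^3) set \<Rightarrow> sfield set" where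
  "test_funs \<Omega> = {\<phi>. smooth \<phi> \<and> compact (closure {x. \<phi> x \<noteq> 0}) \<and> closure {x. \<phi> x \<noteq> 0} \<subseteq> \<Omega>}"

definition test_fields :: "(real^3) set \<Rightarrow> vfield set" where
  "test_fields \<Omega> = {\<Phi>. \<forall>i. (\<lambda>x. \<Phi> x $ i) \<in> test_funs \<Omega>}"

definition grad_cl :: "sfield \<Rightarrow> vfield" where
  "grad_cl \<phi> = (\<lambda>x. \<chi> i. partial i \<phi> x)"

definition curl_cl :: "vfield \<Rightarrow> vfield" where
  "curl_cl \<Phi> = (\<lambda>x. let d = (\<lambda>i j. partial i (\<lambda>y. \<Phi> y $ j) x)
                 in vector [d 2 3 - d 3 2, d 3 1 - d 1 3, d 1 2 - d 2 1])"

definition div_cl :: "vfield \<Rightarrow> sfield" where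
  "div_cl \<Phi> = (\<lambda>x. \<Sum>i\<in>UNIV. partial i (\<lambda>y. \<Phi> y $ i) x)"

definition has_grad :: "(real^3) set \<Rightarrow> sfield \<Rightarrow> vfield \<Rightarrow> bool" where
  "has_grad \<Omega> f g \<longleftrightarrow> f \<in> L2 \<Omega> \<and> g \<in> L2 \<Omega> \<and>
     (\<forall>\<Phi>\<in>test_fields \<Omega>. L2_inner \<Omega> f (div_cl \<Phi>) = - L2_inner \<Omega> g \<Phi>)"

definition has_curl :: "(real^3) set \<Rightarrow> vfield \<Rightarrow> vfield \<Rightarrow> bool" where
  "has_curl \<Omega> F g \<longleftrightarrow> F \<in> L2 \<Omega> \<and> g \<in> L2 \<Omega> \<and>
     (\<forall>\<Phi>\<in>test_fields \<Omega>. L2_inner \<Omega> F (curl_cl \<Phi>) = L2_inner \<Omega> g \<Phi>)"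

definition has_div :: "(real^3) set \<Rightarrow> vfield \<Rightarrow> sfield \<Rightarrow> bool" where
  "has_div \<Omega> C g \<longleftrightarrow> C \<in> L2 \<Omega> \<and> g \<in> L2 \<Omega> \<and>
     (\<forall>\<phi>\<in>test_funs \<Omega>. L2_inner \<Omega> C (grad_cl \<phi>) = - L2_inner \<Omega> g \<phi>)"

text \<open>Weak derivatives are unique up to \<open>ae_eq \<Omega>\<close>; the operators pick a representative.\<close>

definition grad :: "(real^3) set \<Rightarrow> sfield \<Rightarrow> vfield" where
  "grad \<Omega> f = (SOME g. has_grad \<Omega> f g)"

definition curl :: "(real^3) set \<Rightarrow> vfield \<Rightarrow> vfield" where
  "curl \<Omega> F = (SOME g. has_curl \<Omega> F g)"

definition dvg :: "(real^3) set \<Rightarrow> vfield \<Rightarrow> sfield" where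
  "dvg \<Omega> C = (SOME g. has_div \<Omega> C g)"

text \<open>Row \<open>i\<close> of the Jacobian is the gradient of component \<open>i\<close>; the inner product on
  \<open>real^3^3\<close> is the Frobenius one.\<close>

definition jac :: "(real^3) set \<Rightarrow> vfield \<Rightarrow> real^3 \<Rightarrow> real^3^3" where
  "jac \<Omega> u = (\<lambda>x. \<chi> i. grad \<Omega> (\<lambda>y. u y $ i) x)"


section \<open>Sobolev spaces with homogeneous boundary conditions\<close>

text \<open>Each space is the closure of the test functions (fields) in the respective graph norm.\<close>

definition H1_0 :: "(real^3) set \<Rightarrow> sfield set" where
  "H1_0 \<Omega> = {f. \<exists>g. has_grad \<Omega> f g \<and> (\<exists>\<phi>::nat \<Rightarrow> sfield. (\<forall>n. \<phi> n \<in> test_funs \<Omega>) \<and>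
     (\<lambda>n. L2_norm \<Omega> (\<phi> n - f)) \<longlonglongrightarrow> 0 \<and> (\<lambda>n. L2_norm \<Omega> (grad_cl (\<phi> n) - g)) \<longlonglongrightarrow> 0)}"

definition Hcurl_0 :: "(real^3) set \<Rightarrow> vfield set" where
  "Hcurl_0 \<Omega> = {F. \<exists>g. has_curl \<Omega> F g \<and> (\<exists>\<Phi>::nat \<Rightarrow> vfield. (\<forall>n. \<Phi> n \<in> test_fields \<Omega>) \<and>
     (\<lambda>n. L2_norm \<Omega> (\<Phi> n - F)) \<longlonglongrightarrow> 0 \<and> (\<lambda>n. L2_norm \<Omega> (curl_cl (\<Phi> n) - g)) \<longlonglongrightarrow> 0)}"

definition Hdiv_0 :: "(real^3) set \<Rightarrow> vfield set" where
  "Hdiv_0 \<Omega> = {C. \<exists>g. has_div \<Omega> C g \<and> (\<exists>\<Phi>::nat \<Rightarrow> vfield. (\<forall>n. \<Phi> n \<in> test_fields \<Omega>) \<and>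
     (\<lambda>n. L2_norm \<Omega> (\<Phi> n - C)) \<longlonglongrightarrow> 0 \<and> (\<lambda>n. L2_norm \<Omega> (div_cl (\<Phi> n) - g)) \<longlonglongrightarrow> 0)}"

definition H1_0_vec :: "(real^3) set \<Rightarrow> vfield set" where
  "H1_0_vec \<Omega> = {u. \<forall>i. (\<lambda>x. u x $ i) \<in> H1_0 \<Omega>}"

definition H1_norm :: "(real^3) set \<Rightarrow> vfield \<Rightarrow> real" where
  "H1_norm \<Omega> u = sqrt ((L2_norm \<Omega> u)\<^sup>2 + (L2_norm \<Omega> (jac \<Omega> u))\<^sup>2)"


section \<open>Dual spaces\<close>

text \<open>Boundedness forces a functional to agree on fields that are equal almost everywhere, so
  this is the dual of the space of equivalence classes.\<close>

definition dual_space :: "'a::real_vector set \<Rightarrow> ('a \<Rightarrow> real) \<Rightarrow> ('a \<Rightarrow> real) set" where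
  "dual_space W N = {\<phi>. (\<forall>x\<in>W. \<forall>y\<in>W. \<phi> (x + y) = \<phi> x + \<phi> y) \<and>
     (\<forall>c. \<forall>x\<in>W. \<phi> (c *\<^sub>R x) = c * \<phi> x) \<and> (\<exists>M. \<forall>x\<in>W. \<bar>\<phi> x\<bar> \<le> M * N x)}"

definition dual_norm :: "'a::real_vector set \<Rightarrow> ('a \<Rightarrow> real) \<Rightarrow> ('a \<Rightarrow> real) \<Rightarrow> real" where
  "dual_norm W N \<phi> = (SUP x\<in>{x\<in>W. N x \<le> 1}. \<bar>\<phi> x\<bar>)"


section \<open>Domain and triangulations\<close>

text \<open>Near each boundary point the domain is the strict epigraph, in some direction \<open>e\<close>, of a
  Lipschitz function on the plane orthogonal to \<open>e\<close>.\<close>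

definition lipschitz_boundary :: "(real^3) set \<Rightarrow> bool" where
  "lipschitz_boundary \<Omega> \<longleftrightarrow> (\<forall>x\<in>frontier \<Omega>. \<exists>r>0. \<exists>e \<gamma> l. norm e = 1 \<and>
     l-lipschitz_on {z. z \<bullet> e = 0} \<gamma> \<and>
     \<Omega> \<inter> ball x r = {y \<in> ball x r. (\<gamma> (y - (y \<bullet> e) *\<^sub>R e) :: real) < y \<bullet> e})"

definition lipschitz_polyhedron :: "(real^3) set \<Rightarrow> bool" where
  "lipschitz_polyhedron \<Omega> \<longleftrightarrow> open \<Omega> \<and> connected \<Omega> \<and> \<Omega> \<noteq> {} \<and>
     (\<exists>\<P>. finite \<P> \<and> (\<forall>P\<in>\<P>. polytope P) \<and> closure \<Omega> = \<Union>\<P>) \<and> lipschitz_boundary \<Omega>"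

definition simplicial_mesh :: "(real^3) set \<Rightarrow> (real^3) set set \<Rightarrow> bool" where
  "simplicial_mesh \<Omega> \<T> \<longleftrightarrow> triangulation \<T> \<and> (\<forall>K\<in>\<T>. 3 simplex K) \<and> \<Union>\<T> = closure \<Omega>"

definition refines :: "(real^3) set set \<Rightarrow> (real^3) set set \<Rightarrow> bool" where
  "refines \<T>' \<T> \<longleftrightarrow> (\<forall>K'\<in>\<T>'. \<exists>K\<in>\<T>. K' \<subseteq> K)"

definition inradius :: "(real^3) set \<Rightarrow> real" where
  "inradius K = Sup {r. \<exists>c. cball c r \<subseteq> K}"

definition shape_regular :: "('i \<Rightarrow> (real^3) set set) \<Rightarrow> bool" where
  "shape_regular \<T> \<longleftrightarrow> (\<exists>\<sigma>>0. \<forall>h. \<forall>K\<in>\<T> h. diameter K \<le> \<sigma> * inradius K)"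

definition quasi_uniform :: "('i \<Rightarrow> (real^3) set set) \<Rightarrow> bool" where
  "quasi_uniform \<T> \<longleftrightarrow> (\<exists>\<sigma>>0. \<forall>h. \<forall>K\<in>\<T> h. \<forall>K'\<in>\<T> h. diameter K \<le> \<sigma> * diameter K')"


section \<open>Finite element spaces\<close>

definition monomial :: "(3 \<Rightarrow> nat) \<Rightarrow> sfield" where
  "monomial a = (\<lambda>x. \<Prod>i\<in>UNIV. (x $ i) ^ a i)"

definition polys :: "nat \<Rightarrow> sfield set" where
  "polys k = span {monomial a |a. (\<Sum>i\<in>UNIV. a i) \<le> k}"

definition hom_polys :: "nat \<Rightarrow> sfield set" where
  "hom_polys k = span {monomial a |a. (\<Sum>i\<in>UNIV. a i) = k}"

definition vec_of :: "sfield set \<Rightarrow> vfield set" where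
  "vec_of P = {p. \<forall>i. (\<lambda>x. p x $ i) \<in> P}"

text \<open>Local Nedelec (first kind) and Raviart--Thomas spaces of order \<open>k \<ge> 1\<close>
  (lowest order is \<open>k = 1\<close>).\<close>

definition ned_local :: "nat \<Rightarrow> vfield set" where
  "ned_local k = {\<lambda>x. p x + cross3 x (q x) |p q.
     p \<in> vec_of (polys (k - 1)) \<and> q \<in> vec_of (hom_polys (k - 1))}"

definition rt_local :: "nat \<Rightarrow> vfield set" where
  "rt_local k = {\<lambda>x. p x + q x *\<^sub>R x |p q. p \<in> vec_of (polys (k - 1)) \<and> q \<in> hom_polys (k - 1)}"

definition piecewise ::
    "(real^3) set \<Rightarrow> (real^3) set set \<Rightarrow> (real^3 \<Rightarrow> 'b) set \<Rightarrow> (real^3 \<Rightarrow> 'b) set" where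
  "piecewise \<Omega> \<T> P = {v. \<forall>K\<in>\<T>. \<exists>p\<in>P. AE x in lebesgue_on \<Omega>. x \<in> K \<longrightarrow> v x = p x}"

definition lagrange :: "(real^3) set \<Rightarrow> (real^3) set set \<Rightarrow> nat \<Rightarrow> sfield set" where
  "lagrange \<Omega> \<T> k = H1_0 \<Omega> \<inter> piecewise \<Omega> \<T> (polys k)"

definition nedelec1 :: "(real^3) set \<Rightarrow> (real^3) set set \<Rightarrow> nat \<Rightarrow> vfield set" where
  "nedelec1 \<Omega> \<T> k = Hcurl_0 \<Omega> \<inter> piecewise \<Omega> \<T> (ned_local k)"

definition nedelec2 :: "(real^3) set \<Rightarrow> (real^3) set set \<Rightarrow> nat \<Rightarrow> vfield set" where
  "nedelec2 \<Omega> \<T> k = Hcurl_0 \<Omega> \<inter> piecewise \<Omega> \<T> (vec_of (polys k))"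

definition raviart_thomas :: "(real^3) set \<Rightarrow> (real^3) set set \<Rightarrow> nat \<Rightarrow> vfield set" where
  "raviart_thomas \<Omega> \<T> k = Hdiv_0 \<Omega> \<inter> piecewise \<Omega> \<T> (rt_local k)"

definition bdm :: "(real^3) set \<Rightarrow> (real^3) set set \<Rightarrow> nat \<Rightarrow> vfield set" where
  "bdm \<Omega> \<T> k = Hdiv_0 \<Omega> \<inter> piecewise \<Omega> \<T> (vec_of (polys k))"

definition discontinuous :: "(real^3) set \<Rightarrow> (real^3) set set \<Rightarrow> nat \<Rightarrow> sfield set" where
  "discontinuous \<Omega> \<T> k = L2_0 \<Omega> \<inter> piecewise \<Omega> \<T> (polys k)"

text \<open>The four standard sequences that start with Lagrange elements of degree \<open>k\<close>: the Nedelec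
  space is of the first or second kind, the face space Raviart--Thomas or BDM. A full polynomial
  space loses one degree, which fixes the indices.\<close>

definition standard_fe_complex :: "(real^3) set \<Rightarrow> (real^3) set set \<Rightarrow>
    sfield set \<Rightarrow> vfield set \<Rightarrow> vfield set \<Rightarrow> sfield set \<Rightarrow> bool" where
  "standard_fe_complex \<Omega> \<T> G E D L \<longleftrightarrow> (\<exists>k. G = lagrange \<Omega> \<T> k \<and>
     (k \<ge> 1 \<and> E = nedelec1 \<Omega> \<T> k \<and> D = raviart_thomas \<Omega> \<T> k \<and> L = discontinuous \<Omega> \<T> (k - 1) \<or>
      k \<ge> 2 \<and> E = nedelec1 \<Omega> \<T> k \<and> D = bdm \<Omega> \<T> (k - 1) \<and> L = discontinuous \<Omega> \<T> (k - 2) \<or>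
      k \<ge> 2 \<and> E = nedelec2 \<Omega> \<T> (k - 1) \<and> D = raviart_thomas \<Omega> \<T> (k - 1) \<and>
        L = discontinuous \<Omega> \<T> (k - 2) \<or>
      k \<ge> 3 \<and> E = nedelec2 \<Omega> \<T> (k - 1) \<and> D = bdm \<Omega> \<T> (k - 2) \<and>
        L = discontinuous \<Omega> \<T> (k - 3)))"

text \<open>Exactness of \<open>0 \<rightarrow> G \<rightarrow> E \<rightarrow> D \<rightarrow> L \<rightarrow> 0\<close> modulo equality almost everywhere.\<close>

definition exact_complex :: "(real^3) set \<Rightarrow>
    sfield set \<Rightarrow> vfield set \<Rightarrow> vfield set \<Rightarrow> sfield set \<Rightarrow> bool" where
  "exact_complex \<Omega> G E D L \<longleftrightarrow>
     (\<forall>\<phi>\<in>G. grad \<Omega> \<phi> \<in> E) \<and> (\<forall>F\<in>E. curl \<Omega> F \<in> D) \<and> (\<forall>C\<in>D. dvg \<Omega> C \<in> L) \<and>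
     (\<forall>\<phi>\<in>G. ae_eq \<Omega> (grad \<Omega> \<phi>) 0 \<longleftrightarrow> ae_eq \<Omega> \<phi> 0) \<and>
     (\<forall>F\<in>E. ae_eq \<Omega> (curl \<Omega> F) 0 \<longleftrightarrow> (\<exists>\<phi>\<in>G. ae_eq \<Omega> F (grad \<Omega> \<phi>))) \<and>
     (\<forall>C\<in>D. ae_eq \<Omega> (dvg \<Omega> C) 0 \<longleftrightarrow> (\<exists>F\<in>E. ae_eq \<Omega> C (curl \<Omega> F))) \<and>
     (\<forall>s\<in>L. \<exists>C\<in>D. ae_eq \<Omega> s (dvg \<Omega> C))"

text \<open>Piecewise polynomials on a refinement are allowed so that macro-elements are covered.\<close>

definition stokes_fe_pair :: "(real^3) set \<Rightarrow> (real^3) set set \<Rightarrow> nat \<Rightarrow>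
    vfield set \<Rightarrow> sfield set \<Rightarrow> bool" where
  "stokes_fe_pair \<Omega> \<T> k V Q \<longleftrightarrow>
     subspace V \<and> V \<subseteq> H1_0_vec \<Omega> \<and> subspace Q \<and> Q \<subseteq> L2_0 \<Omega> \<and>
     (\<exists>\<T>'. simplicial_mesh \<Omega> \<T>' \<and> refines \<T>' \<T> \<and>
        V \<subseteq> piecewise \<Omega> \<T>' (vec_of (polys k)) \<and> Q \<subseteq> piecewise \<Omega> \<T>' (polys k))"

text \<open>Fields \<open>v = 0\<close> in \<open>V\<close> contribute the value \<open>0 / 0 = 0\<close>, which does not affect the
  supremum because \<open>V\<close> is symmetric.\<close>

definition inf_sup_stable :: "(real^3) set \<Rightarrow>
    ('i \<Rightarrow> vfield set) \<Rightarrow> ('i \<Rightarrow> sfield set) \<Rightarrow> bool" where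
  "inf_sup_stable \<Omega> V Q \<longleftrightarrow> (\<exists>\<beta>>0. \<forall>h. \<forall>q\<in>Q h.
     \<beta> * L2_norm \<Omega> q \<le> (SUP v\<in>V h. L2_inner \<Omega> (dvg \<Omega> v) q / H1_norm \<Omega> v))"


section \<open>Forms and norms\<close>

definition cross_field :: "vfield \<Rightarrow> vfield \<Rightarrow> vfield" where
  "cross_field u B = (\<lambda>x. cross3 (u x) (B x))"

definition convect :: "(real^3) set \<Rightarrow> vfield \<Rightarrow> vfield \<Rightarrow> vfield" where
  "convect \<Omega> w u = (\<lambda>x. jac \<Omega> u x *v w x)"

definition trilinear :: "(real^3) set \<Rightarrow> vfield \<Rightarrow> vfield \<Rightarrow> vfield \<Rightarrow> real" where
  "trilinear \<Omega> w u v = (L2_inner \<Omega> (convect \<Omega> w u) v - L2_inner \<Omega> (convect \<Omega> w v) u) / 2"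

definition a_form :: "(real^3) set \<Rightarrow> real \<Rightarrow> real \<Rightarrow> real \<Rightarrow> vfield \<Rightarrow> vfield \<Rightarrow>
    vfield \<times> vfield \<times> vfield \<Rightarrow> vfield \<times> vfield \<times> vfield \<Rightarrow> real" where
  "a_form \<Omega> Rey Rmag S um Bm = (\<lambda>(u, E, B) (v, F, C).
     trilinear \<Omega> um u v + inverse Rey * L2_inner \<Omega> (jac \<Omega> u) (jac \<Omega> v)
     + S * L2_inner \<Omega> (E + cross_field u Bm) (F + cross_field v Bm)
     - S / Rmag * L2_inner \<Omega> B (curl \<Omega> F) + S / Rmag * L2_inner \<Omega> (curl \<Omega> E) C)"

definition b_form :: "(real^3) set \<Rightarrow> vfield \<times> vfield \<times> vfield \<Rightarrow> sfield \<times> sfield \<Rightarrow> real" where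
  "b_form \<Omega> = (\<lambda>(v, F, C) (q, s). - L2_inner \<Omega> (dvg \<Omega> v) q + L2_inner \<Omega> (dvg \<Omega> C) s)"

definition X_norm :: "(real^3) set \<Rightarrow> vfield \<Rightarrow> vfield \<times> vfield \<times> vfield \<Rightarrow> real" where
  "X_norm \<Omega> Bm = (\<lambda>(v, F, C). sqrt ((L2_norm \<Omega> v)\<^sup>2 + (L2_norm \<Omega> (jac \<Omega> v))\<^sup>2
     + (L2_norm \<Omega> (curl \<Omega> F))\<^sup>2 + (L2_norm \<Omega> (F + cross_field v Bm))\<^sup>2
     + (L2_norm \<Omega> C)\<^sup>2 + (L2_norm \<Omega> (dvg \<Omega> C))\<^sup>2))"

definition Y_norm :: "(real^3) set \<Rightarrow> sfield \<times> sfield \<Rightarrow> real" where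
  "Y_norm \<Omega> = (\<lambda>(q, r). sqrt ((L2_norm \<Omega> q)\<^sup>2 + (L2_norm \<Omega> r)\<^sup>2))"

definition X_eq :: "(real^3) set \<Rightarrow>
    vfield \<times> vfield \<times> vfield \<Rightarrow> vfield \<times> vfield \<times> vfield \<Rightarrow> bool" where
  "X_eq \<Omega> = (\<lambda>(u, E, B) (u', E', B'). ae_eq \<Omega> u u' \<and> ae_eq \<Omega> E E' \<and> ae_eq \<Omega> B B')"

definition Y_eq :: "(real^3) set \<Rightarrow> sfield \<times> sfield \<Rightarrow> sfield \<times> sfield \<Rightarrow> bool" where
  "Y_eq \<Omega> = (\<lambda>(p, r) (p', r'). ae_eq \<Omega> p p' \<and> ae_eq \<Omega> r r')"

definition saddle_solution :: "(real^3) set \<Rightarrow> real \<Rightarrow> real \<Rightarrow> real \<Rightarrow> vfield \<Rightarrow> vfield \<Rightarrow>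
    (vfield \<times> vfield \<times> vfield) set \<Rightarrow> (sfield \<times> sfield) set \<Rightarrow>
    (vfield \<times> vfield \<times> vfield \<Rightarrow> real) \<Rightarrow> (sfield \<times> sfield \<Rightarrow> real) \<Rightarrow>
    vfield \<times> vfield \<times> vfield \<Rightarrow> sfield \<times> sfield \<Rightarrow> bool" where
  "saddle_solution \<Omega> Rey Rmag S um Bm X Y hf gf U x \<longleftrightarrow> U \<in> X \<and> x \<in> Y \<and>
     (\<forall>W\<in>X. \<forall>y\<in>Y. a_form \<Omega> Rey Rmag S um Bm U W + b_form \<Omega> W x = hf W \<and> b_form \<Omega> U y = gf y)"

definition picard_solution :: "(real^3) set \<Rightarrow> real \<Rightarrow> real \<Rightarrow> real \<Rightarrow> (vfield \<Rightarrow> real) \<Rightarrow>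
    vfield \<Rightarrow> vfield \<Rightarrow> (vfield \<times> vfield \<times> vfield) set \<Rightarrow> (sfield \<times> sfield) set \<Rightarrow>
    vfield \<times> vfield \<times> vfield \<Rightarrow> sfield \<times> sfield \<Rightarrow> bool" where
  "picard_solution \<Omega> Rey Rmag S f um Bm X Y = (\<lambda>(u, E, B) (p, r).
     (u, E, B) \<in> X \<and> (p, r) \<in> Y \<and>
     (let j = E + cross_field u Bm in
       \<forall>(v, F, C)\<in>X. \<forall>(q, s)\<in>Y.
         trilinear \<Omega> um u v + inverse Rey * L2_inner \<Omega> (jac \<Omega> u) (jac \<Omega> v)
           - S * L2_inner \<Omega> (cross_field j Bm) v - L2_inner \<Omega> p (dvg \<Omega> v) = f v \<and>
         S * L2_inner \<Omega> j F - S / Rmag * L2_inner \<Omega> B (curl \<Omega> F) = 0 \<and>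
         S / Rmag * L2_inner \<Omega> (curl \<Omega> E) C + L2_inner \<Omega> r (dvg \<Omega> C) = 0 \<and>
         - L2_inner \<Omega> (dvg \<Omega> u) q = 0 \<and>
         L2_inner \<Omega> (dvg \<Omega> B) s = 0))"

end

theory Submission
  imports Defs
begin

text \<open>
On a fixed mesh every space consists of piecewise polynomials, so \<open>X \<times> Y\<close> is
finite-dimensional once fields that agree almost everywhere are identified. The saddle point
problem, read as one bilinear form \<open>A\<close> on \<open>X \<times> Y\<close>, is then a square linear system, and everything
claimed, the bound included, follows from injectivity (\<open>injective_form_solvable\<close>): the solution is
a fixed linear combination of finitely many values of the data, and each of these values is
controlled by a dual norm.

Injectivity (\<open>A_injective\<close>) uses the structure of the equations. Let \<open>((u, E, B), (p, r))\<close> solve the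
homogeneous problem and test with \<open>((u, E, B), (- p, - r))\<close>. The convection term is skew-symmetric,
the two coupling terms of \<open>B\<close> and \<open>curl E\<close> cancel, and so do the constraint terms; what remains is
\<open>\<parallel>grad u\<parallel>\<^sup>2 / Rey + S \<parallel>E + u \<times> Bm\<parallel>\<^sup>2 = 0\<close>. The Poincare inequality gives \<open>u = 0\<close>, hence
\<open>E = 0\<close>. Since the divergence maps the face space into \<open>L\<close>, the magnetic constraint may be tested
with \<open>div B\<close> itself, so \<open>div B = 0\<close>; by exactness \<open>B = curl F\<close>, and the equation tested with \<open>F\<close>
says \<open>B = 0\<close>. Exactness at the end of the complex gives \<open>r = div C\<close>, and testing with \<open>C\<close> gives
\<open>r = 0\<close>. The inf-sup condition gives \<open>p = 0\<close>.

Since \<open>grad\<close>, \<open>curl\<close> and \<open>dvg\<close> choose some weak derivative, they are linear only up to null sets, and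
already this needs the uniqueness of weak derivatives. It rests on the fundamental lemma of the
calculus of variations (\<open>fundamental_lemma\<close>), proved with cutoffs built from \<open>exp (- 1 / t)\<close>. The
products with \<open>um\<close> and \<open>Bm\<close> are square integrable because a piecewise polynomial on a bounded
domain is bounded.

A Picard step is the saddle point problem with data \<open>f\<close> and \<open>0\<close>: testing with one component at a
time separates the equations, and \<open>(j, v \<times> Bm) = - (j \<times> Bm, v)\<close> turns the symmetric term
into the Lorentz force (\<open>picard_solution_iff_saddle_solution\<close>).
\<close>

section \<open>Bilinear forms on spaces of finite dimension modulo a null space\<close>

text \<open>Linearity is required only on a subspace \<open>Z\<close>: the forms below are built from representatives of
weak derivatives, which carry no information outside the finite element spaces.\<close>

definition linear_form_on :: "'a::real_vector set \<Rightarrow> ('a \<Rightarrow> real) \<Rightarrow> bool" where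
  "linear_form_on Z \<phi> \<longleftrightarrow> (\<forall>x\<in>Z. \<forall>y\<in>Z. \<phi> (x + y) = \<phi> x + \<phi> y) \<and> (\<forall>c. \<forall>x\<in>Z. \<phi> (c *\<^sub>R x) = c * \<phi> x)"

definition bilinear_form_on :: "'a::real_vector set \<Rightarrow> ('a \<Rightarrow> 'a \<Rightarrow> real) \<Rightarrow> bool" where
  "bilinear_form_on Z A \<longleftrightarrow> (\<forall>z\<in>Z. linear_form_on Z (A z)) \<and> (\<forall>w\<in>Z. linear_form_on Z (\<lambda>z. A z w))"

lemma linear_form_on_sum:
  assumes "subspace Z" "linear_form_on Z \<phi>" "finite I" "\<And>i. i \<in> I \<Longrightarrow> v i \<in> Z"
  shows "\<phi> (\<Sum>i\<in>I. a i *\<^sub>R v i) = (\<Sum>i\<in>I. a i * \<phi> (v i))"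
  using assms(3,4)
proof (induction I rule: finite_induct)
  case empty
  have "\<phi> (0 *\<^sub>R 0) = 0 * \<phi> 0"
    using assms(1,2) subspace_0 unfolding linear_form_on_def by blast
  then show ?case by simp
next
  case (insert i I)
  have "(\<Sum>i\<in>I. a i *\<^sub>R v i) \<in> Z" "a i *\<^sub>R v i \<in> Z"
    using insert assms(1) by (auto intro!: subspace_sum subspace_scale)
  then show ?case using insert assms(2) by (simp add: linear_form_on_def)
qed

lemma linear_form_on_diff:
  assumes "subspace Z" "linear_form_on Z \<phi>" "x \<in> Z" "y \<in> Z"
  shows "\<phi> (x - y) = \<phi> x - \<phi> y"
proof -
  have "\<phi> (x + (-1) *\<^sub>R y) = \<phi> x + \<phi> ((-1) *\<^sub>R y)" "\<phi> ((-1) *\<^sub>R y) = (-1) * \<phi> y"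
    using assms subspace_scale unfolding linear_form_on_def by blast+
  then show ?thesis by simp
qed

lemma inj_independent_if_relations_trivial:
  fixes v :: "'i \<Rightarrow> 'a::real_vector"
  assumes "finite I" and trivial: "\<And>a. (\<Sum>i\<in>I. a i *\<^sub>R v i) = 0 \<Longrightarrow> \<forall>i\<in>I. a i = 0"
  shows "inj_on v I" "independent (v ` I)"
proof -
  show inj: "inj_on v I"
  proof (rule inj_onI, rule ccontr)
    fix i j assume ij: "i \<in> I" "j \<in> I" "v i = v j" "i \<noteq> j"
    define a where "a k = (if k = i then 1 else if k = j then -1 else 0 :: real)" for k
    have "(\<Sum>k\<in>I. a k *\<^sub>R v k) = (\<Sum>k\<in>{i,j}. a k *\<^sub>R v k)"
      using assms(1) ij by (intro sum.mono_neutral_right) (auto simp: a_def)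
    also have "\<dots> = 0" using ij by (simp add: a_def)
    finally have "a i = 0" using trivial ij by blast
    then show False by (simp add: a_def)
  qed
  show "independent (v ` I)"
  proof (rule independent_if_scalars_zero)
    show "finite (v ` I)" using assms(1) by simp
    fix f x assume "(\<Sum>x\<in>v ` I. f x *\<^sub>R x) = 0" "x \<in> v ` I"
    then show "f x = 0" using trivial[of "\<lambda>i. f (v i)"] inj by (auto simp: sum.reindex)
  qed
qed

text \<open>The generators \<open>B\<close> need not lie in \<open>W\<close>: for a finite element space they will be polynomials cut off
outside pieces of the domain, which violate the continuity conditions across faces.\<close>

definition finite_dim_modulo :: "'a::real_vector set \<Rightarrow> 'a set \<Rightarrow> bool" where
  "finite_dim_modulo Null W \<longleftrightarrow> (\<exists>B. finite B \<and> (\<forall>w\<in>W. \<exists>m\<in>span B. w - m \<in> Null))"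

lemma finite_dim_modulo_subset: "finite_dim_modulo Null W \<Longrightarrow> W' \<subseteq> W \<Longrightarrow> finite_dim_modulo Null W'"
  unfolding finite_dim_modulo_def by (meson subsetD)

lemma finite_dim_modulo_Times:
  assumes "finite_dim_modulo N W" "finite_dim_modulo N' W'"
  shows "finite_dim_modulo (N \<times> N') (W \<times> W')"
proof -
  obtain B B' where B: "finite B" "\<And>w. w \<in> W \<Longrightarrow> \<exists>m\<in>span B. w - m \<in> N"
    and B': "finite B'" "\<And>w. w \<in> W' \<Longrightarrow> \<exists>m\<in>span B'. w - m \<in> N'"
    using assms unfolding finite_dim_modulo_def by blast
  define S where "S = (\<lambda>x. (x, 0 :: 'b)) ` B \<union> (\<lambda>x. (0 :: 'a, x)) ` B'"
  have "\<exists>m\<in>span S. (w, w') - m \<in> N \<times> N'" if "w \<in> W" "w' \<in> W'" for w w'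
  proof -
    from B(2)[OF that(1)] B'(2)[OF that(2)]
    obtain m m' where m: "m \<in> span B" "w - m \<in> N" "m' \<in> span B'" "w' - m' \<in> N'" by blast
    have "linear (\<lambda>x. (x, 0 :: 'b))" "linear (\<lambda>x. (0 :: 'a, x))" by (auto intro: linearI)
    then have "(m, 0) \<in> span ((\<lambda>x. (x, 0 :: 'b)) ` B)" "(0, m') \<in> span ((\<lambda>x. (0 :: 'a, x)) ` B')"
      using m(1,3) linear_span_image by blast+
    then have "(m, 0) \<in> span S" "(0, m') \<in> span S"
      using span_mono[of _ S] unfolding S_def by blast+
    then have "(m, 0) + (0, m') \<in> span S" by (rule span_add)
    then show ?thesis using m by (intro bexI[of _ "(m, m')"]) auto
  qed
  then show ?thesis
    using B(1) B'(1) unfolding finite_dim_modulo_def by (intro exI[of _ S]) (auto simp: S_def)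
qed

text \<open>A basis of the quotient \<open>Z / Null\<close>, with representatives in \<open>Z\<close>. The generators \<open>B\<close>
need not lie in \<open>Z\<close>, so they are no substitute for \<open>C\<close>. A largest family in \<open>Z\<close> without
nontrivial relations modulo \<open>Null\<close> exists, because elements of \<open>span B\<close> congruent to its members are
independent, which bounds its cardinality; by maximality it generates.\<close>

lemma basis_modulo_subspace:
  fixes Z Null :: "'a::real_vector set"
  assumes Z: "subspace Z" and Null: "subspace Null" and findim: "finite_dim_modulo Null Z"
  obtains C where "finite C" "C \<subseteq> Z"
    "\<And>a. (\<Sum>c\<in>C. a c *\<^sub>R c) \<in> Null \<Longrightarrow> \<forall>c\<in>C. a c = 0"
    "\<And>z. z \<in> Z \<Longrightarrow> \<exists>a. z - (\<Sum>c\<in>C. a c *\<^sub>R c) \<in> Null"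
proof -
  obtain B where B: "finite B" and span: "\<And>z. z \<in> Z \<Longrightarrow> \<exists>m\<in>span B. z - m \<in> Null"
    using findim unfolding finite_dim_modulo_def by blast
  define good where "good C \<longleftrightarrow> finite C \<and> C \<subseteq> Z \<and>
    (\<forall>a. (\<Sum>c\<in>C. a c *\<^sub>R c) \<in> Null \<longrightarrow> (\<forall>c\<in>C. a c = 0))" for C
  have bound: "card C \<le> card B" if "good C" for C
  proof -
    have C: "finite C" "C \<subseteq> Z" and ind: "\<And>a. (\<Sum>c\<in>C. a c *\<^sub>R c) \<in> Null \<Longrightarrow> \<forall>c\<in>C. a c = 0"
      using that by (auto simp: good_def)
    obtain m where m: "\<And>c. c \<in> C \<Longrightarrow> m c \<in> span B \<and> c - m c \<in> Null"
      using span C by (metis subsetD)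
    have ind_m: "\<forall>c\<in>C. a c = 0" if "(\<Sum>c\<in>C. a c *\<^sub>R m c) = 0" for a
    proof -
      have "(\<Sum>c\<in>C. a c *\<^sub>R (c - m c)) \<in> Null"
        using m Null by (auto intro!: subspace_sum subspace_scale)
      then have "(\<Sum>c\<in>C. a c *\<^sub>R c) \<in> Null"
        using that by (simp add: scaleR_diff_right sum_subtractf)
      then show ?thesis using ind by blast
    qed
    note m_basis = inj_independent_if_relations_trivial[of C m, OF C(1) ind_m]
    have "card (m ` C) \<le> card B"
      using independent_span_bound[OF B m_basis(2)] m by (metis image_subsetI)
    then show ?thesis using m_basis(1) by (simp add: card_image)
  qed
  have "good {}" by (simp add: good_def)
  moreover have "\<forall>C. good C \<longrightarrow> card C < Suc (card B)" using bound by (simp add: less_Suc_eq_le)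
  ultimately have "\<exists>C. good C \<and> (\<forall>C'. good C' \<longrightarrow> card C' \<le> card C)"
    by (rule ex_has_greatest_nat)
  then obtain C where C: "good C" "\<And>C'. good C' \<Longrightarrow> card C' \<le> card C" by blast
  show ?thesis
  proof
    show fin: "finite C" "C \<subseteq> Z"
      using C(1) by (auto simp: good_def)
    show ind: "\<forall>c\<in>C. a c = 0" if "(\<Sum>c\<in>C. a c *\<^sub>R c) \<in> Null" for a
      using C(1) that unfolding good_def by blast
    fix z assume z: "z \<in> Z"
    show "\<exists>a. z - (\<Sum>c\<in>C. a c *\<^sub>R c) \<in> Null"
    proof (cases "z \<in> C")
      case True
      have "(\<Sum>c\<in>C. (if c = z then 1 else 0) *\<^sub>R c) = (\<Sum>c\<in>C. if c = z then z else 0)"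
        by (rule sum.cong) auto
      also have "\<dots> = z" using True fin by simp
      finally show ?thesis
        using subspace_0[OF Null] by (intro exI[of _ "\<lambda>c. if c = z then 1 else 0"]) simp
    next
      case False
      then have "\<not> good (insert z C)" using C(2)[of "insert z C"] fin by auto
      then obtain a where a: "a z *\<^sub>R z + (\<Sum>c\<in>C. a c *\<^sub>R c) \<in> Null" "\<exists>c\<in>insert z C. a c \<noteq> 0"
        using fin z False by (auto simp: good_def)
      have "a z \<noteq> 0"
        using a ind[of a] by auto
      have "(1 / a z) *\<^sub>R (a z *\<^sub>R z + (\<Sum>c\<in>C. a c *\<^sub>R c)) \<in> Null"
        using a Null subspace_scale by blast
      moreover have "(1 / a z) *\<^sub>R (a z *\<^sub>R z + (\<Sum>c\<in>C. a c *\<^sub>R c))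
          = z - (\<Sum>c\<in>C. (- a c / a z) *\<^sub>R c)"
        using \<open>a z \<noteq> 0\<close> by (simp add: scaleR_add_right scaleR_sum_right sum_negf)
      ultimately show ?thesis by (intro exI[of _ "\<lambda>c. - a c / a z"]) simp
    qed
  qed
qed

text \<open>The rows \<open>F c\<close> are vectors with coordinates in \<open>C\<close>. A trivial kernel makes them independent; they
are as many as the unit vectors, hence span them.\<close>

lemma injective_system_solvable:
  fixes M :: "'a \<Rightarrow> 'a \<Rightarrow> real"
  assumes "finite C"
    and inj: "\<And>a. (\<And>d. d \<in> C \<Longrightarrow> (\<Sum>c\<in>C. a c * M c d) = 0) \<Longrightarrow> \<forall>c\<in>C. a c = 0"
  shows "\<exists>a. \<forall>d\<in>C. (\<Sum>c\<in>C. a c * M c d) = b d"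
proof -
  define e where "e c = (\<lambda>d. if d = c then 1 else 0 :: real)" for c :: 'a
  define F where "F c = (\<Sum>d\<in>C. M c d *\<^sub>R e d)" for c
  have F: "F c d = (if d \<in> C then M c d else 0)" for c d
  proof -
    have "F c d = (\<Sum>x\<in>C. M c x * e x d)"
      unfolding F_def using \<open>finite C\<close>
      by (induction C rule: finite_induct) (auto simp: scaleR_fun_def)
    also have "\<dots> = (\<Sum>x\<in>C. if x = d then M c d else 0)" by (rule sum.cong) (auto simp: e_def)
    finally show ?thesis using \<open>finite C\<close> by simp
  qed
  have comb: "(\<Sum>c\<in>C. a c *\<^sub>R F c) d = (if d \<in> C then \<Sum>c\<in>C. a c * M c d else 0)" for a d
  proof -
    have "(\<Sum>c\<in>I. a c *\<^sub>R F c) d = (\<Sum>c\<in>I. a c * F c d)" if "finite I" for I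
      using that by (induction I rule: finite_induct) (auto simp: scaleR_fun_def)
    then show ?thesis using \<open>finite C\<close> by (simp add: F)
  qed
  have ind: "\<forall>c\<in>C. a c = 0" if "(\<Sum>c\<in>C. a c *\<^sub>R F c) = 0" for a
    using inj[of a] comb[of a] that by (metis zero_fun_apply)
  note injF = inj_independent_if_relations_trivial(1)[of C F, OF \<open>finite C\<close> ind]
    and indF = inj_independent_if_relations_trivial(2)[of C F, OF \<open>finite C\<close> ind]
  have "F c \<in> span (e ` C)" for c
    unfolding F_def by (intro span_sum span_scale span_base) auto
  then have Fe: "F ` C \<subseteq> span (e ` C)" by blast
  define g where "g = (\<Sum>d\<in>C. b d *\<^sub>R e d)"
  have g: "g \<in> span (e ` C)"
    unfolding g_def by (intro span_sum span_scale span_base) auto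
  have gC: "g d = b d" if "d \<in> C" for d
  proof -
    have "g d = (\<Sum>x\<in>C. b x * e x d)"
      unfolding g_def using \<open>finite C\<close>
      by (induction C rule: finite_induct) (auto simp: scaleR_fun_def)
    also have "\<dots> = (\<Sum>x\<in>C. if x = d then b d else 0)" by (rule sum.cong) (auto simp: e_def)
    finally show ?thesis using \<open>finite C\<close> that by simp
  qed
  have "g \<in> span (F ` C)"
  proof (rule ccontr)
    assume n: "g \<notin> span (F ` C)"
    then have "g \<notin> F ` C" using span_base by metis
    have "independent (insert g (F ` C))"
      by (rule independent_insertI[OF n indF])
    then have "card (insert g (F ` C)) \<le> card (e ` C)"
      using independent_span_bound[of "e ` C" "insert g (F ` C)"] Fe g \<open>finite C\<close> by auto
    also have "\<dots> \<le> card C" using \<open>finite C\<close> by (rule card_image_le)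
    finally show False
      using \<open>g \<notin> F ` C\<close> \<open>finite C\<close> injF by (simp add: card_image)
  qed
  then obtain u where "g = (\<Sum>v\<in>F ` C. u v *\<^sub>R v)"
    using span_finite[of "F ` C"] \<open>finite C\<close> by auto
  then have "g = (\<Sum>c\<in>C. u (F c) *\<^sub>R F c)" using injF by (simp add: sum.reindex)
  then have "\<forall>d\<in>C. (\<Sum>c\<in>C. u (F c) * M c d) = b d"
    using comb[of "\<lambda>c. u (F c)"] gC by metis
  then show ?thesis by (rule exI[of _ "\<lambda>c. u (F c)"])
qed

text \<open>The abstract form of the theorem. A right-hand side \<open>\<phi>\<close> matters only through its values on a basis
\<open>C\<close> of \<open>Z / Null\<close>, so \<open>\<Sum> \<phi> c * s c\<close> is a solution when \<open>s c\<close> solves the problem with the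
coordinate functional of \<open>c\<close> as data. This formula shows at once that the constant does not depend
on \<open>\<phi>\<close>.\<close>

lemma injective_form_solvable:
  fixes Z Null :: "'a::real_vector set" and A :: "'a \<Rightarrow> 'a \<Rightarrow> real"
  assumes Z: "subspace Z" and Null: "subspace Null" and findim: "finite_dim_modulo Null Z"
    and A: "bilinear_form_on Z A"
    and A_Null: "\<And>z n. z \<in> Z \<Longrightarrow> n \<in> Z \<inter> Null \<Longrightarrow> A z n = 0"
    and inj: "\<And>z. z \<in> Z \<Longrightarrow> (\<And>w. w \<in> Z \<Longrightarrow> A z w = 0) \<Longrightarrow> z \<in> Null"
    and N_nonneg: "\<And>z. z \<in> Z \<Longrightarrow> 0 \<le> N z"
    and N_add: "\<And>z w. z \<in> Z \<Longrightarrow> w \<in> Z \<Longrightarrow> N (z + w) \<le> N z + N w"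
    and N_scale: "\<And>a z. z \<in> Z \<Longrightarrow> N (a *\<^sub>R z) = \<bar>a\<bar> * N z"
    and N_Null: "\<And>n. n \<in> Z \<inter> Null \<Longrightarrow> N n = 0"
  shows "\<exists>c>0. \<forall>\<phi> D. linear_form_on Z \<phi> \<longrightarrow> (\<forall>w\<in>Z. \<bar>\<phi> w\<bar> \<le> D * N w) \<longrightarrow> 0 \<le> D \<longrightarrow>
           (\<exists>z\<in>Z. (\<forall>w\<in>Z. A z w = \<phi> w) \<and> N z \<le> c * D)"
proof -
  obtain C where C: "finite C" "C \<subseteq> Z"
    and ind: "\<And>a. (\<Sum>c\<in>C. a c *\<^sub>R c) \<in> Null \<Longrightarrow> \<forall>c\<in>C. a c = 0"
    and rep: "\<And>z. z \<in> Z \<Longrightarrow> \<exists>a. z - (\<Sum>c\<in>C. a c *\<^sub>R c) \<in> Null"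
    using basis_modulo_subspace[OF Z Null findim] by blast
  have combZ: "(\<Sum>c\<in>C. a c *\<^sub>R v c) \<in> Z" if "\<And>c. c \<in> C \<Longrightarrow> v c \<in> Z" for a v
    using that Z by (auto intro!: subspace_sum subspace_scale)
  have C_in: "c \<in> Z" if "c \<in> C" for c using C that by blast
  have lin1: "linear_form_on Z (A z)" if "z \<in> Z" for z
    using A that by (simp add: bilinear_form_on_def)
  have lin2: "linear_form_on Z (\<lambda>z. A z w)" if "w \<in> Z" for w
    using A that by (simp add: bilinear_form_on_def)
  have agree: "\<psi> w = \<phi> w" if w: "w \<in> Z" and \<phi>: "linear_form_on Z \<phi>" "linear_form_on Z \<psi>"
    and eqC: "\<And>d. d \<in> C \<Longrightarrow> \<psi> d = \<phi> d"
    and null: "\<And>n. n \<in> Z \<inter> Null \<Longrightarrow> \<psi> n = 0" "\<And>n. n \<in> Z \<inter> Null \<Longrightarrow> \<phi> n = 0" for \<phi> \<psi> w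
  proof -
    obtain a where a: "w - (\<Sum>c\<in>C. a c *\<^sub>R c) \<in> Null" using rep w by blast
    have s: "(\<Sum>c\<in>C. a c *\<^sub>R c) \<in> Z" using combZ[of "\<lambda>c. c"] C_in by simp
    then have n: "w - (\<Sum>c\<in>C. a c *\<^sub>R c) \<in> Z \<inter> Null" using a w Z subspace_diff by blast
    have "\<psi> w = \<psi> (\<Sum>c\<in>C. a c *\<^sub>R c)"
      using null(1)[OF n] linear_form_on_diff[OF Z \<phi>(2) w s] by simp
    also have "\<dots> = \<phi> (\<Sum>c\<in>C. a c *\<^sub>R c)"
      using linear_form_on_sum[OF Z \<phi>(1) C(1), of "\<lambda>c. c" a]
        linear_form_on_sum[OF Z \<phi>(2) C(1), of "\<lambda>c. c" a] C_in eqC by simp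
    also have "\<dots> = \<phi> w"
      using null(2)[OF n] linear_form_on_diff[OF Z \<phi>(1) w s] by simp
    finally show ?thesis .
  qed
  have zero_form: "linear_form_on Z (\<lambda>_. 0)" by (simp add: linear_form_on_def)
  have "\<exists>a. \<forall>d\<in>C. (\<Sum>c\<in>C. a c * A c d) = b d" for b
  proof (rule injective_system_solvable[OF C(1)])
    fix a assume zero: "\<And>d. d \<in> C \<Longrightarrow> (\<Sum>c\<in>C. a c * A c d) = 0"
    let ?z = "\<Sum>c\<in>C. a c *\<^sub>R c"
    have zZ: "?z \<in> Z" using combZ[of "\<lambda>c. c"] C_in by simp
    have "A ?z d = 0" if "d \<in> C" for d
      using linear_form_on_sum[OF Z lin2[OF C_in[OF that]] C(1), of "\<lambda>c. c" a] C_in zero[OF that]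
      by simp
    then have "A ?z w = 0" if "w \<in> Z" for w
      using agree[OF that zero_form lin1[OF zZ]] A_Null[OF zZ] by blast
    then show "\<forall>c\<in>C. a c = 0" using inj[OF zZ] ind by blast
  qed
  then have solve: "\<exists>z\<in>Z. \<forall>d\<in>C. A z d = b d" for b
  proof -
    obtain a where a: "\<forall>d\<in>C. (\<Sum>c\<in>C. a c * A c d) = b d"
      using \<open>\<exists>a. \<forall>d\<in>C. (\<Sum>c\<in>C. a c * A c d) = b d\<close> by blast
    have "A (\<Sum>c\<in>C. a c *\<^sub>R c) d = b d" if "d \<in> C" for d
      using linear_form_on_sum[OF Z lin2[OF C_in[OF that]] C(1), of "\<lambda>c. c" a] C_in a that by simp
    then have "\<forall>d\<in>C. A (\<Sum>c\<in>C. a c *\<^sub>R c) d = b d" by blast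
    then show ?thesis
      by (rule bexI) (use combZ[of "\<lambda>c. c" a] C_in in simp)
  qed
  have "\<exists>z\<in>Z. \<forall>d\<in>C. A z d = (if d = c then 1 else 0)" for c
    by (rule solve)
  then obtain s where s: "\<And>c. s c \<in> Z" "\<And>c d. d \<in> C \<Longrightarrow> A (s c) d = (if d = c then 1 else 0)"
    by metis
  \<comment> \<open>the summand \<open>1\<close> only makes the constant positive\<close>
  define K where "K = (\<Sum>c\<in>C. N c * N (s c)) + 1"
  have "0 \<le> (\<Sum>c\<in>C. N c * N (s c))" using N_nonneg s C_in by (auto intro!: sum_nonneg)
  then have "K > 0" by (simp add: K_def)
  have "\<exists>z\<in>Z. (\<forall>w\<in>Z. A z w = \<phi> w) \<and> N z \<le> K * D"
    if \<phi>: "linear_form_on Z \<phi>" and bd: "\<forall>w\<in>Z. \<bar>\<phi> w\<bar> \<le> D * N w" and D: "0 \<le> D" for \<phi> D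
  proof -
    let ?z = "\<Sum>c\<in>C. \<phi> c *\<^sub>R s c"
    have zZ: "?z \<in> Z" using combZ[of s] s by simp
    have "A ?z d = \<phi> d" if "d \<in> C" for d
    proof -
      have "A ?z d = (\<Sum>c\<in>C. \<phi> c * A (s c) d)"
        using linear_form_on_sum[OF Z lin2[OF C_in[OF that]] C(1), of s \<phi>] s by simp
      also have "\<dots> = (\<Sum>c\<in>C. if c = d then \<phi> d else 0)"
        using s that by (intro sum.cong) auto
      finally show ?thesis using C that by simp
    qed
    moreover have "\<phi> n = 0" if "n \<in> Z \<inter> Null" for n
      using bd N_Null[OF that] that by fastforce
    ultimately have sol: "A ?z w = \<phi> w" if "w \<in> Z" for w
      using agree[OF that \<phi> lin1[OF zZ]] A_Null[OF zZ] by blast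
    have "N (\<Sum>c\<in>I. \<phi> c *\<^sub>R s c) \<le> (\<Sum>c\<in>I. \<bar>\<phi> c\<bar> * N (s c))" if "finite I" "I \<subseteq> C" for I
      using that
    proof (induction I rule: finite_induct)
      case empty
      then show ?case using N_scale[OF subspace_0[OF Z], of 0] by simp
    next
      case (insert i I)
      have "(\<Sum>c\<in>I. \<phi> c *\<^sub>R s c) \<in> Z" "\<phi> i *\<^sub>R s i \<in> Z"
        using s Z by (auto intro!: subspace_sum subspace_scale)
      then have "N (\<phi> i *\<^sub>R s i + (\<Sum>c\<in>I. \<phi> c *\<^sub>R s c)) \<le> \<bar>\<phi> i\<bar> * N (s i) + N (\<Sum>c\<in>I. \<phi> c *\<^sub>R s c)"
        using N_add N_scale[OF s(1)] by metis
      then show ?case using insert by simp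
    qed
    then have "N ?z \<le> (\<Sum>c\<in>C. \<bar>\<phi> c\<bar> * N (s c))" using C by blast
    also have "\<dots> \<le> (\<Sum>c\<in>C. (D * N c) * N (s c))"
      using bd C_in N_nonneg s by (intro sum_mono mult_right_mono) auto
    also have "\<dots> = D * (K - 1)" by (simp add: K_def sum_distrib_left mult.assoc)
    also have "\<dots> \<le> K * D"
      using D by (simp add: algebra_simps)
    finally show ?thesis using sol zZ by blast
  qed
  then show ?thesis using \<open>K > 0\<close> by blast
qed

lemma bilinear_form_on_symmetricI:
  assumes "\<And>x y. Q x y = Q y x" "\<And>x. x \<in> W \<Longrightarrow> linear_form_on W (Q x)"
  shows "bilinear_form_on W Q"
  using assms unfolding bilinear_form_on_def by (metis (no_types, lifting) ext)

text \<open>The form may be degenerate, so \<open>Q y y = 0\<close> has to be treated apart: then \<open>t \<mapsto> Q (x + t y) (x + t y)\<close>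
is affine, and it can stay nonnegative only if its slope vanishes.\<close>

lemma psd_Cauchy_Schwarz:
  assumes W: "subspace W" and Q: "bilinear_form_on W Q"
    and sym: "\<And>x y. Q x y = Q y x" and psd: "\<And>x. x \<in> W \<Longrightarrow> 0 \<le> Q x x"
    and xy: "x \<in> W" "y \<in> W"
  shows "\<bar>Q x y\<bar> \<le> sqrt (Q x x) * sqrt (Q y y)"
proof -
  have add: "Q u (v + w) = Q u v + Q u w" and sc: "Q u (c *\<^sub>R v) = c * Q u v"
    if "u \<in> W" "v \<in> W" "w \<in> W" for u v w c
    using Q that by (auto simp: bilinear_form_on_def linear_form_on_def)
  have quad: "0 \<le> Q x x + 2 * t * Q x y + t\<^sup>2 * Q y y" for t
  proof -
    have m: "t *\<^sub>R y \<in> W" using W xy by (simp add: subspace_scale)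
    then have mm: "x + t *\<^sub>R y \<in> W" using W xy by (simp add: subspace_add)
    have "Q (x + t *\<^sub>R y) (x + t *\<^sub>R y) = Q (x + t *\<^sub>R y) x + t * Q (x + t *\<^sub>R y) y"
      using add[OF mm xy(1) m] sc[OF mm xy(2) xy(2)] by simp
    also have "\<dots> = Q x (x + t *\<^sub>R y) + t * Q y (x + t *\<^sub>R y)" by (simp add: sym)
    also have "\<dots> = Q x x + t * Q x y + t * (Q x y + t * Q y y)"
      using add[OF xy(1) xy(1) m] sc[OF xy(1) xy(2) xy(2)] add[OF xy(2) xy(1) m]
        sc[OF xy(2) xy(2) xy(2)] by (simp add: sym)
    finally show ?thesis using psd[OF mm] by (simp add: algebra_simps power2_eq_square)
  qed
  have "(Q x y)\<^sup>2 \<le> Q x x * Q y y"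
  proof (cases "Q y y = 0")
    case True
    have "Q x y = 0"
    proof (rule ccontr)
      assume "Q x y \<noteq> 0"
      \<comment> \<open>chosen to make the affine function equal to \<open>- 1\<close>\<close>
      define t where "t = - (Q x x + 1) / (2 * Q x y)"
      have "2 * t * Q x y = - (Q x x + 1)" using \<open>Q x y \<noteq> 0\<close> by (simp add: t_def)
      moreover have "0 \<le> Q x x + 2 * t * Q x y" using quad[of t] True by simp
      ultimately show False by linarith
    qed
    then show ?thesis using True by simp
  next
    case False
    then have p: "Q y y > 0" using psd[OF xy(2)] by simp
    have "0 \<le> (Q x x + 2 * (- Q x y / Q y y) * Q x y + (- Q x y / Q y y)\<^sup>2 * Q y y) * Q y y"
      by (intro mult_nonneg_nonneg quad psd xy)
    also have "\<dots> = Q x x * Q y y - (Q x y)\<^sup>2"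
      using p by (simp add: field_simps power2_eq_square)
    finally show ?thesis by simp
  qed
  then have "sqrt ((Q x y)\<^sup>2) \<le> sqrt (Q x x * Q y y)" by (rule real_sqrt_le_mono)
  then show ?thesis by (simp add: real_sqrt_mult)
qed

lemma psd_triangle:
  assumes W: "subspace W" and Q: "bilinear_form_on W Q"
    and sym: "\<And>x y. Q x y = Q y x" and psd: "\<And>x. x \<in> W \<Longrightarrow> 0 \<le> Q x x"
    and xy: "x \<in> W" "y \<in> W"
  shows "sqrt (Q (x + y) (x + y)) \<le> sqrt (Q x x) + sqrt (Q y y)"
proof (rule real_le_lsqrt)
  have add: "Q u (v + w) = Q u v + Q u w" if "u \<in> W" "v \<in> W" "w \<in> W" for u v w
    using Q that by (auto simp: bilinear_form_on_def linear_form_on_def)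
  have "x + y \<in> W" using W xy by (simp add: subspace_add)
  then have "Q (x + y) (x + y) = Q x (x + y) + Q y (x + y)"
    using add[of "x + y" x y] xy sym by simp
  also have "\<dots> = Q x x + 2 * Q x y + Q y y"
    using add[of x x y] add[of y x y] xy sym[of x y] by simp
  also have "\<dots> \<le> Q x x + 2 * (sqrt (Q x x) * sqrt (Q y y)) + Q y y"
    using psd_Cauchy_Schwarz[OF assms] by auto
  also have "\<dots> = (sqrt (Q x x) + sqrt (Q y y))\<^sup>2"
    using psd xy by (simp add: power2_sum)
  finally show "Q (x + y) (x + y) \<le> (sqrt (Q x x) + sqrt (Q y y))\<^sup>2" .
  show "0 \<le> sqrt (Q x x) + sqrt (Q y y)" using psd xy by simp
qed

text \<open>Where \<open>N x = 0\<close> the vector cannot be normalized; there \<open>\<phi>\<close> vanishes by boundedness.\<close>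

lemma dual_norm_bound:
  assumes W: "subspace W" and \<phi>: "\<phi> \<in> dual_space W N"
    and nonneg: "\<And>x. x \<in> W \<Longrightarrow> 0 \<le> N x"
    and scale: "\<And>c x. x \<in> W \<Longrightarrow> N (c *\<^sub>R x) = \<bar>c\<bar> * N x"
  shows "x \<in> W \<Longrightarrow> \<bar>\<phi> x\<bar> \<le> dual_norm W N \<phi> * N x" "0 \<le> dual_norm W N \<phi>"
proof -
  obtain M where M: "\<And>x. x \<in> W \<Longrightarrow> \<bar>\<phi> x\<bar> \<le> M * N x" and sc: "\<And>c x. x \<in> W \<Longrightarrow> \<phi> (c *\<^sub>R x) = c * \<phi> x"
    using \<phi> unfolding dual_space_def mem_Collect_eq by metis
  have bdd: "bdd_above ((\<lambda>x. \<bar>\<phi> x\<bar>) ` {x\<in>W. N x \<le> 1})"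
  proof (rule bdd_aboveI2)
    fix x assume "x \<in> {x\<in>W. N x \<le> 1}"
    then have x: "x \<in> W" "N x \<le> 1" by auto
    have "\<bar>\<phi> x\<bar> \<le> M * N x" using M x by blast
    also have "\<dots> \<le> \<bar>M\<bar> * 1" using x nonneg by (intro mult_mono) auto
    finally show "\<bar>\<phi> x\<bar> \<le> \<bar>M\<bar>" by simp
  qed
  have le: "\<bar>\<phi> x\<bar> \<le> dual_norm W N \<phi>" if "x \<in> W" "N x \<le> 1" for x
    unfolding dual_norm_def using that bdd by (intro cSUP_upper) auto
  have N0: "N 0 = 0" using scale[of 0 0] subspace_0[OF W] by simp
  show "0 \<le> dual_norm W N \<phi>" using le[of 0] N0 subspace_0[OF W] abs_ge_zero[of "\<phi> 0"] by linarith
  show "\<bar>\<phi> x\<bar> \<le> dual_norm W N \<phi> * N x" if x: "x \<in> W"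
  proof (cases "N x = 0")
    case True then show ?thesis using M[OF x] by simp
  next
    case False
    then have p: "N x > 0" using nonneg[OF x] by simp
    have "\<bar>\<phi> ((1 / N x) *\<^sub>R x)\<bar> \<le> dual_norm W N \<phi>"
      using x W p scale by (intro le) (auto intro: subspace_scale)
    then show ?thesis using p by (simp add: sc[OF x] abs_mult field_simps)
  qed
qed

section \<open>Square-integrable fields modulo null sets\<close>

locale domain =
  fixes \<Omega> :: "(real^3) set"
begin

abbreviation "\<mu> \<equiv> lebesgue_on \<Omega>"
abbreviation "ip \<equiv> L2_inner \<Omega>"
abbreviation "nrm \<equiv> L2_norm \<Omega>"
abbreviation "ae \<equiv> ae_eq \<Omega>"

lemma AE_lebesgue_on_iff:
  assumes "open \<Omega>"
  shows "(AE x in \<mu>. P x) \<longleftrightarrow> (AE x in lebesgue. x \<in> \<Omega> \<longrightarrow> P x)"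
  using assms by (subst AE_restrict_space_iff) auto

lemma L2_measurable: "f \<in> L2 \<Omega> \<Longrightarrow> f \<in> borel_measurable \<mu>"
  by (simp add: L2_def)

lemma L2_square_integrable: "f \<in> L2 \<Omega> \<Longrightarrow> integrable \<mu> (\<lambda>x. (norm (f x))\<^sup>2)"
  by (simp add: L2_def)

lemma L2_inner_integrable:
  assumes "f \<in> L2 \<Omega>" "g \<in> L2 \<Omega>"
  shows "integrable \<mu> (\<lambda>x. f x \<bullet> g x)"
proof (rule Bochner_Integration.integrable_bound)
  show "integrable \<mu> (\<lambda>x. (norm (f x))\<^sup>2 + (norm (g x))\<^sup>2)"
    by (intro Bochner_Integration.integrable_add L2_square_integrable assms)
  show "(\<lambda>x. f x \<bullet> g x) \<in> borel_measurable \<mu>"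
    using L2_measurable[OF assms(1)] L2_measurable[OF assms(2)] by measurable
  have "\<bar>f x \<bullet> g x\<bar> \<le> (norm (f x))\<^sup>2 + (norm (g x))\<^sup>2" for x
  proof -
    have "\<bar>f x \<bullet> g x\<bar> \<le> norm (f x) * norm (g x)" by (rule Cauchy_Schwarz_ineq2)
    also have "\<dots> \<le> (norm (f x))\<^sup>2 + (norm (g x))\<^sup>2"
      using sum_squares_bound[of "norm (f x)" "norm (g x)"]
        mult_nonneg_nonneg[OF norm_ge_zero[of "f x"] norm_ge_zero[of "g x"]] by linarith
    finally show ?thesis .
  qed
  then show "AE x in \<mu>. norm (f x \<bullet> g x) \<le> norm ((norm (f x))\<^sup>2 + (norm (g x))\<^sup>2)"
    by simp
qed

lemma L2_bound:
  assumes "f \<in> L2 \<Omega>" "g \<in> borel_measurable \<mu>"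
    and "AE x in \<mu>. norm (g x) \<le> K * norm (f x)"
  shows "g \<in> L2 \<Omega>"
proof -
  have "integrable \<mu> (\<lambda>x. (norm (g x))\<^sup>2)"
  proof (rule Bochner_Integration.integrable_bound)
    show "integrable \<mu> (\<lambda>x. K\<^sup>2 * (norm (f x))\<^sup>2)"
      using L2_square_integrable[OF assms(1)] by simp
    show "(\<lambda>x. (norm (g x))\<^sup>2) \<in> borel_measurable \<mu>"
      using assms by auto
    show "AE x in \<mu>. norm ((norm (g x))\<^sup>2) \<le> norm (K\<^sup>2 * (norm (f x))\<^sup>2)"
      using assms(3)
    proof eventually_elim
      case (elim x)
      then have "(norm (g x))\<^sup>2 \<le> (K * norm (f x))\<^sup>2" by (intro power_mono) auto
      then show ?case by (simp add: power_mult_distrib)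
    qed
  qed
  then show ?thesis using assms by (simp add: L2_def)
qed

lemma L2_add:
  assumes "f \<in> L2 \<Omega>" "g \<in> L2 \<Omega>"
  shows "f + g \<in> L2 \<Omega>"
proof -
  have "integrable \<mu> (\<lambda>x. (norm (f x))\<^sup>2 + (norm (g x))\<^sup>2 + 2 * (f x \<bullet> g x))"
    using L2_inner_integrable[OF assms]
    by (intro Bochner_Integration.integrable_add integrable_mult_right L2_square_integrable assms)
  moreover have "(norm (f x))\<^sup>2 + (norm (g x))\<^sup>2 + 2 * (f x \<bullet> g x) = (norm ((f + g) x))\<^sup>2" for x
    by (simp add: power2_norm_eq_inner inner_add_left inner_add_right inner_commute)
  moreover have "f + g \<in> borel_measurable \<mu>"
    unfolding plus_fun_def by (intro borel_measurable_add L2_measurable assms)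
  ultimately show ?thesis by (simp add: L2_def)
qed

lemma L2_scaleR:
  assumes "f \<in> L2 \<Omega>"
  shows "c *\<^sub>R f \<in> L2 \<Omega>"
proof (rule L2_bound[OF assms])
  show "c *\<^sub>R f \<in> borel_measurable \<mu>"
    unfolding scaleR_fun_def using L2_measurable[OF assms] by simp
  show "AE x in \<mu>. norm ((c *\<^sub>R f) x) \<le> \<bar>c\<bar> * norm (f x)"
    by (simp add: scaleR_fun_def)
qed

lemma subspace_L2: "subspace (L2 \<Omega>)"
proof (rule subspaceI)
  show "0 \<in> L2 \<Omega>" by (simp add: L2_def zero_fun_def)
qed (rule L2_add L2_scaleR; assumption)+

lemmas L2_diff = subspace_diff[OF subspace_L2]

lemma L2_bounded:
  assumes "bounded \<Omega>" "open \<Omega>" "f \<in> borel_measurable \<mu>"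
    "AE x in \<mu>. norm (f x) \<le> M"
  shows "f \<in> L2 \<Omega>"
proof -
  have \<Omega>: "\<Omega> \<in> lmeasurable" using assms by (simp add: lmeasurable_open)
  have "emeasure \<mu> \<Omega> < \<infinity>"
    using \<Omega> by (subst emeasure_restrict_space) (auto simp: fmeasurable_def)
  moreover have "AE x in \<mu>. norm ((norm (f x))\<^sup>2) \<le> M\<^sup>2"
    using assms(4) by eventually_elim (simp add: power_mono)
  moreover have "\<Omega> \<in> sets \<mu>" using \<Omega> by (auto simp: sets_restrict_space)
  ultimately have "integrable \<mu> (\<lambda>x. (norm (f x))\<^sup>2)"
    using assms(3) by (intro integrableI_bounded_set[where A = \<Omega> and B = "M\<^sup>2"]) auto
  then show ?thesis using assms(3) by (simp add: L2_def)
qed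

lemma L2_inner_commute: "ip f g = ip g f"
  unfolding L2_inner_def by (simp add: inner_commute)

lemma L2_inner_self_nonneg: "0 \<le> ip f f"
  unfolding L2_inner_def by (rule Bochner_Integration.integral_nonneg) simp

lemma bilinear_form_on_L2_inner:
  "bilinear_form_on (L2 \<Omega> :: (real^3 \<Rightarrow> 'a::euclidean_space) set) (ip)"
proof (rule bilinear_form_on_symmetricI[OF L2_inner_commute])
  fix f :: "real^3 \<Rightarrow> 'a" assume f: "f \<in> L2 \<Omega>"
  show "linear_form_on (L2 \<Omega>) (ip f)"
    unfolding linear_form_on_def L2_inner_def
  proof (intro conjI ballI allI)
    fix g h :: "real^3 \<Rightarrow> 'a" assume "g \<in> L2 \<Omega>" "h \<in> L2 \<Omega>"
    then show "(LINT x|\<mu>. f x \<bullet> (g + h) x)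
        = (LINT x|\<mu>. f x \<bullet> g x) + (LINT x|\<mu>. f x \<bullet> h x)"
      using L2_inner_integrable[OF f] by (simp add: inner_add_right)
  next
    fix c and g :: "real^3 \<Rightarrow> 'a"
    show "(LINT x|\<mu>. f x \<bullet> (c *\<^sub>R g) x) = c * (LINT x|\<mu>. f x \<bullet> g x)"
      by (simp add: scaleR_fun_def)
  qed
qed

lemma L2_inner_ae_cong:
  assumes "f \<in> L2 \<Omega>" "f' \<in> L2 \<Omega>" "g \<in> L2 \<Omega>" "g' \<in> L2 \<Omega>" "ae f f'" "ae g g'"
  shows "ip f g = ip f' g'"
  unfolding L2_inner_def
proof (rule integral_cong_AE)
  show "AE x in \<mu>. f x \<bullet> g x = f' x \<bullet> g' x"
    using assms(5,6) unfolding ae_eq_def by eventually_elim simp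
qed (intro borel_measurable_inner L2_measurable assms)+

lemma L2_norm_nonneg [simp]: "0 \<le> nrm f"
  by (simp add: L2_norm_def L2_inner_self_nonneg)

lemma L2_norm_power2: "(nrm f)\<^sup>2 = ip f f"
  by (simp add: L2_norm_def L2_inner_self_nonneg)

lemma L2_inner_self_eq_0_iff:
  assumes "f \<in> L2 \<Omega>"
  shows "ip f f = 0 \<longleftrightarrow> ae f 0"
proof -
  have "(LINT x|\<mu>. f x \<bullet> f x) = 0 \<longleftrightarrow> (AE x in \<mu>. f x \<bullet> f x = 0)"
    using L2_inner_integrable[OF assms assms] by (rule integral_nonneg_eq_0_iff_AE) simp
  then show ?thesis by (simp add: L2_inner_def ae_eq_def)
qed

lemma L2_norm_eq_0_iff: "f \<in> L2 \<Omega> \<Longrightarrow> nrm f = 0 \<longleftrightarrow> ae f 0"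
  using L2_inner_self_eq_0_iff by (simp add: L2_norm_def)

lemma L2_Cauchy_Schwarz:
  "f \<in> L2 \<Omega> \<Longrightarrow> g \<in> L2 \<Omega> \<Longrightarrow> \<bar>ip f g\<bar> \<le> nrm f * nrm g"
  unfolding L2_norm_def
  by (rule psd_Cauchy_Schwarz[OF subspace_L2 bilinear_form_on_L2_inner L2_inner_commute L2_inner_self_nonneg])

lemma L2_norm_triangle:
  "f \<in> L2 \<Omega> \<Longrightarrow> g \<in> L2 \<Omega> \<Longrightarrow> nrm (f + g) \<le> nrm f + nrm g"
  unfolding L2_norm_def
  by (rule psd_triangle[OF subspace_L2 bilinear_form_on_L2_inner L2_inner_commute L2_inner_self_nonneg])

lemma L2_norm_scaleR: "nrm (c *\<^sub>R f) = \<bar>c\<bar> * nrm f"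
proof -
  have "ip (c *\<^sub>R f) (c *\<^sub>R f) = c\<^sup>2 * ip f f"
    by (simp add: L2_inner_def scaleR_fun_def power2_eq_square mult.assoc)
  then show ?thesis by (simp add: L2_norm_def real_sqrt_mult)
qed

lemma measurable_vec_iff:
  fixes f :: "'a \<Rightarrow> 'b::euclidean_space^'n"
  shows "f \<in> borel_measurable M \<longleftrightarrow> (\<forall>i. (\<lambda>x. f x $ i) \<in> borel_measurable M)"
proof (intro iffI allI)
  fix i assume "f \<in> borel_measurable M"
  then show "(\<lambda>x. f x $ i) \<in> borel_measurable M"
    by (rule borel_measurable_continuous_on[rotated]) (intro continuous_intros)
next
  assume *: "\<forall>i. (\<lambda>x. f x $ i) \<in> borel_measurable M"
  show "f \<in> borel_measurable M"
  proof (rule borel_measurable_euclidean_space[THEN iffD2], intro ballI)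
    fix b :: "'b^'n" assume "b \<in> Basis"
    have "(\<lambda>x. f x \<bullet> b) = (\<lambda>x. \<Sum>i\<in>UNIV. f x $ i \<bullet> b $ i)" by (simp add: inner_vec_def)
    moreover have "(\<lambda>x. f x $ i \<bullet> b $ i) \<in> borel_measurable M" for i
      using *[rule_format, of i] by measurable
    ultimately show "(\<lambda>x. f x \<bullet> b) \<in> borel_measurable M" by simp
  qed
qed

lemma L2_vec_iff:
  fixes f :: "real^3 \<Rightarrow> 'b::euclidean_space^'n"
  shows "f \<in> L2 \<Omega> \<longleftrightarrow> (\<forall>i. (\<lambda>x. f x $ i) \<in> L2 \<Omega>)"
proof (intro iffI allI)
  fix i assume f: "f \<in> L2 \<Omega>"
  show "(\<lambda>x. f x $ i) \<in> L2 \<Omega>"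
  proof (rule L2_bound[OF f])
    show "(\<lambda>x. f x $ i) \<in> borel_measurable \<mu>"
      using L2_measurable[OF f] measurable_vec_iff by blast
    show "AE x in \<mu>. norm (f x $ i) \<le> 1 * norm (f x)"
      using Finite_Cartesian_Product.norm_nth_le[of "f _" i] by simp
  qed
next
  assume *: "\<forall>i. (\<lambda>x. f x $ i) \<in> L2 \<Omega>"
  have "(norm (f x))\<^sup>2 = (\<Sum>i\<in>UNIV. (norm (f x $ i))\<^sup>2)" for x
    by (simp add: norm_vec_def L2_set_def sum_nonneg)
  moreover have "f \<in> borel_measurable \<mu>"
    using * L2_measurable measurable_vec_iff by blast
  ultimately show "f \<in> L2 \<Omega>" using * L2_square_integrable by (simp add: L2_def)
qed

lemma L2_inner_vec:
  fixes f g :: "real^3 \<Rightarrow> 'b::euclidean_space^'n"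
  assumes "f \<in> L2 \<Omega>" "g \<in> L2 \<Omega>"
  shows "ip f g = (\<Sum>i\<in>UNIV. ip (\<lambda>x. f x $ i) (\<lambda>x. g x $ i))"
  unfolding L2_inner_def inner_vec_def
  using assms by (intro Bochner_Integration.integral_sum) (auto simp: L2_vec_iff intro: L2_inner_integrable)

lemma L2_norm_nth_le:
  fixes f :: "real^3 \<Rightarrow> 'b::euclidean_space^'n"
  assumes "f \<in> L2 \<Omega>"
  shows "nrm (\<lambda>x. f x $ i) \<le> nrm f"
proof -
  have "ip (\<lambda>x. f x $ i) (\<lambda>x. f x $ i) \<le> (\<Sum>i\<in>UNIV. ip (\<lambda>x. f x $ i) (\<lambda>x. f x $ i))"
    by (rule member_le_sum) (auto simp: L2_inner_self_nonneg)
  then show ?thesis unfolding L2_norm_def L2_inner_vec[OF assms assms] by simp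
qed

lemma L2_bounded_bilinear:
  fixes prod :: "'b::euclidean_space \<Rightarrow> 'c::euclidean_space \<Rightarrow> 'd::euclidean_space"
  assumes prod: "bounded_bilinear prod" and f: "f \<in> L2 \<Omega>" and g: "g \<in> borel_measurable \<mu>"
    and bd: "AE x in \<mu>. norm (g x) \<le> M"
  shows "(\<lambda>x. prod (f x) (g x)) \<in> L2 \<Omega>"
proof -
  obtain K where K: "K > 0" "\<And>a b. norm (prod a b) \<le> norm a * norm b * K"
    using bounded_bilinear.pos_bounded[OF prod] by blast
  show ?thesis
  proof (rule L2_bound[OF f])
    have "continuous_on UNIV (\<lambda>p. prod (fst p) (snd p))"
      using bounded_bilinear.continuous_on[OF prod continuous_on_fst[OF continuous_on_id] continuous_on_snd[OF continuous_on_id]] .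
    then show "(\<lambda>x. prod (f x) (g x)) \<in> borel_measurable \<mu>"
      using borel_measurable_continuous_Pair[OF L2_measurable[OF f] g] by blast
    show "AE x in \<mu>. norm (prod (f x) (g x)) \<le> (M * K) * norm (f x)"
      using bd
    proof eventually_elim
      case (elim x)
      have "norm (f x) * norm (g x) * K \<le> norm (f x) * M * K"
        using elim K by (intro mult_right_mono mult_left_mono) auto
      then show ?case using K(2)[of "f x" "g x"] by (simp add: mult_ac)
    qed
  qed
qed

lemma ae_eq_refl [simp]: "ae f f"
  by (simp add: ae_eq_def)

lemma ae_eq_sym: "ae f g \<Longrightarrow> ae g f"
  by (simp add: ae_eq_def eq_commute)

lemma ae_eq_trans: "ae f g \<Longrightarrow> ae g h \<Longrightarrow> ae f h"
  unfolding ae_eq_def by (erule (1) eventually_elim2) simp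

lemma ae_eq_add: "ae f g \<Longrightarrow> ae f' g' \<Longrightarrow> ae (f + f') (g + g')"
  unfolding ae_eq_def by (erule (1) eventually_elim2) simp

lemma ae_eq_scaleR: "ae f g \<Longrightarrow> ae (c *\<^sub>R f) (c *\<^sub>R g)"
  unfolding ae_eq_def by (elim eventually_mono) (simp add: scaleR_fun_def)

lemma ae_eq_diff_0_iff:
  fixes f g :: "real^3 \<Rightarrow> 'b::real_vector"
  shows "ae (f - g) 0 \<longleftrightarrow> ae f g"
  by (simp add: ae_eq_def)

lemma ae_eq_vec_iff:
  fixes F G :: "real^3 \<Rightarrow> 'b^'n::finite"
  shows "ae F G \<longleftrightarrow> (\<forall>i. ae (\<lambda>x. F x $ i) (\<lambda>x. G x $ i))"
proof
  assume *: "\<forall>i. ae (\<lambda>x. F x $ i) (\<lambda>x. G x $ i)"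
  have "AE x in \<mu>. \<forall>i\<in>UNIV. F x $ i = G x $ i"
    using * by (intro AE_ball_countable') (auto simp: ae_eq_def intro: countable_finite)
  then show "ae F G" by (simp add: ae_eq_def vec_eq_iff)
next
  assume "ae F G"
  then show "\<forall>i. ae (\<lambda>x. F x $ i) (\<lambda>x. G x $ i)"
    unfolding ae_eq_def by (auto elim: eventually_mono)
qed

lemma ae_eq_0_components: "ae F 0 \<longleftrightarrow> (\<forall>i. ae (\<lambda>x. F x $ i) 0)"
  for F :: "real^3 \<Rightarrow> 'b::zero^'n::finite"
  unfolding ae_eq_vec_iff[of F 0] by (simp add: zero_fun_def)

text \<open>Linearity up to null sets, the form of linearity that \<open>grad\<close>, \<open>curl\<close> and \<open>dvg\<close> have.\<close>

definition ae_linear_on :: "'a::real_vector set \<Rightarrow> ('a \<Rightarrow> real^3 \<Rightarrow> 'b::euclidean_space) \<Rightarrow> bool" where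
  "ae_linear_on Z D \<longleftrightarrow> (\<forall>z\<in>Z. D z \<in> L2 \<Omega>) \<and>
     (\<forall>z\<in>Z. \<forall>w\<in>Z. ae (D (z + w)) (D z + D w)) \<and>
     (\<forall>c. \<forall>z\<in>Z. ae (D (c *\<^sub>R z)) (c *\<^sub>R D z))"

lemma ae_linear_on_L2: "ae_linear_on Z D \<Longrightarrow> z \<in> Z \<Longrightarrow> D z \<in> L2 \<Omega>"
  by (simp add: ae_linear_on_def)

lemma ae_linear_on_compose:
  assumes "ae_linear_on W D" "\<And>z. z \<in> Z \<Longrightarrow> \<pi> z \<in> W"
    "\<And>z w. \<pi> (z + w) = \<pi> z + \<pi> w" "\<And>c z. \<pi> (c *\<^sub>R z) = c *\<^sub>R \<pi> z"
  shows "ae_linear_on Z (\<lambda>z. D (\<pi> z))"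
  using assms unfolding ae_linear_on_def by simp

lemma ae_linear_on_id: "Z \<subseteq> L2 \<Omega> \<Longrightarrow> ae_linear_on Z (\<lambda>z. z)"
  unfolding ae_linear_on_def by auto

lemma ae_linear_on_add:
  assumes "ae_linear_on Z D" "ae_linear_on Z D'"
  shows "ae_linear_on Z (\<lambda>z. D z + D' z)"
  unfolding ae_linear_on_def
proof (intro conjI ballI allI)
  fix z w assume zw: "z \<in> Z" "w \<in> Z"
  have "ae (D (z + w) + D' (z + w)) ((D z + D w) + (D' z + D' w))"
    using assms zw unfolding ae_linear_on_def by (intro ae_eq_add) auto
  then show "ae (D (z + w) + D' (z + w)) (D z + D' z + (D w + D' w))" by (simp add: add_ac)
next
  fix c z assume "z \<in> Z"
  then have "ae (D (c *\<^sub>R z) + D' (c *\<^sub>R z)) (c *\<^sub>R D z + c *\<^sub>R D' z)"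
    using assms unfolding ae_linear_on_def by (intro ae_eq_add) auto
  then show "ae (D (c *\<^sub>R z) + D' (c *\<^sub>R z)) (c *\<^sub>R (D z + D' z))" by (simp add: scaleR_add_right)
qed (use assms in \<open>auto simp: ae_linear_on_def intro: L2_add\<close>)

text \<open>Multiplication by a bounded field; it covers the cross product with \<open>Bm\<close> and the convection
by \<open>um\<close>.\<close>

lemma ae_linear_on_bounded_bilinear:
  fixes prod :: "'b::euclidean_space \<Rightarrow> 'c::euclidean_space \<Rightarrow> 'd::euclidean_space"
  assumes prod: "bounded_bilinear prod" and D: "ae_linear_on Z D"
    and g: "g \<in> borel_measurable \<mu>" and bd: "AE x in \<mu>. norm (g x) \<le> M"
  shows "ae_linear_on Z (\<lambda>z x. prod (D z x) (g x))"
  unfolding ae_linear_on_def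
proof (intro conjI ballI allI)
  fix z assume "z \<in> Z"
  then show "(\<lambda>x. prod (D z x) (g x)) \<in> L2 \<Omega>"
    using D g bd by (intro L2_bounded_bilinear[OF prod]) (auto simp: ae_linear_on_def)
next
  fix z w assume "z \<in> Z" "w \<in> Z"
  then have "ae (D (z + w)) (D z + D w)" using D by (auto simp: ae_linear_on_def)
  then show "ae (\<lambda>x. prod (D (z + w) x) (g x)) ((\<lambda>x. prod (D z x) (g x)) + (\<lambda>x. prod (D w x) (g x)))"
    unfolding ae_eq_def by eventually_elim (simp add: bounded_bilinear.add_left[OF prod])
next
  fix c z assume "z \<in> Z"
  then have "ae (D (c *\<^sub>R z)) (c *\<^sub>R D z)" using D by (auto simp: ae_linear_on_def)
  then show "ae (\<lambda>x. prod (D (c *\<^sub>R z) x) (g x)) (c *\<^sub>R (\<lambda>x. prod (D z x) (g x)))"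
    unfolding ae_eq_def
    by eventually_elim (simp add: scaleR_fun_def bounded_bilinear.scaleR_left[OF prod])
qed

text \<open>Every term of the forms \<open>a\<close> and \<open>b\<close> and of the squared norms has this shape, and integrals do not
see the null sets on which linearity fails.\<close>

lemma bilinear_form_on_L2_inner_ae_linear:
  assumes Z: "subspace Z" and D: "ae_linear_on Z D" and D': "ae_linear_on Z D'"
  shows "bilinear_form_on Z (\<lambda>z w. ip (D z) (D' w))"
proof -
  have lin: "linear_form_on Z (\<lambda>w. ip f (D w))" if D: "ae_linear_on Z D" and f: "f \<in> L2 \<Omega>"
    for f :: "real^3 \<Rightarrow> 'b" and D
    unfolding linear_form_on_def
  proof (intro conjI ballI allI)
    have L: "linear_form_on (L2 \<Omega>) (ip f)"
      using bilinear_form_on_L2_inner f by (auto simp: bilinear_form_on_def)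
    fix z w assume zw: "z \<in> Z" "w \<in> Z"
    have "ip f (D (z + w)) = ip f (D z + D w)"
      using D zw f Z unfolding ae_linear_on_def
      by (intro L2_inner_ae_cong) (auto intro: L2_add subspace_add)
    then show "ip f (D (z + w)) = ip f (D z) + ip f (D w)"
      using L D zw by (simp add: linear_form_on_def ae_linear_on_def)
  next
    have L: "linear_form_on (L2 \<Omega>) (ip f)"
      using bilinear_form_on_L2_inner f by (auto simp: bilinear_form_on_def)
    fix c z assume z: "z \<in> Z"
    have "ip f (D (c *\<^sub>R z)) = ip f (c *\<^sub>R D z)"
      using D z f Z unfolding ae_linear_on_def
      by (intro L2_inner_ae_cong) (auto intro: L2_scaleR subspace_scale)
    then show "ip f (D (c *\<^sub>R z)) = c * ip f (D z)"
      using L D z by (simp add: linear_form_on_def ae_linear_on_def)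
  qed
  show ?thesis
    unfolding bilinear_form_on_def
  proof (intro conjI ballI)
    show "linear_form_on Z (\<lambda>w. ip (D z) (D' w))" if "z \<in> Z" for z
      using lin[OF D' ae_linear_on_L2[OF D that]] .
    show "linear_form_on Z (\<lambda>z. ip (D z) (D' w))" if "w \<in> Z" for w
      using lin[OF D ae_linear_on_L2[OF D' that]] by (subst L2_inner_commute)
  qed
qed

lemma bilinear_form_on_add:
  "bilinear_form_on Z A \<Longrightarrow> bilinear_form_on Z B \<Longrightarrow> bilinear_form_on Z (\<lambda>z w. A z w + B z w)"
  unfolding bilinear_form_on_def linear_form_on_def by (auto simp: algebra_simps)

lemma bilinear_form_on_cmult:
  "bilinear_form_on Z A \<Longrightarrow> bilinear_form_on Z (\<lambda>z w. c * A z w)"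
  unfolding bilinear_form_on_def linear_form_on_def by (auto simp: algebra_simps)

lemma bilinear_form_on_swap:
  "bilinear_form_on Z A \<Longrightarrow> bilinear_form_on Z (\<lambda>z w. A w z)"
  unfolding bilinear_form_on_def by auto

end

section \<open>Smooth cutoffs and the fundamental lemma of the calculus of variations\<close>

text \<open>The functions \<open>exp (- 1 / t)\<close>, extended by \<open>0\<close> to \<open>t \<le> 0\<close>, together with the powers
of \<open>1 / t\<close> that appear when they are differentiated.\<close>

definition flat :: "nat \<Rightarrow> real \<Rightarrow> real" where
  "flat k t = (if t > 0 then inverse t ^ k * exp (- inverse t) else 0)"

lemma flat_tendsto_0: "(flat k \<longlongrightarrow> 0) (at 0)"
proof -
  have "((\<lambda>t. inverse t ^ k / exp (inverse t)) \<longlongrightarrow> (0::real)) (at_right 0)"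
    by (rule filterlim_compose[OF tendsto_power_div_exp_0 filterlim_inverse_at_top_right])
  then have R: "(flat k \<longlongrightarrow> 0) (at_right 0)"
    by (rule Lim_transform_eventually)
      (auto simp: eventually_at_filter flat_def exp_minus divide_inverse)
  have L: "(flat k \<longlongrightarrow> 0) (at_left 0)"
    by (rule Lim_transform_eventually[of "\<lambda>_. 0"]) (auto simp: eventually_at_filter flat_def)
  show ?thesis using L R by (simp add: filterlim_split_at)
qed

text \<open>At \<open>0\<close> the difference quotient of \<open>flat k\<close> is \<open>flat (k + 1)\<close>, which tends to \<open>0\<close>.\<close>

lemma DERIV_flat: "(flat k has_real_derivative flat (k + 2) t - real k * flat (k + 1) t) (at t)"
proof -
  consider "t > 0" | "t < 0" | "t = 0" by linarith
  then show ?thesis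
  proof cases
    case 1
    have "((\<lambda>t. inverse t ^ k) has_real_derivative
        real k * (- (inverse t ^ Suc (Suc 0)) * inverse t ^ (k - Suc 0))) (at t)"
      by (rule DERIV_power, rule DERIV_inverse) (use 1 in simp)
    moreover have "real k * (- (inverse t ^ Suc (Suc 0)) * inverse t ^ (k - Suc 0)) = - real k * inverse t ^ (k + 1)"
      by (cases k) (auto simp: algebra_simps)
    ultimately have p: "((\<lambda>t. inverse t ^ k) has_real_derivative - real k * inverse t ^ (k + 1)) (at t)"
      by (simp only:)
    have e: "((\<lambda>t. exp (- inverse t)) has_real_derivative exp (- inverse t) * inverse t ^ 2) (at t)"
      using 1 by (auto intro!: derivative_eq_intros simp: power2_eq_square)
    have "((\<lambda>t. inverse t ^ k * exp (- inverse t)) has_real_derivative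
        flat (k + 2) t - real k * flat (k + 1) t) (at t)"
      using DERIV_mult[OF p e] 1 by (simp add: flat_def power2_eq_square algebra_simps)
    then show ?thesis
      by (rule has_field_derivative_transform_within_open[where S = "{0<..}"]) (use 1 in \<open>auto simp: flat_def\<close>)
  next
    case 2
    have "((\<lambda>t. 0) has_real_derivative flat (k + 2) t - real k * flat (k + 1) t) (at t)"
      using 2 by (simp add: flat_def)
    then show ?thesis
      by (rule has_field_derivative_transform_within_open[where S = "{..<0}"]) (use 2 in \<open>auto simp: flat_def\<close>)
  next
    case 3
    have "((\<lambda>h. (flat k (0 + h) - flat k 0) / h) \<longlongrightarrow> 0) (at 0)"
      using flat_tendsto_0[of "k + 1"]
      by (rule Lim_transform_eventually) (auto simp: eventually_at_filter flat_def divide_inverse)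
    then show ?thesis using 3 by (simp add: DERIV_def flat_def)
  qed
qed

text \<open>An algebra that is closed under partial derivatives, so smoothness of its members needs no
higher product or chain rules.\<close>

inductive_set cutoff_algebra :: "sfield set" where
  const: "(\<lambda>x. c) \<in> cutoff_algebra"
| flat: "(\<lambda>x. flat k (s * x $ i + a)) \<in> cutoff_algebra"
| add: "f \<in> cutoff_algebra \<Longrightarrow> g \<in> cutoff_algebra \<Longrightarrow> (\<lambda>x. f x + g x) \<in> cutoff_algebra"
| mult: "f \<in> cutoff_algebra \<Longrightarrow> g \<in> cutoff_algebra \<Longrightarrow> (\<lambda>x. f x * g x) \<in> cutoff_algebra"

lemma partial_eqI: "(f has_derivative D) (at x) \<Longrightarrow> partial i f x = D (axis i 1)"
  unfolding partial_def by (simp add: frechet_derivative_at[symmetric])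

lemma partial_const: "partial i (\<lambda>x. c) = (\<lambda>x. 0)"
  by (rule ext) (subst partial_eqI, auto intro!: derivative_eq_intros)

lemma partial_add:
  assumes "f differentiable (at x)" "g differentiable (at x)"
  shows "partial i (\<lambda>y. f y + g y) x = partial i f x + partial i g x"
  using partial_eqI[OF has_derivative_add[OF assms[unfolded frechet_derivative_works]]]
  by (simp add: partial_def)

lemma partial_mult:
  assumes "f differentiable (at x)" "g differentiable (at x)"
  shows "partial i (\<lambda>y. f y * g y) x = f x * partial i g x + partial i f x * g x"
  using partial_eqI[OF has_derivative_mult[OF assms[unfolded frechet_derivative_works]]]
  by (simp add: partial_def)

lemma cutoff_algebra_step:
  assumes "f \<in> cutoff_algebra"
  shows "(\<forall>x. f differentiable (at x)) \<and> (\<forall>i. partial i f \<in> cutoff_algebra)"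
  using assms
proof induction
  case (const c)
  then show ?case by (simp add: partial_const cutoff_algebra.const)
next
  case (flat k s i a)
  have d: "((\<lambda>x. flat k (s * x $ i + a)) has_derivative
      (\<lambda>h. (s * h $ i) * (flat (k + 2) (s * x $ i + a) - real k * flat (k + 1) (s * x $ i + a)))) (at x)" for x :: "real^3"
  proof -
    have "((\<lambda>x. s * x $ i + a) has_derivative (\<lambda>h. s * h $ i)) (at x)"
      by (auto intro!: derivative_eq_intros bounded_linear_imp_has_derivative bounded_linear_vec_nth)
    then show ?thesis
      using has_derivative_compose[OF _ DERIV_flat[THEN has_field_derivative_imp_has_derivative]]
      by (simp add: mult.commute)
  qed
  have "partial j (\<lambda>x. flat k (s * x $ i + a)) = (\<lambda>x. s * axis j 1 $ i *
     (flat (k + 2) (s * x $ i + a) + (- real k) * flat (k + 1) (s * x $ i + a)))" for j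
    by (rule ext, subst partial_eqI[OF d]) simp
  then have "partial j (\<lambda>x. flat k (s * x $ i + a)) \<in> cutoff_algebra" for j
    by (simp only:) (intro cutoff_algebra.intros)
  moreover have "(\<lambda>x. flat k (s * x $ i + a)) differentiable (at x)" for x
    unfolding differentiable_def by (rule exI, rule d)
  ultimately show ?case by blast
next
  case (add f g)
  then have "partial i (\<lambda>x. f x + g x) = (\<lambda>x. partial i f x + partial i g x)" for i
    by (auto simp: partial_add)
  then show ?case using add by (auto intro: cutoff_algebra.add)
next
  case (mult f g)
  then have "partial i (\<lambda>x. f x * g x) = (\<lambda>x. f x * partial i g x + partial i f x * g x)" for i
    by (auto simp: partial_mult)
  then show ?case using mult by (auto intro!: cutoff_algebra.add cutoff_algebra.mult)
qed

lemma smooth_cutoff_algebra: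
  assumes "f \<in> cutoff_algebra"
  shows "smooth f"
proof -
  have "foldr partial is f \<in> cutoff_algebra" for "is"
    by (induction "is") (auto simp: assms cutoff_algebra_step)
  then show ?thesis using cutoff_algebra_step by (simp add: smooth_def)
qed

lemma cutoff_algebra_power:
  "f \<in> cutoff_algebra \<Longrightarrow> (\<lambda>x. f x ^ n) \<in> cutoff_algebra"
  by (induction n) (auto intro: cutoff_algebra.intros)

lemma cutoff_algebra_prod:
  assumes "finite I" "\<And>i. i \<in> I \<Longrightarrow> f i \<in> cutoff_algebra"
  shows "(\<lambda>x. \<Prod>i\<in>I. f i x) \<in> cutoff_algebra"
  using assms by (induction I rule: finite_induct) (auto intro: cutoff_algebra.intros)

text \<open>If \<open>\<psi>\<close> takes values in \<open>[0, 1]\<close> and is positive exactly on the open box, then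
\<open>1 - (1 - \<psi>)\<^sup>n\<close> increases to the indicator function of the box, and it stays in the
algebra that contains \<open>\<psi>\<close>.\<close>

lemma test_funs_approximate_box:
  fixes a b :: "real^3"
  assumes sub: "cbox a b \<subseteq> \<Omega>"
  obtains \<phi> where "\<And>n. \<phi> n \<in> test_funs \<Omega>" "\<And>n x. 0 \<le> \<phi> n x \<and> \<phi> n x \<le> 1"
    "\<And>x. (\<lambda>n. \<phi> n x) \<longlonglongrightarrow> indicator (box a b) x"
proof
  define \<psi> :: sfield where "\<psi> = (\<lambda>x. \<Prod>i\<in>UNIV. flat 0 (1 * x $ i + (- a $ i)) * flat 0 ((-1) * x $ i + b $ i))"
  \<comment> \<open>written without subtraction to match the generators of \<open>cutoff_algebra\<close>\<close>
  define \<phi> :: "nat \<Rightarrow> sfield" where "\<phi> n = (\<lambda>x. 1 + (-1) * (1 + (-1) * \<psi> x) ^ n)" for n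
  have flat01: "0 \<le> flat 0 t \<and> flat 0 t \<le> 1" for t by (simp add: flat_def)
  have \<psi>01: "0 \<le> \<psi> x \<and> \<psi> x \<le> 1" for x
    unfolding \<psi>_def using flat01 by (auto intro!: prod_nonneg prod_le_1 mult_le_one)
  have in_alg: "\<phi> n \<in> cutoff_algebra" for n
    unfolding \<phi>_def \<psi>_def
    by (intro cutoff_algebra_power cutoff_algebra_prod cutoff_algebra.intros finite)
  have pos: "\<psi> x > 0" if "x \<in> box a b" for x
    using that unfolding \<psi>_def mem_box_cart by (intro prod_pos) (auto simp: flat_def)
  have zero: "\<psi> x = 0" if out: "x \<notin> box a b" for x
  proof -
    obtain i where "x $ i \<le> a $ i \<or> b $ i \<le> x $ i"
      using out by (auto simp: mem_box_cart not_less)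
    then show ?thesis unfolding \<psi>_def
      by (intro prod_zero bexI[of _ i]) (auto simp: flat_def)
  qed
  have supp: "closure {x. \<phi> n x \<noteq> 0} \<subseteq> cbox a b" for n
  proof (rule closure_minimal)
    show "{x. \<phi> n x \<noteq> 0} \<subseteq> cbox a b"
    proof
      fix x assume "x \<in> {x. \<phi> n x \<noteq> 0}"
      then have "\<psi> x \<noteq> 0" by (auto simp: \<phi>_def)
      then show "x \<in> cbox a b" using zero box_subset_cbox[of a b] by blast
    qed
  qed (rule closed_cbox)
  have "compact (closure {x. \<phi> n x \<noteq> 0})" for n
    using compact_Int_closed[OF compact_cbox closed_closure, of a b "{x. \<phi> n x \<noteq> 0}"] supp[of n]
    by (simp add: inf.absorb2)
  moreover have "closure {x. \<phi> n x \<noteq> 0} \<subseteq> \<Omega>" for n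
    using supp[of n] sub by (rule order_trans)
  ultimately show "\<phi> n \<in> test_funs \<Omega>" for n
    using smooth_cutoff_algebra[OF in_alg] by (simp add: test_funs_def)
  show "0 \<le> \<phi> n x \<and> \<phi> n x \<le> 1" for n x
    using \<psi>01[of x] by (auto simp: \<phi>_def power_le_one)
  show "(\<lambda>n. \<phi> n x) \<longlonglongrightarrow> indicator (box a b) x" for x
  proof (cases "x \<in> box a b")
    case True
    have "(\<lambda>n. (1 - \<psi> x) ^ n) \<longlonglongrightarrow> 0"
      using pos[OF True] \<psi>01[of x] by (intro LIMSEQ_power_zero) auto
    then have "(\<lambda>n. 1 - (1 - \<psi> x) ^ n) \<longlonglongrightarrow> 1 - 0"
      by (intro tendsto_diff tendsto_const)
    then show ?thesis using True by (simp add: \<phi>_def)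
  next
    case False
    then show ?thesis using zero by (simp add: \<phi>_def)
  qed
qed

text \<open>Boxes form an intersection-stable generator of the Borel sets, and a Lebesgue set differs from a
Borel set by a null set; so all set integrals of \<open>G\<close> vanish.\<close>

lemma AE_0_if_box_integrals_0:
  fixes G :: "'a::euclidean_space \<Rightarrow> real"
  assumes G: "integrable lebesgue G"
    and zero: "\<And>a b. (LINT x:box a b|lebesgue. G x) = 0" and supp: "\<And>x. x \<notin> box c d \<Longrightarrow> G x = 0"
  shows "AE x in lebesgue. G x = 0"
proof -
  have int: "set_integrable lebesgue A G" if "A \<in> sets lebesgue" for A
    using integrable_mult_indicator[OF that G] by (simp add: set_integrable_def)
  have "(\<lambda>x. indicat_real (box c d) x *\<^sub>R G x) = G"
    using supp by (auto simp: indicator_def fun_eq_iff)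
  then have all: "(LINT x|lebesgue. G x) = 0"
    using zero[of c d] unfolding set_lebesgue_integral_def by (simp only:)
  have borel: "(LINT x:A|lebesgue. G x) = 0" if "A \<in> sets borel" for A :: "'a set"
  proof -
    let ?E = "range (\<lambda>(a, b). box a b :: 'a set)"
    have "Int_stable ?E" by (auto simp: Int_stable_def box_Int_box)
    moreover have "?E \<subseteq> Pow UNIV" by auto
    moreover have "A \<in> sigma_sets UNIV ?E" using that by (simp add: borel_eq_box)
    ultimately show ?thesis
    proof (induction rule: sigma_sets_induct_disjoint)
      case (basic A) then show ?case using zero by auto
    next
      case empty show ?case by (simp add: set_lebesgue_integral_def)
    next
      case (compl A)
      then have A: "A \<in> sets lebesgue" by (auto simp: borel_eq_box)
      have "(LINT x:UNIV - A|lebesgue. G x) = (LINT x:UNIV|lebesgue. G x) - (LINT x:A|lebesgue. G x)"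
      proof -
        have "(LINT x:UNIV - A|lebesgue. G x)
            = (LINT x|lebesgue. indicator UNIV x *\<^sub>R G x - indicator A x *\<^sub>R G x)"
          unfolding set_lebesgue_integral_def
          by (rule Bochner_Integration.integral_cong) (auto simp: indicator_def)
        moreover have U: "UNIV \<in> sets lebesgue" by (intro borel_closed sets_completionI_sets) simp
        ultimately show ?thesis
          using Bochner_Integration.integral_diff[OF int[OF U, unfolded set_integrable_def]
              int[OF A, unfolded set_integrable_def]]
          by (simp add: set_lebesgue_integral_def)
      qed
      then show ?case using compl all by (simp add: set_lebesgue_integral_def)
    next
      case (union A)
      then have "A i \<in> sets borel" for i unfolding borel_eq_box by auto
      then have "A i \<in> sets lebesgue" for i by (rule sets_completionI_sets[of _ lborel, simplified])
      then show ?case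
        using lebesgue_integral_countable_add[of A lebesgue G] int[of "\<Union>i. A i"] union
        by (auto simp: disjoint_family_on_def)
    qed
  qed
  have "AE x in lebesgue. G x = 0 x"
  proof (rule density_unique_real[OF G])
    show "integrable lebesgue (0 :: 'a \<Rightarrow> real)" by (simp add: zero_fun_def)
    fix A :: "'a set" assume "A \<in> sets lebesgue"
    then obtain S N N' where A: "A = S \<union> N" "N \<subseteq> N'" "N' \<in> null_sets lborel" "S \<in> sets lborel"
      by (rule sets_completionE)
    have "AE x in lebesgue. x \<notin> N'" using A AE_not_in null_sets_completionI by blast
    then have "AE x in lebesgue. x \<in> A \<longleftrightarrow> x \<in> S" by eventually_elim (use A in auto)
    moreover have "S \<in> sets lebesgue" using A by auto
    ultimately have "(LINT x:S|lebesgue. G x) = (LINT x:A|lebesgue. G x)"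
      using int \<open>A \<in> sets lebesgue\<close>
      by (intro set_integral_cong_set) (auto simp: set_borel_measurable_def set_integrable_def)
    then show "(LINT x:A|lebesgue. G x) = (LINT x:A|lebesgue. 0 x)"
      using borel A by (simp add: set_lebesgue_integral_def)
  qed
  then show ?thesis by simp
qed

locale bounded_domain = domain +
  assumes dom: "open \<Omega>" "bounded \<Omega>"
begin

text \<open>Cutoffs that approximate boxes show that \<open>g\<close> integrates to zero over every box whose closure lies
in \<open>\<Omega>\<close>, and \<open>\<Omega>\<close> is a countable union of closed boxes.\<close>

lemma fundamental_lemma:
  fixes g :: sfield
  assumes g: "g \<in> L2 \<Omega>"
    and orth: "\<And>\<phi>. \<phi> \<in> test_funs \<Omega> \<Longrightarrow> ip g \<phi> = 0"
  shows "ae g 0"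
proof -
  have meas: "\<Omega> \<in> sets lebesgue" using dom by auto
  have one: "(\<lambda>x. 1 :: real) \<in> L2 \<Omega>" by (rule L2_bounded[OF dom(2,1), where M = 1]) (simp_all add: AE_I2)
  have gint: "integrable \<mu> g"
    using L2_inner_integrable[OF g one] by simp
  have box0: "(LINT x|\<mu>. g x * indicator (box a b) x) = 0" if "cbox a b \<subseteq> \<Omega>" for a b :: "real^3"
  proof -
    obtain \<phi> where \<phi>: "\<And>n. \<phi> n \<in> test_funs \<Omega>" "\<And>n x. 0 \<le> \<phi> n x \<and> \<phi> n x \<le> 1"
      "\<And>x. (\<lambda>n. \<phi> n x) \<longlonglongrightarrow> indicator (box a b) x"
      using test_funs_approximate_box[OF \<open>cbox a b \<subseteq> \<Omega>\<close>] by blast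
    have cont: "continuous_on UNIV (\<phi> n)" for n
    proof -
      have "\<phi> n differentiable (at x)" for x
        using \<phi>(1)[of n] by (auto simp: test_funs_def smooth_def dest!: spec[of _ "[]"])
      then show ?thesis by (simp add: continuous_at_imp_continuous_on differentiable_imp_continuous_within)
    qed
    have "(\<lambda>n. LINT x|\<mu>. g x * \<phi> n x) \<longlonglongrightarrow> (LINT x|\<mu>. g x * indicator (box a b) x)"
    proof (rule integral_dominated_convergence[where w = "\<lambda>x. norm (g x)"])
      show "(\<lambda>x. g x * \<phi> n x) \<in> borel_measurable \<mu>" for n
        using meas by (intro borel_measurable_times L2_measurable[OF g]
          continuous_imp_measurable_on_sets_lebesgue continuous_on_subset[OF cont]) auto
      show "(\<lambda>x. g x * indicator (box a b) x) \<in> borel_measurable \<mu>"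
        by (intro borel_measurable_times L2_measurable[OF g]
          measurable_restrict_space1[OF borel_measurable_indicator]) auto
      show "AE x in \<mu>. norm (g x * \<phi> n x) \<le> norm (g x)" for n
        using \<phi>(2) by (auto simp: abs_mult intro!: AE_I2 mult_left_le)
      show "AE x in \<mu>. (\<lambda>n. g x * \<phi> n x) \<longlonglongrightarrow> g x * indicator (box a b) x"
        by (intro AE_I2 tendsto_intros \<phi>(3))
    qed (use gint in auto)
    moreover have "(LINT x|\<mu>. g x * \<phi> n x) = 0" for n
      using orth[OF \<phi>(1)] by (simp add: L2_inner_def)
    ultimately show ?thesis by (simp add: LIMSEQ_const_iff)
  qed
  have on_box: "AE x in lebesgue. x \<in> cbox c d \<longrightarrow> g x = 0" if sub: "cbox c d \<subseteq> \<Omega>" for c d :: "real^3"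
  proof -
    have gintL: "integrable lebesgue (\<lambda>x. indicator \<Omega> x *\<^sub>R g x)"
      using gint meas by (simp add: integrable_restrict_space)
    define G where "G x = indicator (box c d) x *\<^sub>R (indicator \<Omega> x *\<^sub>R g x)" for x
    have "AE x in lebesgue. G x = 0"
    proof (rule AE_0_if_box_integrals_0)
      show "G x = 0" if "x \<notin> box c d" for x using that by (simp add: G_def)
      show "integrable lebesgue G"
        unfolding G_def by (intro integrable_mult_indicator gintL) auto
      fix a b :: "real^3"
      obtain a' b' where ab: "box a b \<inter> box c d = box a' b'" using box_Int_box[of a b c d] by blast
      \<comment> \<open>an empty intersection may come with corners outside \<open>\<Omega>\<close> and is replaced by another empty box\<close>
      have "\<exists>a b. cbox a b \<subseteq> \<Omega> \<and> box a b = box a' b'"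
      proof (cases "box a' b' = {}")
        case True
        have "cbox (1::real^3) 0 = {}" "box (1::real^3) 0 = {}"
          by (auto simp: interval_eq_empty_cart)
        then show ?thesis using True by (metis empty_subsetI)
      next
        case False
        then have "cbox a' b' \<subseteq> closure (box c d)"
          using ab closure_box[OF False] closure_mono[of "box a' b'" "box c d"] by auto
        then have "cbox a' b' \<subseteq> \<Omega>" 
          using sub closure_minimal[OF box_subset_cbox closed_cbox, of c d] by blast
        then show ?thesis by blast
      qed
      then have "(LINT x|\<mu>. g x * indicator (box a' b') x) = 0"
        using box0 by metis
      then have "(LINT x|lebesgue. indicator \<Omega> x *\<^sub>R (g x * indicator (box a' b') x)) = 0"
        using meas by (simp add: integral_restrict_space)
      moreover have "indicator \<Omega> x *\<^sub>R (g x * indicator (box a' b') x) = indicator (box a b) x *\<^sub>R G x" for x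
        unfolding G_def ab[symmetric] by (auto simp: indicator_def)
      ultimately show "(LINT x:box a b|lebesgue. G x) = 0"
        by (simp add: set_lebesgue_integral_def)
    qed
    moreover have "AE x in lebesgue. x \<notin> cbox c d - box c d"
      using negligible_frontier_interval[of c d] by (intro AE_not_in) (simp add: negligible_iff_null_sets)
    ultimately show ?thesis
      by eventually_elim (use sub in \<open>auto simp: G_def indicator_def split: if_splits\<close>)
  qed
  obtain \<D> where D: "countable \<D>" "\<D> \<subseteq> Pow \<Omega>" "\<And>X. X \<in> \<D> \<Longrightarrow> \<exists>a b. X = cbox a b" "\<Union>\<D> = \<Omega>"
    using open_countable_Union_open_cbox[OF dom(1)] by metis
  have "AE x in lebesgue. x \<in> X \<longrightarrow> g x = 0" if "X \<in> \<D>" for X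
  proof -
    obtain a b where "X = cbox a b" using D(3) \<open>X \<in> \<D>\<close> by blast
    then show ?thesis using on_box D(2) \<open>X \<in> \<D>\<close> by blast
  qed
  then have "AE x in lebesgue. \<forall>X\<in>\<D>. x \<in> X \<longrightarrow> g x = 0"
    by (intro AE_ball_countable[THEN iffD2] D(1)) blast
  then have "AE x in lebesgue. x \<in> \<Omega> \<longrightarrow> g x = 0"
    by eventually_elim (use D in auto)
  then show ?thesis unfolding ae_eq_def using AE_lebesgue_on_iff[OF dom(1)] by simp
qed

end

section \<open>Test functions and weak derivatives\<close>

lemma smooth_differentiable: "smooth \<phi> \<Longrightarrow> \<phi> differentiable (at x)"
  unfolding smooth_def by (metis foldr.simps(1) id_apply)

lemma smooth_partial:
  assumes "smooth \<phi>"
  shows "smooth (partial i \<phi>)"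
  unfolding smooth_def
proof (intro allI)
  fix "is" x
  have "foldr partial is (partial i \<phi>) = foldr partial (is @ [i]) \<phi>" by simp
  then show "foldr partial is (partial i \<phi>) differentiable (at x)"
    using assms by (simp add: smooth_def del: foldr_append)
qed

lemma partial_scaleR:
  assumes "f differentiable (at x)"
  shows "partial i (c *\<^sub>R f) x = c * partial i f x"
  using partial_mult[of "\<lambda>_. c" x f i] assms by (simp add: scaleR_fun_def partial_const)

lemma foldr_partial_add:
  assumes "smooth f" "smooth g"
  shows "foldr partial is (f + g) = foldr partial is f + foldr partial is g"
proof (induction "is")
  case (Cons i "is")
  have "foldr partial is f differentiable (at x)" "foldr partial is g differentiable (at x)" for x
    using assms by (simp_all add: smooth_def)
  then have "partial i (foldr partial is f + foldr partial is g)
      = partial i (foldr partial is f) + partial i (foldr partial is g)"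
    by (intro ext) (simp add: plus_fun_def partial_add)
  then show ?case by (simp only: foldr_Cons o_apply Cons)
qed simp

lemma foldr_partial_scaleR:
  assumes "smooth f"
  shows "foldr partial is (c *\<^sub>R f) = c *\<^sub>R foldr partial is f"
proof (induction "is")
  case (Cons i "is")
  have "foldr partial is f differentiable (at x)" for x
    using assms by (simp add: smooth_def)
  then have "partial i (c *\<^sub>R foldr partial is f) = c *\<^sub>R partial i (foldr partial is f)"
    by (intro ext) (simp add: partial_scaleR, simp add: scaleR_fun_def)
  then show ?case using Cons by simp
qed simp

lemma smooth_add:
  assumes "smooth f" "smooth g"
  shows "smooth (f + g)"
proof -
  have "foldr partial is f differentiable (at x)" "foldr partial is g differentiable (at x)" for "is" x
    using assms by (simp_all add: smooth_def)
  then have "(\<lambda>y. foldr partial is f y + foldr partial is g y) differentiable (at x)" for "is" x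
    by (intro differentiable_add)
  then show ?thesis
    unfolding smooth_def foldr_partial_add[OF assms] by (simp add: plus_fun_def)
qed

lemma smooth_scaleR:
  assumes "smooth f"
  shows "smooth (c *\<^sub>R f)"
proof -
  have "foldr partial is f differentiable (at x)" for "is" x
    using assms by (simp add: smooth_def)
  then have "(\<lambda>y. c *\<^sub>R foldr partial is f y) differentiable (at x)" for "is" x
    by (intro differentiable_scaleR differentiable_const)
  then show ?thesis
    unfolding smooth_def foldr_partial_scaleR[OF assms] by (simp add: scaleR_fun_def)
qed

lemma test_funs_smooth: "\<phi> \<in> test_funs \<Omega> \<Longrightarrow> smooth \<phi>"
  by (simp add: test_funs_def)

lemma test_funs_supportI:
  assumes "smooth \<psi>" "compact K" "K \<subseteq> \<Omega>" "\<And>x. x \<notin> K \<Longrightarrow> \<psi> x = 0"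
  shows "\<psi> \<in> test_funs \<Omega>"
proof -
  have "{x. \<psi> x \<noteq> 0} \<subseteq> K" using assms(4) by blast
  then have sub: "closure {x. \<psi> x \<noteq> 0} \<subseteq> K"
    by (rule closure_minimal) (rule compact_imp_closed[OF assms(2)])
  then have "compact (closure {x. \<psi> x \<noteq> 0})"
    using compact_Int_closed[OF assms(2) closed_closure, of "{x. \<psi> x \<noteq> 0}"] by (simp add: inf.absorb2)
  then show ?thesis
    using order_trans[OF sub assms(3)] assms(1) unfolding test_funs_def by blast
qed

text \<open>Differentiation does not enlarge the support, so one compact set serves for \<open>\<phi>\<close> and its partial
derivatives.\<close>

lemma test_funs_support:
  assumes "\<phi> \<in> test_funs \<Omega>"
  obtains K where "compact K" "K \<subseteq> \<Omega>" "\<And>x. x \<notin> K \<Longrightarrow> \<phi> x = 0" "\<And>i x. x \<notin> K \<Longrightarrow> partial i \<phi> x = 0"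
proof -
  obtain K where K: "K = closure {x. \<phi> x \<noteq> 0}" by blast
  have cK: "compact K" "K \<subseteq> \<Omega>" using assms unfolding K test_funs_def by blast+
  have 0: "\<phi> x = 0" if "x \<notin> K" for x
    using that closure_subset[of "{x. \<phi> x \<noteq> 0}"] unfolding K by auto
  have "partial i \<phi> x = 0" if "x \<notin> K" for i x
  proof -
    have "((\<lambda>y. 0) has_derivative (\<lambda>h. 0)) (at x)" by simp
    then have "(\<phi> has_derivative (\<lambda>h. 0)) (at x)"
      by (rule has_derivative_transform_within_open[OF _ open_Compl[OF compact_imp_closed[OF cK(1)]]])
        (simp_all add: that 0)
    then show ?thesis by (rule partial_eqI)
  qed
  then show ?thesis using that cK 0 by blast
qed

lemma subspace_test_funs: "subspace (test_funs \<Omega>)"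
proof (rule subspaceI)
  have "0 = (\<lambda>x::real^3. 0 :: real)" by (simp add: zero_fun_def)
  moreover have "smooth (\<lambda>x. 0)" by (rule smooth_cutoff_algebra) (rule cutoff_algebra.const)
  ultimately show "0 \<in> test_funs \<Omega>" using test_funs_supportI[of 0 "{}" \<Omega>] by simp
next
  fix f g assume fg: "f \<in> test_funs \<Omega>" "g \<in> test_funs \<Omega>"
  obtain K where K: "compact K" "K \<subseteq> \<Omega>" "\<And>x. x \<notin> K \<Longrightarrow> f x = 0"
    by (rule test_funs_support[OF fg(1)]) blast
  obtain K' where K': "compact K'" "K' \<subseteq> \<Omega>" "\<And>x. x \<notin> K' \<Longrightarrow> g x = 0"
    by (rule test_funs_support[OF fg(2)]) blast
  show "f + g \<in> test_funs \<Omega>"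
    using smooth_add[OF fg[THEN test_funs_smooth]] compact_Un[OF K(1) K'(1)] Un_least[OF K(2) K'(2)]
    by (rule test_funs_supportI) (simp add: K(3) K'(3))
next
  fix c f assume f: "f \<in> test_funs \<Omega>"
  obtain K where K: "compact K" "K \<subseteq> \<Omega>" "\<And>x. x \<notin> K \<Longrightarrow> f x = 0"
    by (rule test_funs_support[OF f]) blast
  show "c *\<^sub>R f \<in> test_funs \<Omega>"
    using smooth_scaleR[OF test_funs_smooth[OF f]] K(1,2)
    by (rule test_funs_supportI) (simp add: K(3) scaleR_fun_def)
qed

lemma test_funs_partial: "\<phi> \<in> test_funs \<Omega> \<Longrightarrow> partial i \<phi> \<in> test_funs \<Omega>"
proof -
  assume \<phi>: "\<phi> \<in> test_funs \<Omega>"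
  obtain K where "compact K" "K \<subseteq> \<Omega>" "\<And>i x. x \<notin> K \<Longrightarrow> partial i \<phi> x = 0"
    by (rule test_funs_support[OF \<phi>]) blast
  then show ?thesis
    by (intro test_funs_supportI[OF smooth_partial[OF test_funs_smooth[OF \<phi>]]]) auto
qed

lemma test_funs_continuous: "\<phi> \<in> test_funs \<Omega> \<Longrightarrow> continuous_on S \<phi>"
  using smooth_differentiable[OF test_funs_smooth]
  by (simp add: continuous_at_imp_continuous_on differentiable_imp_continuous_within)

lemma test_funs_bounded:
  assumes "\<phi> \<in> test_funs \<Omega>"
  obtains M where "M \<ge> 0" "\<And>x. \<bar>\<phi> x\<bar> \<le> M"
proof -
  obtain K where K: "compact K" "\<And>x. x \<notin> K \<Longrightarrow> \<phi> x = 0"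
    by (rule test_funs_support[OF assms]) blast
  have "bounded (\<phi> ` K)"
    using compact_continuous_image[OF test_funs_continuous[OF assms] K(1)] by (rule compact_imp_bounded)
  then obtain M where M: "\<And>x. x \<in> K \<Longrightarrow> \<bar>\<phi> x\<bar> \<le> M" by (auto simp: bounded_iff)
  have "\<bar>\<phi> x\<bar> \<le> \<bar>M\<bar>" for x using M[of x] K(2)[of x] by (cases "x \<in> K") auto
  then show ?thesis using that[of "\<bar>M\<bar>"] by simp
qed

context bounded_domain
begin

lemma test_funs_L2:
  assumes "\<phi> \<in> test_funs \<Omega>"
  shows "\<phi> \<in> L2 \<Omega>"
proof -
  obtain M where "\<And>x. \<bar>\<phi> x\<bar> \<le> M" by (rule test_funs_bounded[OF assms]) blast
  then show ?thesis
    using assms dom by (intro L2_bounded[where M = M] continuous_imp_measurable_on_sets_lebesgue test_funs_continuous) auto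
qed

lemma subspace_test_fields: "subspace (test_fields \<Omega>)"
proof (rule subspaceI)
  show "0 \<in> test_fields \<Omega>"
    using subspace_0[OF subspace_test_funs] by (auto simp: test_fields_def zero_fun_def)
next
  fix F G assume "F \<in> test_fields \<Omega>" "G \<in> test_fields \<Omega>"
  then show "F + G \<in> test_fields \<Omega>"
    using subspace_add[OF subspace_test_funs] unfolding test_fields_def
    by (auto simp: plus_fun_def)
next
  fix c F assume "F \<in> test_fields \<Omega>"
  then show "c *\<^sub>R F \<in> test_fields \<Omega>"
    using subspace_scale[OF subspace_test_funs, of _ \<Omega> c] unfolding test_fields_def
    by (auto simp: scaleR_fun_def)
qed

lemma test_fields_component: "\<Phi> \<in> test_fields \<Omega> \<Longrightarrow> (\<lambda>x. \<Phi> x $ i) \<in> test_funs \<Omega>"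
  by (simp add: test_fields_def)

lemma test_fields_axis:
  assumes "\<phi> \<in> test_funs \<Omega>"
  shows "(\<lambda>x. axis i (\<phi> x)) \<in> test_fields \<Omega>"
proof -
  have "(\<lambda>x. axis i (\<phi> x) $ j) = (if j = i then \<phi> else 0)" for j
    by (auto simp: axis_def fun_eq_iff)
  then show ?thesis
    using assms subspace_0[OF subspace_test_funs] by (simp add: test_fields_def)
qed

lemma test_fields_L2:
  assumes "\<Phi> \<in> test_fields \<Omega>"
  shows "\<Phi> \<in> L2 \<Omega>"
  using assms test_funs_L2 test_fields_component unfolding L2_vec_iff by blast

lemma partial_test_add:
  assumes "\<phi> \<in> test_funs \<Omega>" "\<psi> \<in> test_funs \<Omega>"
  shows "partial i (\<lambda>y. \<phi> y + \<psi> y) x = partial i \<phi> x + partial i \<psi> x"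
  using assms by (intro partial_add smooth_differentiable test_funs_smooth)

lemma partial_test_scaleR:
  assumes "\<phi> \<in> test_funs \<Omega>"
  shows "partial i (\<lambda>y. c * \<phi> y) x = c * partial i \<phi> x"
  using partial_scaleR[OF smooth_differentiable[OF test_funs_smooth[OF assms]], of i c x]
  by (simp add: scaleR_fun_def)

lemma div_cl_L2:
  assumes "\<Phi> \<in> test_fields \<Omega>"
  shows "div_cl \<Phi> \<in> L2 \<Omega>"
proof -
  have "div_cl \<Phi> = (\<Sum>i\<in>UNIV. partial i (\<lambda>y. \<Phi> y $ i))"
    unfolding div_cl_def sum_3 by (simp add: plus_fun_def)
  then show ?thesis
    using assms by (simp add: subspace_sum[OF subspace_L2] test_funs_L2 test_funs_partial test_fields_component)
qed

lemma grad_cl_L2: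
  assumes "\<phi> \<in> test_funs \<Omega>"
  shows "grad_cl \<phi> \<in> L2 \<Omega>"
  unfolding L2_vec_iff grad_cl_def using assms by (auto intro: test_funs_L2 test_funs_partial)

lemma curl_cl_L2:
  assumes "\<Phi> \<in> test_fields \<Omega>"
  shows "curl_cl \<Phi> \<in> L2 \<Omega>"
proof -
  have d: "(\<lambda>x. partial i (\<lambda>y. \<Phi> y $ j) x - partial k (\<lambda>y. \<Phi> y $ l) x) \<in> L2 \<Omega>" for i j k l
    using L2_diff[of "partial i (\<lambda>y. \<Phi> y $ j)" "partial k (\<lambda>y. \<Phi> y $ l)"] assms
    by (auto simp: fun_diff_def intro: test_funs_L2 test_funs_partial test_fields_component)
  show ?thesis
    unfolding L2_vec_iff curl_cl_def forall_3 Let_def by (simp add: vector_3 d)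
qed

lemma div_cl_add:
  assumes "\<Phi> \<in> test_fields \<Omega>" "\<Psi> \<in> test_fields \<Omega>"
  shows "div_cl (\<Phi> + \<Psi>) = div_cl \<Phi> + div_cl \<Psi>"
  using partial_test_add[OF test_fields_component[OF assms(1)] test_fields_component[OF assms(2)]]
  by (simp add: div_cl_def fun_eq_iff sum.distrib)

lemma div_cl_scaleR:
  assumes "\<Phi> \<in> test_fields \<Omega>"
  shows "div_cl (c *\<^sub>R \<Phi>) = c *\<^sub>R div_cl \<Phi>"
  using partial_test_scaleR[OF test_fields_component[OF assms]]
  by (simp add: div_cl_def fun_eq_iff scaleR_fun_def sum_distrib_left)

lemma curl_cl_add:
  assumes "\<Phi> \<in> test_fields \<Omega>" "\<Psi> \<in> test_fields \<Omega>"
  shows "curl_cl (\<Phi> + \<Psi>) = curl_cl \<Phi> + curl_cl \<Psi>"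
  using partial_test_add[OF test_fields_component[OF assms(1)] test_fields_component[OF assms(2)]]
  by (simp add: curl_cl_def fun_eq_iff vec_eq_iff forall_3 Let_def)

lemma curl_cl_scaleR:
  assumes "\<Phi> \<in> test_fields \<Omega>"
  shows "curl_cl (c *\<^sub>R \<Phi>) = c *\<^sub>R curl_cl \<Phi>"
  using partial_test_scaleR[OF test_fields_component[OF assms]]
  by (simp add: curl_cl_def fun_eq_iff vec_eq_iff forall_3 Let_def scaleR_fun_def algebra_simps)

text \<open>The fundamental lemma applied to test fields \<open>\<phi> e\<^sub>i\<close>, one component at a time.\<close>

lemma test_fields_separate:
  assumes g: "g \<in> L2 \<Omega>"
    and orth: "\<And>\<Phi>. \<Phi> \<in> test_fields \<Omega> \<Longrightarrow> ip g \<Phi> = 0"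
  shows "ae g 0"
proof -
  have "ae (\<lambda>x. g x $ i) 0" for i
  proof (rule fundamental_lemma)
    show "(\<lambda>x. g x $ i) \<in> L2 \<Omega>" using g L2_vec_iff by blast
    fix \<phi> assume "\<phi> \<in> test_funs \<Omega>"
    then have "ip g (\<lambda>x. axis i (\<phi> x)) = 0" by (intro orth test_fields_axis)
    then show "ip (\<lambda>x. g x $ i) \<phi> = 0" by (simp add: L2_inner_def inner_axis)
  qed
  then show ?thesis using ae_eq_0_components by blast
qed

text \<open>All three notions of weak derivative have the form \<open>(f, A \<Phi>) = s (g, \<Phi>)\<close> for \<open>\<Phi>\<close> in a class \<open>T\<close> of
test functions, with \<open>A\<close> a classical operator and \<open>s = \<plusminus>1\<close>; the algebra is done once for all of
them.\<close>

definition weak_deriv :: "(real^3 \<Rightarrow> 'b::euclidean_space) set \<Rightarrow> ((real^3 \<Rightarrow> 'b) \<Rightarrow> real^3 \<Rightarrow> 'a::euclidean_space) \<Rightarrow>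
    real \<Rightarrow> (real^3 \<Rightarrow> 'a) \<Rightarrow> (real^3 \<Rightarrow> 'b) \<Rightarrow> bool" where
  "weak_deriv T A s f g \<longleftrightarrow> f \<in> L2 \<Omega> \<and> g \<in> L2 \<Omega> \<and> (\<forall>\<Phi>\<in>T. ip f (A \<Phi>) = s * ip g \<Phi>)"

definition separating :: "(real^3 \<Rightarrow> 'b::euclidean_space) set \<Rightarrow> ((real^3 \<Rightarrow> 'b) \<Rightarrow> real^3 \<Rightarrow> 'a::euclidean_space) \<Rightarrow> bool" where
  "separating T A \<longleftrightarrow> (\<forall>\<Phi>\<in>T. \<Phi> \<in> L2 \<Omega> \<and> A \<Phi> \<in> L2 \<Omega>) \<and>
     (\<forall>h\<in>L2 \<Omega>. (\<forall>\<Phi>\<in>T. ip h \<Phi> = 0) \<longrightarrow> ae h 0)"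

lemma weak_deriv_eqs:
  "has_grad \<Omega> = weak_deriv (test_fields \<Omega>) div_cl (-1)"
  "has_curl \<Omega> = weak_deriv (test_fields \<Omega>) curl_cl 1"
  "has_div \<Omega> = weak_deriv (test_funs \<Omega>) grad_cl (-1)"
  by (simp_all add: fun_eq_iff has_grad_def has_curl_def has_div_def weak_deriv_def)

lemma separating_tests:
  "separating (test_fields \<Omega>) div_cl" "separating (test_fields \<Omega>) curl_cl" "separating (test_funs \<Omega>) grad_cl"
  unfolding separating_def
  by (simp_all add: test_fields_L2 test_funs_L2 div_cl_L2 curl_cl_L2 grad_cl_L2
      test_fields_separate fundamental_lemma)

lemma weak_deriv_0: "weak_deriv T A s 0 0"
  by (simp add: weak_deriv_def L2_inner_def subspace_0[OF subspace_L2])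

lemma weak_deriv_add:
  assumes "separating T A" "weak_deriv T A s f g" "weak_deriv T A s f' g'"
  shows "weak_deriv T A s (f + f') (g + g')"
proof -
  have "ip (f + f') (A \<Phi>) = s * ip (g + g') \<Phi>" if T: "\<Phi> \<in> T" for \<Phi>
  proof -
    have "ip (f + f') (A \<Phi>) = ip f (A \<Phi>) + ip f' (A \<Phi>)" "ip (g + g') \<Phi> = ip g \<Phi> + ip g' \<Phi>"
      using bilinear_form_on_L2_inner assms T
      unfolding bilinear_form_on_def linear_form_on_def weak_deriv_def separating_def by blast+
    then show ?thesis using assms(2,3) T by (simp add: weak_deriv_def algebra_simps)
  qed
  then show ?thesis using assms by (auto simp: weak_deriv_def intro: L2_add)
qed

lemma weak_deriv_scaleR: "weak_deriv T A s f g \<Longrightarrow> weak_deriv T A s (c *\<^sub>R f) (c *\<^sub>R g)"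
  by (auto simp: weak_deriv_def L2_scaleR) (simp add: L2_inner_def scaleR_fun_def)

lemma weak_deriv_unique:
  assumes sep: "separating T A" and "s \<noteq> 0" and w: "weak_deriv T A s f g" "weak_deriv T A s f' g'" and "ae f f'"
  shows "ae g g'"
proof -
  have L: "f \<in> L2 \<Omega>" "g \<in> L2 \<Omega>" "f' \<in> L2 \<Omega>" "g' \<in> L2 \<Omega>" using w by (auto simp: weak_deriv_def)
  have "ip (g - g') \<Phi> = 0" if T: "\<Phi> \<in> T" for \<Phi>
  proof -
    have \<Phi>: "\<Phi> \<in> L2 \<Omega>" "A \<Phi> \<in> L2 \<Omega>" using sep T by (auto simp: separating_def)
    have "ip f (A \<Phi>) = ip f' (A \<Phi>)"
      using L \<Phi> assms(5) by (intro L2_inner_ae_cong) auto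
    then have "ip g \<Phi> = ip g' \<Phi>" using w T \<open>s \<noteq> 0\<close> by (auto simp: weak_deriv_def)
    moreover have "linear_form_on (L2 \<Omega>) (\<lambda>h. ip h \<Phi>)"
      using bilinear_form_on_L2_inner \<Phi> by (auto simp: bilinear_form_on_def)
    ultimately show ?thesis using linear_form_on_diff[OF subspace_L2 _ L(2,4)] by fastforce
  qed
  then have "ae (g - g') 0" using sep L2_diff[OF L(2,4)] by (simp add: separating_def)
  then show ?thesis by (simp add: ae_eq_diff_0_iff)
qed

text \<open>An operator that selects one of the weak derivatives is linear up to null sets, because the sum of
two selected derivatives is again a weak derivative of the sum, and weak derivatives are unique.\<close>

lemma ae_linear_on_weak_deriv:
  assumes sep: "separating T A" and s: "s \<noteq> 0"
    and D: "\<And>f g. weak_deriv T A s f g \<Longrightarrow> weak_deriv T A s f (D f)"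
  shows "ae_linear_on {f. \<exists>g. weak_deriv T A s f g} D"
  unfolding ae_linear_on_def
proof (intro conjI ballI allI)
  fix f f' assume "f \<in> {f. \<exists>g. weak_deriv T A s f g}" "f' \<in> {f. \<exists>g. weak_deriv T A s f g}"
  then have "weak_deriv T A s (f + f') (D f + D f')" using D weak_deriv_add[OF sep] by blast
  then show "ae (D (f + f')) (D f + D f')" using weak_deriv_unique[OF sep s D _ ae_eq_refl] by blast
next
  fix c f assume "f \<in> {f. \<exists>g. weak_deriv T A s f g}"
  then have "weak_deriv T A s (c *\<^sub>R f) (c *\<^sub>R D f)" using D weak_deriv_scaleR by blast
  then show "ae (D (c *\<^sub>R f)) (c *\<^sub>R D f)" using weak_deriv_unique[OF sep s D _ ae_eq_refl] by blast
next
  fix f assume "f \<in> {f. \<exists>g. weak_deriv T A s f g}"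
  then show "D f \<in> L2 \<Omega>" using D by (auto simp: weak_deriv_def)
qed

lemma weak_derivs_unique:
  "has_grad \<Omega> f g \<Longrightarrow> has_grad \<Omega> f' g' \<Longrightarrow> ae f f' \<Longrightarrow> ae g g'"
  "has_curl \<Omega> F G \<Longrightarrow> has_curl \<Omega> F' G' \<Longrightarrow> ae F F' \<Longrightarrow> ae G G'"
  "has_div \<Omega> C d \<Longrightarrow> has_div \<Omega> C' d' \<Longrightarrow> ae C C' \<Longrightarrow> ae d d'"
  unfolding weak_deriv_eqs
  by (rule weak_deriv_unique[OF separating_tests(1), where s = "-1"]
      weak_deriv_unique[OF separating_tests(2), where s = 1]
      weak_deriv_unique[OF separating_tests(3), where s = "-1"], simp, assumption, assumption, assumption)+

lemma weak_derivs_0: "has_grad \<Omega> 0 0" "has_curl \<Omega> 0 0" "has_div \<Omega> 0 0"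
  unfolding weak_deriv_eqs by (rule weak_deriv_0)+

lemma weak_derivs_selected:
  "has_grad \<Omega> f g \<Longrightarrow> has_grad \<Omega> f (grad \<Omega> f)"
  "has_curl \<Omega> F G \<Longrightarrow> has_curl \<Omega> F (curl \<Omega> F)"
  "has_div \<Omega> C d \<Longrightarrow> has_div \<Omega> C (dvg \<Omega> C)"
  unfolding grad_def curl_def dvg_def
  by (rule someI[of "has_grad \<Omega> f"] someI[of "has_curl \<Omega> F"] someI[of "has_div \<Omega> C"], assumption)+

lemma ae_linear_on_operators:
  "ae_linear_on {f. \<exists>g. has_grad \<Omega> f g} (grad \<Omega>)"
  "ae_linear_on {F. \<exists>G. has_curl \<Omega> F G} (curl \<Omega>)"
  "ae_linear_on {C. \<exists>d. has_div \<Omega> C d} (dvg \<Omega>)"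
  unfolding weak_deriv_eqs
  by (rule ae_linear_on_weak_deriv[OF separating_tests(1)] ae_linear_on_weak_deriv[OF separating_tests(2)]
      ae_linear_on_weak_deriv[OF separating_tests(3)], simp,
      erule weak_derivs_selected[unfolded weak_deriv_eqs])+

lemma ae_linear_on_vec:
  fixes D :: "'n::finite \<Rightarrow> 'a::real_vector \<Rightarrow> real^3 \<Rightarrow> 'b::euclidean_space"
  assumes "\<And>i. ae_linear_on Z (D i)"
  shows "ae_linear_on Z (\<lambda>z x. \<chi> i. D i z x)"
proof -
  have all: "ae F G" if "\<And>i. ae (\<lambda>x. F x $ i) (\<lambda>x. G x $ i)" for F G :: "real^3 \<Rightarrow> 'b^'n"
    using that ae_eq_vec_iff by blast
  show ?thesis
    unfolding ae_linear_on_def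
  proof (intro conjI ballI allI)
    fix z assume "z \<in> Z"
    then show "(\<lambda>x. \<chi> i. D i z x) \<in> L2 \<Omega>"
      using assms by (simp add: L2_vec_iff ae_linear_on_def)
  next
    fix z w assume "z \<in> Z" "w \<in> Z"
    then have "ae (D i (z + w)) (D i z + D i w)" for i
      using assms by (simp add: ae_linear_on_def)
    then show "ae (\<lambda>x. \<chi> i. D i (z + w) x) ((\<lambda>x. \<chi> i. D i z x) + (\<lambda>x. \<chi> i. D i w x))"
      by (intro all) (simp add: plus_fun_def)
  next
    fix c z assume "z \<in> Z"
    then have "ae (D i (c *\<^sub>R z)) (c *\<^sub>R D i z)" for i
      using assms by (simp add: ae_linear_on_def)
    then show "ae (\<lambda>x. \<chi> i. D i (c *\<^sub>R z) x) (c *\<^sub>R (\<lambda>x. \<chi> i. D i z x))"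
      by (intro all) (simp add: scaleR_fun_def)
  qed
qed

lemma H1_0_has_grad: "f \<in> H1_0 \<Omega> \<Longrightarrow> has_grad \<Omega> f (grad \<Omega> f)"
  unfolding H1_0_def using weak_derivs_selected(1) by blast

lemma H1_0_vec_L2: "u \<in> H1_0_vec \<Omega> \<Longrightarrow> u \<in> L2 \<Omega>"
  using H1_0_has_grad unfolding L2_vec_iff[of u] H1_0_vec_def has_grad_def by blast

lemma Hcurl_0_has_curl: "F \<in> Hcurl_0 \<Omega> \<Longrightarrow> has_curl \<Omega> F (curl \<Omega> F)"
  unfolding Hcurl_0_def using weak_derivs_selected(2) by blast

lemma Hdiv_0_has_div: "C \<in> Hdiv_0 \<Omega> \<Longrightarrow> has_div \<Omega> C (dvg \<Omega> C)"
  unfolding Hdiv_0_def using weak_derivs_selected(3) by blast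

lemma ae_linear_on_jac:
  shows "ae_linear_on (H1_0_vec \<Omega>) (jac \<Omega>)"
  unfolding jac_def
proof (rule ae_linear_on_vec)
  fix i
  show "ae_linear_on (H1_0_vec \<Omega>) (\<lambda>u x. grad \<Omega> (\<lambda>y. u y $ i) x)"
    by (rule ae_linear_on_compose[OF ae_linear_on_operators(1), where \<pi> = "\<lambda>u y. u y $ i"])
      (auto simp: H1_0_vec_def scaleR_fun_def plus_fun_def dest: H1_0_has_grad)
qed

text \<open>The divergence of a vector field with weak gradients is the trace of its Jacobian: use the test
fields \<open>\<phi> e\<^sub>i\<close> in the definition of the weak gradient of the component \<open>i\<close>.\<close>

lemma H1_0_vec_has_div:
  assumes u: "u \<in> H1_0_vec \<Omega>"
  shows "has_div \<Omega> u (\<Sum>i\<in>UNIV. (\<lambda>x. grad \<Omega> (\<lambda>y. u y $ i) x $ i))"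
proof -
  have g: "has_grad \<Omega> (\<lambda>y. u y $ i) (grad \<Omega> (\<lambda>y. u y $ i))" for i
    using u by (simp add: H1_0_vec_def H1_0_has_grad)
  define d where "d i = (\<lambda>x. grad \<Omega> (\<lambda>y. u y $ i) x $ i)" for i
  have d: "d i \<in> L2 \<Omega>" for i
    using g[of i] unfolding has_grad_def d_def L2_vec_iff by blast
  have uL2: "u \<in> L2 \<Omega>" using u by (rule H1_0_vec_L2)
  have "ip u (grad_cl \<phi>) = - ip (sum d UNIV) \<phi>" if \<phi>: "\<phi> \<in> test_funs \<Omega>" for \<phi>
  proof -
    have comp: "ip (\<lambda>y. u y $ i) (partial i \<phi>) = - ip (d i) \<phi>" for i
    proof -
      have e: "(\<lambda>x. axis i (\<phi> x) $ j) = (if j = i then \<phi> else (\<lambda>x. 0))" for j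
        by (auto simp: axis_def fun_eq_iff)
      have "div_cl (\<lambda>x. axis i (\<phi> x)) x = (\<Sum>j\<in>UNIV. if j = i then partial i \<phi> x else 0)" for x
        unfolding div_cl_def e by (rule sum.cong) (auto simp: partial_const)
      then have "div_cl (\<lambda>x. axis i (\<phi> x)) = partial i \<phi>" by (simp add: fun_eq_iff)
      moreover have "ip (grad \<Omega> (\<lambda>y. u y $ i)) (\<lambda>x. axis i (\<phi> x)) = ip (d i) \<phi>"
        by (simp add: L2_inner_def inner_axis d_def)
      ultimately show ?thesis
        using g[of i] test_fields_axis[OF \<phi>, of i] unfolding has_grad_def by metis
    qed
    have "ip u (grad_cl \<phi>) = (\<Sum>i\<in>UNIV. ip (\<lambda>y. u y $ i) (partial i \<phi>))"
      using L2_inner_vec[OF uL2 grad_cl_L2[OF \<phi>]] by (simp add: grad_cl_def)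
    also have "\<dots> = - (\<Sum>i\<in>UNIV. 1 * ip (d i) \<phi>)"
      by (simp add: comp sum_negf)
    also have "(\<Sum>i\<in>UNIV. 1 * ip (d i) \<phi>) = ip (\<Sum>i\<in>UNIV. 1 *\<^sub>R d i) \<phi>"
      by (rule linear_form_on_sum[OF subspace_L2, symmetric])
        (use bilinear_form_on_L2_inner test_funs_L2[OF \<phi>] d in \<open>auto simp: bilinear_form_on_def\<close>)
    finally show ?thesis by simp
  qed
  then show ?thesis
    using uL2 d subspace_sum[OF subspace_L2, of UNIV d] unfolding has_div_def d_def by blast
qed

text \<open>The common pattern of \<open>Hcurl_0\<close> and \<open>Hdiv_0\<close>: closures of test fields in a graph norm.\<close>

lemma subspace_graph_closure:
  fixes P :: "(real^3 \<Rightarrow> 'a::euclidean_space) \<Rightarrow> (real^3 \<Rightarrow> 'b::euclidean_space) \<Rightarrow> bool"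
  assumes P_L2: "\<And>f g. P f g \<Longrightarrow> f \<in> L2 \<Omega> \<and> g \<in> L2 \<Omega>"
    and P_add: "\<And>f g f' g'. P f g \<Longrightarrow> P f' g' \<Longrightarrow> P (f + f') (g + g')"
    and P_scale: "\<And>c f g. P f g \<Longrightarrow> P (c *\<^sub>R f) (c *\<^sub>R g)" and P_0: "P 0 0"
    and T: "subspace T" and T_L2: "\<And>\<phi>. \<phi> \<in> T \<Longrightarrow> \<phi> \<in> L2 \<Omega> \<and> A \<phi> \<in> L2 \<Omega>"
    and A_add: "\<And>\<phi> \<psi>. \<phi> \<in> T \<Longrightarrow> \<psi> \<in> T \<Longrightarrow> A (\<phi> + \<psi>) = A \<phi> + A \<psi>"
    and A_scale: "\<And>c \<phi>. \<phi> \<in> T \<Longrightarrow> A (c *\<^sub>R \<phi>) = c *\<^sub>R A \<phi>"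
  shows "subspace {f. \<exists>g. P f g \<and> (\<exists>\<phi>::nat \<Rightarrow> _. (\<forall>n. \<phi> n \<in> T) \<and>
     (\<lambda>n. nrm (\<phi> n - f)) \<longlonglongrightarrow> 0 \<and> (\<lambda>n. nrm (A (\<phi> n) - g)) \<longlonglongrightarrow> 0)}" (is "subspace ?H")
proof (rule subspaceI)
  have "A 0 = 0" using A_scale[OF subspace_0[OF T], of 0] by simp
  then have "P 0 0 \<and> (\<forall>n::nat. 0 \<in> T) \<and> (\<lambda>n. nrm (0 - 0 :: real^3 \<Rightarrow> 'a)) \<longlonglongrightarrow> 0 \<and>
     (\<lambda>n. nrm (A 0 - 0)) \<longlonglongrightarrow> 0"
    using P_0 subspace_0[OF T] by (simp add: L2_norm_def L2_inner_def)
  then show "0 \<in> ?H"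
    by (intro CollectI exI[of _ 0] conjI exI[of _ "\<lambda>_. 0"]) auto
next
  fix f f' assume "f \<in> ?H" "f' \<in> ?H"
  then obtain g g' \<phi> \<phi>' where *: "P f g" "P f' g'" "\<And>n. \<phi> n \<in> T" "\<And>n. \<phi>' n \<in> T"
    "(\<lambda>n. nrm (\<phi> n - f)) \<longlonglongrightarrow> 0" "(\<lambda>n. nrm (A (\<phi> n) - g)) \<longlonglongrightarrow> 0"
    "(\<lambda>n. nrm (\<phi>' n - f')) \<longlonglongrightarrow> 0" "(\<lambda>n. nrm (A (\<phi>' n) - g')) \<longlonglongrightarrow> 0"
    by blast
  have lim: "(\<lambda>n. nrm (a n + b n - (c + d))) \<longlonglongrightarrow> 0"
    if "(\<lambda>n. nrm (a n - c)) \<longlonglongrightarrow> 0" "(\<lambda>n. nrm (b n - d)) \<longlonglongrightarrow> 0"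
      "\<And>n. a n \<in> L2 \<Omega>" "\<And>n. b n \<in> L2 \<Omega>" "c \<in> L2 \<Omega>" "d \<in> L2 \<Omega>"
    for a b :: "nat \<Rightarrow> real^3 \<Rightarrow> 'c::euclidean_space" and c d
  proof (rule tendsto_sandwich[OF _ _ tendsto_const])
    show "(\<lambda>n. nrm (a n - c) + nrm (b n - d)) \<longlonglongrightarrow> 0"
      using tendsto_add[OF that(1,2)] by simp
    have "nrm (a n + b n - (c + d)) \<le> nrm (a n - c) + nrm (b n - d)" for n
      using L2_norm_triangle[OF L2_diff[OF that(3,5)] L2_diff[OF that(4,6)], of n n] by (simp add: algebra_simps)
    then show "\<forall>\<^sub>F n in sequentially. nrm (a n + b n - (c + d)) \<le> nrm (a n - c) + nrm (b n - d)"
      by simp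
  qed simp
  have "(\<lambda>n. nrm (\<phi> n + \<phi>' n - (f + f'))) \<longlonglongrightarrow> 0"
    using * P_L2[OF *(1)] P_L2[OF *(2)] T_L2[OF *(3)] T_L2[OF *(4)] by (intro lim) auto
  moreover have "(\<lambda>n. nrm (A (\<phi> n) + A (\<phi>' n) - (g + g'))) \<longlonglongrightarrow> 0"
    using * P_L2[OF *(1)] P_L2[OF *(2)] T_L2[OF *(3)] T_L2[OF *(4)] by (intro lim) auto
  ultimately have "P (f + f') (g + g') \<and> (\<forall>n. \<phi> n + \<phi>' n \<in> T) \<and>
     (\<lambda>n. nrm (\<phi> n + \<phi>' n - (f + f'))) \<longlonglongrightarrow> 0 \<and>
     (\<lambda>n. nrm (A (\<phi> n + \<phi>' n) - (g + g'))) \<longlonglongrightarrow> 0"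
    using * P_add T A_add by (simp add: subspace_add)
  then show "f + f' \<in> ?H"
    by (intro CollectI exI[of _ "g + g'"] conjI exI[of _ "\<lambda>n. \<phi> n + \<phi>' n"]) auto
next
  fix c f assume "f \<in> ?H"
  then obtain g \<phi> where *: "P f g" "\<And>n. \<phi> n \<in> T"
    "(\<lambda>n. nrm (\<phi> n - f)) \<longlonglongrightarrow> 0" "(\<lambda>n. nrm (A (\<phi> n) - g)) \<longlonglongrightarrow> 0"
    by blast
  have lim: "(\<lambda>n. nrm (c *\<^sub>R a n - c *\<^sub>R d)) \<longlonglongrightarrow> 0"
    if "(\<lambda>n. nrm (a n - d)) \<longlonglongrightarrow> 0" for a :: "nat \<Rightarrow> real^3 \<Rightarrow> 'c::euclidean_space" and d
    using tendsto_mult_left[OF that, of "\<bar>c\<bar>"]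
    by (simp add: scaleR_diff_right[symmetric] L2_norm_scaleR)
  have "P (c *\<^sub>R f) (c *\<^sub>R g) \<and> (\<forall>n. c *\<^sub>R \<phi> n \<in> T) \<and>
     (\<lambda>n. nrm (c *\<^sub>R \<phi> n - c *\<^sub>R f)) \<longlonglongrightarrow> 0 \<and>
     (\<lambda>n. nrm (A (c *\<^sub>R \<phi> n) - c *\<^sub>R g)) \<longlonglongrightarrow> 0"
    using * P_scale T A_scale lim[OF *(3)] lim[OF *(4)] by (simp add: subspace_scale)
  then show "c *\<^sub>R f \<in> ?H"
    by (intro CollectI exI[of _ "c *\<^sub>R g"] conjI exI[of _ "\<lambda>n. c *\<^sub>R \<phi> n"]) auto
qed

lemma subspace_Hcurl_0: "subspace (Hcurl_0 \<Omega>)"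
  unfolding Hcurl_0_def
proof (rule subspace_graph_closure)
  show "f \<in> L2 \<Omega> \<and> g \<in> L2 \<Omega>" if "has_curl \<Omega> f g" for f g
    using that by (simp add: has_curl_def)
  show "\<phi> \<in> L2 \<Omega> \<and> curl_cl \<phi> \<in> L2 \<Omega>" if "\<phi> \<in> test_fields \<Omega>" for \<phi>
    using that by (simp add: test_fields_L2 curl_cl_L2)
qed (rule weak_deriv_add[OF separating_tests(2), where s = 1, folded weak_deriv_eqs] weak_deriv_scaleR[where T = "test_fields \<Omega>" and A = curl_cl and s = 1, folded weak_deriv_eqs]
    weak_derivs_0 subspace_test_fields curl_cl_add curl_cl_scaleR; assumption?)+

lemma subspace_Hdiv_0: "subspace (Hdiv_0 \<Omega>)"
  unfolding Hdiv_0_def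
proof (rule subspace_graph_closure)
  show "f \<in> L2 \<Omega> \<and> g \<in> L2 \<Omega>" if "has_div \<Omega> f g" for f g
    using that by (simp add: has_div_def)
  show "\<phi> \<in> L2 \<Omega> \<and> div_cl \<phi> \<in> L2 \<Omega>" if "\<phi> \<in> test_fields \<Omega>" for \<phi>
    using that by (simp add: test_fields_L2 div_cl_L2)
qed (rule weak_deriv_add[OF separating_tests(3), where s = "-1", folded weak_deriv_eqs] weak_deriv_scaleR[where T = "test_funs \<Omega>" and A = grad_cl and s = "-1", folded weak_deriv_eqs]
    weak_derivs_0 subspace_test_fields div_cl_add div_cl_scaleR; assumption?)+

end

section \<open>The Poincare inequality\<close>

lemma integrable_compact_support:
  fixes f :: "'a::euclidean_space \<Rightarrow> real"
  assumes "continuous_on UNIV f" "compact K" "\<And>x. x \<notin> K \<Longrightarrow> f x = 0"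
  shows "integrable lborel f"
proof -
  have "integrable lborel (\<lambda>x. indicator K x *\<^sub>R f x)"
    by (rule borel_integrable_compact[OF assms(2) continuous_on_subset[OF assms(1)]]) simp
  moreover have "(\<lambda>x. indicator K x *\<^sub>R f x) = f" using assms(3) by (auto simp: indicator_def fun_eq_iff)
  ultimately show ?thesis by simp
qed

text \<open>By translation invariance the difference quotients of \<open>f\<close> in direction \<open>e\<close> have integral zero;
they converge to \<open>D\<close> and, by the mean value theorem, are bounded and supported in a fixed ball.\<close>

lemma integral_directional_derivative_0:
  fixes f D :: "'a::euclidean_space \<Rightarrow> real" and e :: 'a
  assumes der: "\<And>x t. ((\<lambda>t. f (x + t *\<^sub>R e)) has_real_derivative D (x + t *\<^sub>R e)) (at t)"
    and cont: "continuous_on UNIV f" "continuous_on UNIV D"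
    and K: "compact K" "\<And>x. x \<notin> K \<Longrightarrow> f x = 0" "\<And>x. x \<notin> K \<Longrightarrow> D x = 0"
  shows "(LINT x|lborel. D x) = 0"
proof -
  have fint: "integrable lborel f" by (rule integrable_compact_support[OF cont(1) K(1,2)])
  obtain R where R: "\<And>x. x \<in> K \<Longrightarrow> norm x \<le> R" using compact_imp_bounded[OF K(1)] by (auto simp: bounded_iff)
  have "bounded (D ` K)"
    using compact_continuous_image[OF continuous_on_subset[OF cont(2)] K(1)] by (simp add: compact_imp_bounded)
  then obtain M0 where M0: "\<And>x. x \<in> K \<Longrightarrow> \<bar>D x\<bar> \<le> M0" by (auto simp: bounded_iff)
  define M where "M = \<bar>M0\<bar>"
  have M: "\<bar>D x\<bar> \<le> M" for x using M0[of x] K(3)[of x] by (cases "x \<in> K") (auto simp: M_def)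
  define t where "t n = 1 / (real n + 1)" for n
  have t: "0 < t n" "t n \<le> 1" for n by (auto simp: t_def)
  have t0: "t \<longlonglongrightarrow> 0" unfolding t_def by (rule LIMSEQ_Suc[OF lim_1_over_n, simplified of_nat_Suc add.commute[of 1]])
  define s where "s n x = (f (x + t n *\<^sub>R e) - f x) / t n" for n x
  have "(\<lambda>n. LINT x|lborel. s n x) \<longlonglongrightarrow> (LINT x|lborel. D x)"
  proof (rule integral_dominated_convergence[where w = "\<lambda>x. M * indicator (cball 0 (R + norm e)) x"])
    show "integrable lborel (\<lambda>x::'a. M * indicator (cball 0 (R + norm e)) x)"
      by (intro integrable_mult_right integrable_real_indicator emeasure_lborel_cball_finite) simp
    show "D \<in> borel_measurable lborel" using borel_measurable_continuous_onI[OF cont(2)] by simp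
    show "s n \<in> borel_measurable lborel" for n
    proof -
      have "continuous_on UNIV (\<lambda>x. f (x + t n *\<^sub>R e))"
        by (rule continuous_on_compose2[OF cont(1)]) (auto intro!: continuous_intros)
      then have "continuous_on UNIV (s n)"
        unfolding s_def using cont(1) t[of n] by (intro continuous_intros) auto
      then show ?thesis using borel_measurable_continuous_onI by simp
    qed
    show "AE x in lborel. (\<lambda>n. s n x) \<longlonglongrightarrow> D x"
    proof (rule AE_I2)
      fix x
      have "((\<lambda>h. (f (x + h *\<^sub>R e) - f x) / h) \<longlongrightarrow> D x) (at 0)"
        using der[of x 0] by (simp add: DERIV_def)
      moreover have "filterlim t (at 0) sequentially"
        using t0 t by (intro filterlim_atI) (auto simp: less_imp_neq[symmetric])
      ultimately show "(\<lambda>n. s n x) \<longlonglongrightarrow> D x"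
        unfolding s_def by (rule filterlim_compose)
    qed
    show "AE x in lborel. norm (s n x) \<le> M * indicator (cball 0 (R + norm e)) x" for n
    proof (rule AE_I2)
      fix x
      obtain z where z: "0 < z" "z < t n" "f (x + t n *\<^sub>R e) - f (x + 0 *\<^sub>R e) = (t n - 0) * D (x + z *\<^sub>R e)"
        using MVT2[of 0 "t n" "\<lambda>t. f (x + t *\<^sub>R e)" "\<lambda>t. D (x + t *\<^sub>R e)"] der t[of n] by blast
      have s: "s n x = D (x + z *\<^sub>R e)" using z t[of n] by (simp add: s_def)
      show "norm (s n x) \<le> M * indicator (cball 0 (R + norm e)) x"
      proof (cases "x \<in> cball 0 (R + norm e)")
        case True then show ?thesis using M s by simp
      next
        case False
        have "norm (z *\<^sub>R e) \<le> norm e"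
          using z t[of n] by (simp add: mult_left_le_one_le)
        then have "norm (x + z *\<^sub>R e) > R"
          using False norm_diff_ineq[of x "z *\<^sub>R e"] by simp
        then have "D (x + z *\<^sub>R e) = 0" using R K(3) by (meson not_le)
        then show ?thesis using s False by simp
      qed
    qed
  qed
  moreover have "(LINT x|lborel. s n x) = 0" for n
  proof -
    have shift: "(\<lambda>x. f (x + t n *\<^sub>R e)) = (\<lambda>x. f (t n *\<^sub>R e + x))" by (simp add: add.commute)
    have fm: "f \<in> borel_measurable borel" using borel_measurable_continuous_onI[OF cont(1)] .
    have "integrable (distr lborel borel ((+) (t n *\<^sub>R e))) f" using fint by (simp add: lborel_distr_plus)
    then have i: "integrable lborel (\<lambda>x. f (t n *\<^sub>R e + x))"
      by (rule integrable_distr[rotated]) simp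
    have "(LINT x|lborel. f (t n *\<^sub>R e + x)) = (LINT x|distr lborel borel ((+) (t n *\<^sub>R e)). f x)"
      using fm by (intro integral_distr[symmetric]) auto
    then have "(LINT x|lborel. f (t n *\<^sub>R e + x)) = (LINT x|lborel. f x)" by (simp add: lborel_distr_plus)
    then have "(LINT x|lborel. f (x + t n *\<^sub>R e)) = (LINT x|lborel. f x)" unfolding shift .
    then show ?thesis unfolding s_def using i[folded shift] fint by simp
  qed
  ultimately show ?thesis by (simp add: LIMSEQ_const_iff)
qed

context bounded_domain
begin

text \<open>Integrate the derivative of \<open>x\<^sub>i \<phi>\<^sup>2\<close> in direction \<open>i\<close>: \<open>\<parallel>\<phi>\<parallel>\<^sup>2 = - 2 (x\<^sub>i \<phi>, \<partial>\<^sub>i \<phi>)\<close>,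
and \<open>\<bar>x\<^sub>i\<bar> \<le> R\<close> on \<open>\<Omega>\<close>.\<close>

lemma Poincare_test_funs:
  obtains R where "R \<ge> 0" "\<And>\<phi> i. \<phi> \<in> test_funs \<Omega> \<Longrightarrow> nrm \<phi> \<le> 2 * R * nrm (partial i \<phi>)"
proof -
  obtain R0 where R0: "\<And>x. x \<in> \<Omega> \<Longrightarrow> norm x \<le> R0" using dom by (auto simp: bounded_iff)
  define R where "R = \<bar>R0\<bar>"
  have R: "R \<ge> 0" "\<And>x. x \<in> \<Omega> \<Longrightarrow> norm x \<le> R" using R0 by (force simp: R_def)+
  have "nrm \<phi> \<le> 2 * R * nrm (partial i \<phi>)" if \<phi>: "\<phi> \<in> test_funs \<Omega>" for \<phi> i
  proof -
    obtain K where K: "compact K" "K \<subseteq> \<Omega>" "\<And>x. x \<notin> K \<Longrightarrow> \<phi> x = 0" "\<And>i x. x \<notin> K \<Longrightarrow> partial i \<phi> x = 0"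
      by (rule test_funs_support[OF \<phi>]) blast
    define e :: "real^3" where "e = axis i 1"
    define f where "f x = x $ i * (\<phi> x * \<phi> x)" for x
    define D where "D x = \<phi> x * \<phi> x + 2 * (x $ i * \<phi> x * partial i \<phi> x)" for x
    have der: "((\<lambda>t. f (x + t *\<^sub>R e)) has_real_derivative D (x + t *\<^sub>R e)) (at t)" for x t
    proof -
      have "(\<phi> has_derivative frechet_derivative \<phi> (at (x + t *\<^sub>R e))) (at (x + t *\<^sub>R e))"
        using smooth_differentiable[OF test_funs_smooth[OF \<phi>]] frechet_derivative_works by blast
      moreover have "((\<lambda>t. x + t *\<^sub>R e) has_derivative (\<lambda>h. h *\<^sub>R e)) (at t)"
        by (auto intro!: derivative_eq_intros)
      ultimately have "((\<lambda>t. \<phi> (x + t *\<^sub>R e)) has_derivative (\<lambda>h. frechet_derivative \<phi> (at (x + t *\<^sub>R e)) (h *\<^sub>R e))) (at t)"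
        by (rule has_derivative_compose[rotated])
      moreover have "frechet_derivative \<phi> (at (x + t *\<^sub>R e)) (h *\<^sub>R e) = partial i \<phi> (x + t *\<^sub>R e) * h" for h
        using linear_frechet_derivative[OF smooth_differentiable[OF test_funs_smooth[OF \<phi>]], of "x + t *\<^sub>R e"]
        by (simp add: linear_scale partial_def e_def)
      ultimately have 1: "((\<lambda>t. \<phi> (x + t *\<^sub>R e)) has_real_derivative partial i \<phi> (x + t *\<^sub>R e)) (at t)"
        by (simp add: has_field_derivative_def)
      have "((\<lambda>t. x $ i + t) has_real_derivative 1) (at t)" by (auto intro!: derivative_eq_intros)
      moreover have "(\<lambda>t. (x + t *\<^sub>R e) $ i) = (\<lambda>t. x $ i + t)" by (simp add: e_def)
      ultimately have 2: "((\<lambda>t. (x + t *\<^sub>R e) $ i) has_real_derivative 1) (at t)" by simp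
      show ?thesis
        unfolding f_def using DERIV_mult[OF 2 DERIV_mult[OF 1 1]] by (simp add: D_def algebra_simps)
    qed
    have contphi: "continuous_on UNIV \<phi>" "continuous_on UNIV (partial i \<phi>)"
      using test_funs_continuous[OF \<phi>] test_funs_continuous[OF test_funs_partial[OF \<phi>]] by auto
    have "continuous_on UNIV f" unfolding f_def using contphi by (intro continuous_intros)
    moreover have "continuous_on UNIV D" unfolding D_def using contphi by (intro continuous_intros)
    ultimately have D0: "(LINT x|lborel. D x) = 0"
      using der K by (intro integral_directional_derivative_0[OF der _ _ K(1)]) (auto simp: f_def D_def)
    define \<psi> where "\<psi> x = x $ i * \<phi> x" for x
    have meas: "\<Omega> \<in> sets lebesgue" using dom by auto
    have \<phi>L: "\<phi> \<in> L2 \<Omega>" "partial i \<phi> \<in> L2 \<Omega>"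
      using \<phi> by (auto intro: test_funs_L2 test_funs_partial)
    have le: "AE x in \<mu>. \<bar>\<psi> x\<bar> \<le> R * \<bar>\<phi> x\<bar>"
    proof (rule AE_I2)
      fix x assume "x \<in> space \<mu>"
      then have "norm x \<le> R" using R by simp
      then have "\<bar>x $ i\<bar> \<le> R" using component_le_norm_cart[of x i] by linarith
      then show "\<bar>\<psi> x\<bar> \<le> R * \<bar>\<phi> x\<bar>" by (simp add: \<psi>_def abs_mult mult_right_mono)
    qed
    have "continuous_on \<Omega> \<psi>"
      unfolding \<psi>_def by (intro continuous_intros continuous_on_subset[OF contphi(1)]) auto
    then have \<psi>L: "\<psi> \<in> L2 \<Omega>"
      using le meas by (intro L2_bound[OF \<phi>L(1)] continuous_imp_measurable_on_sets_lebesgue) auto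
    have "(LINT x|lborel. D x) = (LINT x|lebesgue. D x)"
      by (rule integral_completion[symmetric]) (simp add: borel_measurable_continuous_onI \<open>continuous_on UNIV D\<close>)
    also have "\<dots> = (LINT x|lebesgue. indicator \<Omega> x *\<^sub>R D x)"
    proof (rule Bochner_Integration.integral_cong)
      fix x
      have "D x = 0" if "x \<notin> \<Omega>"
      proof -
        have "x \<notin> K" using that K(2) by blast
        then show ?thesis using K(3,4) by (simp add: D_def)
      qed
      then show "D x = indicator \<Omega> x *\<^sub>R D x" by (cases "x \<in> \<Omega>") auto
    qed simp
    also have "\<dots> = (LINT x|\<mu>. \<phi> x \<bullet> \<phi> x + 2 * (\<psi> x \<bullet> partial i \<phi> x))"
      using meas by (simp add: integral_restrict_space D_def \<psi>_def)
    also have "\<dots> = ip \<phi> \<phi> + 2 * ip \<psi> (partial i \<phi>)"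
      unfolding L2_inner_def using L2_inner_integrable[OF \<phi>L(1) \<phi>L(1)] L2_inner_integrable[OF \<psi>L \<phi>L(2)] by simp
    finally have "ip \<phi> \<phi> = - 2 * ip \<psi> (partial i \<phi>)" using D0 by simp
    also have "\<dots> \<le> 2 * (nrm \<psi> * nrm (partial i \<phi>))"
      using L2_Cauchy_Schwarz[OF \<psi>L \<phi>L(2)] by linarith
    also have "nrm \<psi> \<le> R * nrm \<phi>"
    proof -
      have "ip \<psi> \<psi> \<le> (LINT x|\<mu>. R\<^sup>2 * (\<phi> x \<bullet> \<phi> x))"
        unfolding L2_inner_def
      proof (rule integral_mono_AE)
        show "AE x in \<mu>. \<psi> x \<bullet> \<psi> x \<le> R\<^sup>2 * (\<phi> x \<bullet> \<phi> x)"
          using le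
        proof eventually_elim
          case (elim x)
          then have "\<bar>\<psi> x\<bar>\<^sup>2 \<le> (R * \<bar>\<phi> x\<bar>)\<^sup>2" by (intro power_mono) auto
          then show ?case by (simp add: power_mult_distrib power2_eq_square[symmetric])
        qed
      qed (use L2_inner_integrable[OF \<psi>L \<psi>L] L2_inner_integrable[OF \<phi>L(1) \<phi>L(1)] in auto)
      also have "\<dots> = R\<^sup>2 * ip \<phi> \<phi>" by (simp add: L2_inner_def)
      finally have "sqrt (ip \<psi> \<psi>) \<le> sqrt (R\<^sup>2 * ip \<phi> \<phi>)" by (rule real_sqrt_le_mono)
      then show ?thesis using R(1) by (simp add: L2_norm_def real_sqrt_mult)
    qed
    finally have *: "nrm \<phi> * nrm \<phi> \<le> nrm \<phi> * (2 * R * nrm (partial i \<phi>))"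
      using L2_norm_power2[of \<phi>] by (simp add: mult_right_mono power2_eq_square mult_ac)
    show ?thesis
    proof (cases "nrm \<phi> = 0")
      case True then show ?thesis using R(1) by simp
    next
      case False
      then have "nrm \<phi> > 0" using L2_norm_nonneg[of \<phi>] by linarith
      then show ?thesis using * by simp
    qed
  qed
  then show ?thesis using that R(1) by blast
qed

text \<open>The Poincare inequality passes from test functions to their limits.\<close>

lemma H1_0_zero_if_grad_zero:
  assumes u: "u \<in> H1_0 \<Omega>" and g0: "ae (grad \<Omega> u) 0"
  shows "ae u 0"
proof -
  obtain g \<phi> where g: "has_grad \<Omega> u g" and \<phi>: "\<And>n. \<phi> n \<in> test_funs \<Omega>"
    and lim: "(\<lambda>n. nrm (\<phi> n - u)) \<longlonglongrightarrow> 0" "(\<lambda>n. nrm (grad_cl (\<phi> n) - g)) \<longlonglongrightarrow> 0"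
    using u unfolding H1_0_def by blast
  have gL: "g \<in> L2 \<Omega>" and uL: "u \<in> L2 \<Omega>" using g by (auto simp: has_grad_def)
  have "ae g 0"
    using weak_derivs_unique(1)[OF g weak_derivs_selected(1)[OF g] ae_eq_refl] g0 ae_eq_trans by blast
  then have ng: "nrm g = 0" using L2_norm_eq_0_iff[OF gL] by simp
  obtain R where R: "R \<ge> 0" "\<And>\<phi> i. \<phi> \<in> test_funs \<Omega> \<Longrightarrow> nrm \<phi> \<le> 2 * R * nrm (partial i \<phi>)"
    by (rule Poincare_test_funs) blast
  have "nrm u \<le> nrm (\<phi> n - u) + 2 * R * nrm (grad_cl (\<phi> n) - g)" for n
  proof -
    have \<phi>L: "\<phi> n \<in> L2 \<Omega>" using \<phi> by (auto intro: test_funs_L2)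
    have GL: "grad_cl (\<phi> n) \<in> L2 \<Omega>" using \<phi> by (auto intro: grad_cl_L2)
    have neg: "nrm (- (\<phi> n - u)) = nrm (\<phi> n - u)"
      using L2_norm_scaleR[of "-1" "\<phi> n - u"] by simp
    have "nrm (\<phi> n + - (\<phi> n - u)) \<le> nrm (\<phi> n) + nrm (- (\<phi> n - u))"
      using L2_diff[OF uL \<phi>L] by (intro L2_norm_triangle \<phi>L) simp
    then have "nrm u \<le> nrm (\<phi> n) + nrm (\<phi> n - u)"
      unfolding neg by simp
    moreover have "nrm (\<phi> n) \<le> 2 * R * nrm (partial 1 (\<phi> n))" using R \<phi> by blast
    moreover have "nrm (partial 1 (\<phi> n)) \<le> nrm (grad_cl (\<phi> n))"
      using L2_norm_nth_le[OF GL, of 1] by (simp add: grad_cl_def)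
    moreover have "nrm (grad_cl (\<phi> n)) \<le> nrm (grad_cl (\<phi> n) - g) + nrm g"
      using L2_norm_triangle[OF L2_diff[OF GL gL] gL] by simp
    moreover have "2 * R * nrm (partial 1 (\<phi> n)) \<le> 2 * R * nrm (grad_cl (\<phi> n) - g)"
      using calculation R(1) ng by (intro mult_left_mono) auto
    ultimately show ?thesis by linarith
  qed
  moreover have "(\<lambda>n. nrm (\<phi> n - u) + 2 * R * nrm (grad_cl (\<phi> n) - g)) \<longlonglongrightarrow> 0 + 2 * R * 0"
    by (intro tendsto_intros lim)
  ultimately have "nrm u \<le> 0"
    by (intro LIMSEQ_le_const) auto
  then have "nrm u = 0" using L2_norm_nonneg[of u] by linarith
  then show ?thesis using L2_norm_eq_0_iff[OF uL] by simp
qed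

end

section \<open>Finite element spaces\<close>

text \<open>What the theory uses of the polynomials on one cell. A finite-dimensional superspace suffices here
and spares the choice of bases.\<close>

definition local_space :: "(real^3 \<Rightarrow> 'b::euclidean_space) set \<Rightarrow> bool" where
  "local_space P \<longleftrightarrow> subspace P \<and> (\<exists>B. finite B \<and> P \<subseteq> span B) \<and> (\<forall>p\<in>P. continuous_on UNIV p)"

lemma finite_multi_indices: "finite {a :: 3 \<Rightarrow> nat. (\<Sum>i\<in>UNIV. a i) \<le> k}"
proof (rule finite_subset)
  show "finite (PiE (UNIV :: 3 set) (\<lambda>_. {..k}))" by (rule finite_PiE) auto
  show "{a :: 3 \<Rightarrow> nat. (\<Sum>i\<in>UNIV. a i) \<le> k} \<subseteq> PiE UNIV (\<lambda>_. {..k})"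
  proof
    fix a :: "3 \<Rightarrow> nat" assume "a \<in> {a. (\<Sum>i\<in>UNIV. a i) \<le> k}"
    then have "a i \<le> k" for i using member_le_sum[of i UNIV a] by fastforce
    then show "a \<in> PiE UNIV (\<lambda>_. {..k})" by (auto simp: PiE_def)
  qed
qed

lemma local_space_span:
  assumes "finite B" "\<And>b. b \<in> B \<Longrightarrow> continuous_on UNIV b"
  shows "local_space (span B)"
proof -
  have "subspace {p :: real^3 \<Rightarrow> 'a. continuous_on UNIV p}"
    unfolding subspace_def by (auto simp: zero_fun_def plus_fun_def scaleR_fun_def intro!: continuous_intros)
  then have "span B \<subseteq> {p. continuous_on UNIV p}" using assms(2) by (intro span_minimal) auto
  then show ?thesis using assms(1) unfolding local_space_def by blast
qed

lemma local_space_subspace: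
  assumes "local_space P" "subspace P'" "P' \<subseteq> P"
  shows "local_space P'"
  using assms unfolding local_space_def by (meson order_trans subsetD)

lemma continuous_monomial: "continuous_on UNIV (monomial a)"
  unfolding monomial_def by (intro continuous_intros)

lemma local_space_polys: "local_space (polys k)"
proof -
  have "{monomial a |a. (\<Sum>i\<in>UNIV. a i) \<le> k} = monomial ` {a. (\<Sum>i\<in>UNIV. a i) \<le> k}" by auto
  then show ?thesis unfolding polys_def
    using finite_multi_indices[of k] by (auto intro!: local_space_span continuous_monomial)
qed

lemma local_space_hom_polys: "local_space (hom_polys k)"
proof (rule local_space_subspace[OF local_space_polys])
  show "hom_polys k \<subseteq> polys k" unfolding polys_def hom_polys_def by (rule span_mono) auto
qed (simp add: hom_polys_def)

lemma linear_span_image_subset: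
  assumes "linear \<Lambda>" "P \<subseteq> span B"
  shows "\<Lambda> ` P \<subseteq> span (\<Lambda> ` B)"
  using assms by (metis image_mono linear_span_image)

lemma local_space_vec_of:
  assumes P: "local_space P"
  shows "local_space (vec_of P)"
proof -
  obtain B where B: "finite B" "P \<subseteq> span B" using P by (auto simp: local_space_def)
  define \<Lambda> :: "3 \<Rightarrow> sfield \<Rightarrow> vfield" where "\<Lambda> i = (\<lambda>b x. axis i (b x))" for i
  have lin: "linear (\<Lambda> i)" for i
    by (rule linearI) (auto simp: \<Lambda>_def fun_eq_iff vec_eq_iff axis_def scaleR_fun_def)
  have "p \<in> span (\<Union>i. \<Lambda> i ` B)" if "p \<in> vec_of P" for p
  proof -
    have "\<Lambda> i (\<lambda>x. p x $ i) \<in> span (\<Lambda> i ` B)" for i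
      using linear_span_image_subset[OF lin B(2)] that by (auto simp: vec_of_def)
    then have "\<Lambda> i (\<lambda>x. p x $ i) \<in> span (\<Union>i. \<Lambda> i ` B)" for i
      using span_mono[of "\<Lambda> i ` B" "\<Union>i. \<Lambda> i ` B"] by blast
    then have "\<Lambda> 1 (\<lambda>x. p x $ 1) + \<Lambda> 2 (\<lambda>x. p x $ 2) + \<Lambda> 3 (\<lambda>x. p x $ 3) \<in> span (\<Union>i. \<Lambda> i ` B)"
      by (intro span_add)
    moreover have "\<Lambda> 1 (\<lambda>x. p x $ 1) + \<Lambda> 2 (\<lambda>x. p x $ 2) + \<Lambda> 3 (\<lambda>x. p x $ 3) = p"
      by (auto simp: \<Lambda>_def fun_eq_iff vec_eq_iff forall_3 axis_def)
    ultimately show ?thesis by simp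
  qed
  moreover have "finite (\<Union>i. \<Lambda> i ` B)" using B by auto
  moreover have "subspace (vec_of P)"
  proof -
    have sP: "subspace P" using P by (simp add: local_space_def)
    show ?thesis
    proof (rule subspaceI)
      show "0 \<in> vec_of P" using subspace_0[OF sP] by (simp add: vec_of_def zero_fun_def)
      show "f + g \<in> vec_of P" if "f \<in> vec_of P" "g \<in> vec_of P" for f g
        using that subspace_add[OF sP] unfolding vec_of_def by (auto simp: plus_fun_def)
      show "c *\<^sub>R f \<in> vec_of P" if "f \<in> vec_of P" for c f
        using that subspace_scale[OF sP, of _ c] unfolding vec_of_def by (auto simp: scaleR_fun_def)
    qed
  qed
  moreover have "continuous_on UNIV p" if "p \<in> vec_of P" for p
  proof -
    have "continuous_on UNIV (\<lambda>x. p x $ i)" for i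
      using that P by (simp add: vec_of_def local_space_def)
    then have "continuous_on UNIV (\<lambda>x. \<chi> i. p x $ i)" by (intro continuous_on_vec_lambda)
    then show ?thesis by simp
  qed
  ultimately show ?thesis unfolding local_space_def by blast
qed

text \<open>Nedelec and Raviart-Thomas spaces enrich polynomials by the image of homogeneous polynomials under
a linear multiplication operator.\<close>

lemma local_space_plus_image:
  fixes \<Lambda> :: "(real^3 \<Rightarrow> 'c::euclidean_space) \<Rightarrow> real^3 \<Rightarrow> 'b::euclidean_space"
  assumes P: "local_space P" and Q: "local_space Q" and lin: "linear \<Lambda>"
    and cont: "\<And>q. q \<in> Q \<Longrightarrow> continuous_on UNIV (\<Lambda> q)"
  shows "local_space {p + \<Lambda> q |p q. p \<in> P \<and> q \<in> Q}"
proof -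
  obtain B where B: "finite B" "P \<subseteq> span B" using P by (auto simp: local_space_def)
  obtain C where C: "finite C" "Q \<subseteq> span C" using Q by (auto simp: local_space_def)
  have sub: "subspace P" "subspace (\<Lambda> ` Q)"
    using P Q lin by (auto simp: local_space_def intro: linear_subspace_image)
  have eq: "{p + \<Lambda> q |p q. p \<in> P \<and> q \<in> Q} = {p + r |p r. p \<in> P \<and> r \<in> \<Lambda> ` Q}" by blast
  have "p + \<Lambda> q \<in> span (B \<union> \<Lambda> ` C)" if "p \<in> P" "q \<in> Q" for p q
  proof (rule span_add)
    show "p \<in> span (B \<union> \<Lambda> ` C)" using that B span_mono[of B "B \<union> \<Lambda> ` C"] by blast
    show "\<Lambda> q \<in> span (B \<union> \<Lambda> ` C)"
      using that linear_span_image_subset[OF lin C(2)] span_mono[of "\<Lambda> ` C" "B \<union> \<Lambda> ` C"] by blast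
  qed
  then have "{p + \<Lambda> q |p q. p \<in> P \<and> q \<in> Q} \<subseteq> span (B \<union> \<Lambda> ` C)" by blast
  moreover have "finite (B \<union> \<Lambda> ` C)" using B C by simp
  moreover have "subspace {p + \<Lambda> q |p q. p \<in> P \<and> q \<in> Q}" unfolding eq by (rule subspace_sums[OF sub])
  moreover have "continuous_on UNIV (p + \<Lambda> q)" if "p \<in> P" "q \<in> Q" for p q
    using that P cont unfolding local_space_def plus_fun_def by (intro continuous_intros) auto
  ultimately show ?thesis unfolding local_space_def by blast
qed

lemma local_space_ned_local: "local_space (ned_local k)"
proof -
  let ?L = "\<lambda>(q :: vfield) x. cross3 x (q x)"
  have "local_space {p + ?L q |p q. p \<in> vec_of (polys (k - 1)) \<and> q \<in> vec_of (hom_polys (k - 1))}"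
  proof (rule local_space_plus_image)
    show "linear ?L"
      by (rule linearI) (auto simp: fun_eq_iff scaleR_fun_def cross_add_right cross_mult_right)
    show "continuous_on UNIV (?L q)" if "q \<in> vec_of (hom_polys (k - 1))" for q
    proof -
      have "continuous_on UNIV q"
        using that local_space_vec_of[OF local_space_hom_polys] by (auto simp: local_space_def)
      then show ?thesis by (intro continuous_on_cross continuous_on_id)
    qed
  qed (intro local_space_vec_of local_space_polys local_space_hom_polys)+
  then show ?thesis by (simp add: ned_local_def plus_fun_def)
qed

lemma local_space_rt_local: "local_space (rt_local k)"
proof -
  let ?L = "\<lambda>(q :: sfield) x. q x *\<^sub>R x"
  have "local_space {p + ?L q |p q. p \<in> vec_of (polys (k - 1)) \<and> q \<in> hom_polys (k - 1)}"
  proof (rule local_space_plus_image)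
    show "linear ?L"
      by (rule linearI) (auto simp: fun_eq_iff scaleR_fun_def scaleR_add_left)
    show "continuous_on UNIV (?L q)" if "q \<in> hom_polys (k - 1)" for q
    proof -
      have "continuous_on UNIV q" using that local_space_hom_polys by (auto simp: local_space_def)
      then show ?thesis by (intro continuous_intros)
    qed
  qed (intro local_space_vec_of local_space_polys local_space_hom_polys)+
  then show ?thesis by (simp add: rt_local_def plus_fun_def)
qed

context bounded_domain
begin

lemma subspace_piecewise:
  assumes P: "subspace P"
  shows "subspace (piecewise \<Omega> \<T> P)"
proof (rule subspaceI)
  show "0 \<in> piecewise \<Omega> \<T> P" using subspace_0[OF P] by (auto simp: piecewise_def intro!: bexI[of _ 0])
next
  fix v w assume vw: "v \<in> piecewise \<Omega> \<T> P" "w \<in> piecewise \<Omega> \<T> P"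
  have "\<exists>p\<in>P. AE x in \<mu>. x \<in> K \<longrightarrow> (v + w) x = p x" if "K \<in> \<T>" for K
  proof -
    from vw that obtain p q where "p \<in> P" "q \<in> P" and pq: "AE x in \<mu>. x \<in> K \<longrightarrow> v x = p x"
      "AE x in \<mu>. x \<in> K \<longrightarrow> w x = q x" unfolding piecewise_def by blast
    then have "p + q \<in> P" using subspace_add[OF P] by blast
    moreover have "AE x in \<mu>. x \<in> K \<longrightarrow> (v + w) x = (p + q) x" using pq by eventually_elim simp
    ultimately show ?thesis by blast
  qed
  then show "v + w \<in> piecewise \<Omega> \<T> P" by (simp add: piecewise_def)
next
  fix c v assume v: "v \<in> piecewise \<Omega> \<T> P"
  have "\<exists>p\<in>P. AE x in \<mu>. x \<in> K \<longrightarrow> (c *\<^sub>R v) x = p x" if K: "K \<in> \<T>" for K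
  proof -
    obtain p where p: "p \<in> P" "AE x in \<mu>. x \<in> K \<longrightarrow> v x = p x"
      using v K by (auto simp: piecewise_def)
    have "AE x in \<mu>. x \<in> K \<longrightarrow> (c *\<^sub>R v) x = (c *\<^sub>R p) x"
      using p(2) by eventually_elim (simp add: scaleR_fun_def)
    then show ?thesis using subspace_scale[OF P p(1)] by blast
  qed
  then show "c *\<^sub>R v \<in> piecewise \<Omega> \<T> P" by (simp add: piecewise_def)
qed

text \<open>A continuous local function is bounded on the compact closure of \<open>\<Omega>\<close>, and there are finitely many
cells.\<close>

lemma piecewise_AE_bounded:
  fixes P :: "(real^3 \<Rightarrow> 'b::euclidean_space) set"
  assumes "finite \<T>" "\<Omega> \<subseteq> \<Union>\<T>" "local_space P" "v \<in> piecewise \<Omega> \<T> P"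
  obtains M where "AE x in \<mu>. norm (v x) \<le> M"
proof -
  have "\<exists>M. AE x in \<mu>. x \<in> K \<longrightarrow> norm (v x) \<le> M" if "K \<in> \<T>" for K
  proof -
    obtain p where p: "p \<in> P" "AE x in \<mu>. x \<in> K \<longrightarrow> v x = p x"
      using assms(4) \<open>K \<in> \<T>\<close> by (auto simp: piecewise_def)
    have "continuous_on (closure \<Omega>) p"
      using assms(3) p(1) continuous_on_subset by (auto simp: local_space_def)
    then have "bounded (p ` closure \<Omega>)"
      using dom(2) by (intro compact_imp_bounded compact_continuous_image) (auto simp: compact_closure)
    then obtain M where M: "\<And>x. x \<in> closure \<Omega> \<Longrightarrow> norm (p x) \<le> M" by (auto simp: bounded_iff)
    have "AE x in \<mu>. x \<in> \<Omega>" by (rule AE_I2) simp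
    with p(2) have "AE x in \<mu>. x \<in> K \<longrightarrow> norm (v x) \<le> M"
      by eventually_elim (use M closure_subset[of \<Omega>] in auto)
    then show ?thesis by blast
  qed
  then have "\<forall>K\<in>\<T>. \<exists>M. AE x in \<mu>. x \<in> K \<longrightarrow> norm (v x) \<le> M" by blast
  from bchoice[OF this] obtain M where
    M: "\<forall>K\<in>\<T>. AE x in \<mu>. x \<in> K \<longrightarrow> norm (v x) \<le> M K" ..
  have "AE x in \<mu>. x \<in> \<Omega>" by (rule AE_I2) simp
  moreover have "AE x in \<mu>. \<forall>K\<in>\<T>. x \<in> K \<longrightarrow> norm (v x) \<le> M K"
    using M assms(1) by (intro AE_ball_countable') (auto intro: countable_finite)
  ultimately have "AE x in \<mu>. norm (v x) \<le> (\<Sum>K\<in>\<T>. \<bar>M K\<bar>)"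
  proof eventually_elim
    case (elim x)
    then obtain K where K: "K \<in> \<T>" "x \<in> K" using assms(2) by blast
    then have "norm (v x) \<le> \<bar>M K\<bar>" using elim by force
    also have "\<dots> \<le> (\<Sum>K\<in>\<T>. \<bar>M K\<bar>)" using K assms(1) by (intro member_le_sum) auto
    finally show ?case .
  qed
  then show ?thesis using that by blast
qed

abbreviation "finite_dim_ae \<equiv> finite_dim_modulo {f. ae f 0}"

text \<open>Restricting the generators of the local space to disjoint pieces, one for each cell, yields the
generators; cells are added one at a time, and \<open>R1\<close>, \<open>R2\<close> restrict to the union of the earlier
cells and to its complement, so that overlaps do no harm.\<close>

lemma finite_dim_ae_piecewise:
  fixes P :: "(real^3 \<Rightarrow> 'b::euclidean_space) set"
  assumes fin: "finite \<T>" and cover: "\<Omega> \<subseteq> \<Union>\<T>" and P: "local_space P"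
  shows "finite_dim_ae (piecewise \<Omega> \<T> P)"
proof -
  obtain B where B: "finite B" "P \<subseteq> span B" using P by (auto simp: local_space_def)
  have "\<exists>B'. finite B' \<and> (\<forall>v\<in>piecewise \<Omega> \<T> P. \<exists>m\<in>span B'. AE x in \<mu>. x \<in> \<Union>\<T> \<longrightarrow> v x = m x)"
    using fin
  proof (induction \<T> rule: finite_induct)
    case empty
    have "0 \<in> span {}" by (rule span_zero)
    then show ?case by (intro exI[of _ "{}"]) auto
  next
    case (insert K F)
    then obtain B' where B': "finite B'"
      "\<And>v. v \<in> piecewise \<Omega> F P \<Longrightarrow> \<exists>m\<in>span B'. AE x in \<mu>. x \<in> \<Union>F \<longrightarrow> v x = m x" by blast
    define R1 :: "(real^3 \<Rightarrow> 'b) \<Rightarrow> real^3 \<Rightarrow> 'b" where "R1 b = (\<lambda>x. if x \<in> \<Union>F then b x else 0)" for b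
    define R2 :: "(real^3 \<Rightarrow> 'b) \<Rightarrow> real^3 \<Rightarrow> 'b" where "R2 b = (\<lambda>x. if x \<in> \<Union>F then 0 else b x)" for b
    have lin: "linear R1" "linear R2"
      by (auto intro!: linearI simp: R1_def R2_def fun_eq_iff scaleR_fun_def)
    have "\<exists>m\<in>span (R1 ` B' \<union> R2 ` B). AE x in \<mu>. x \<in> \<Union>(insert K F) \<longrightarrow> v x = m x"
      if v: "v \<in> piecewise \<Omega> (insert K F) P" for v
    proof -
      have "v \<in> piecewise \<Omega> F P" using v by (auto simp: piecewise_def)
      then obtain m where m: "m \<in> span B'" "AE x in \<mu>. x \<in> \<Union>F \<longrightarrow> v x = m x"
        using B'(2) by blast
      obtain p where p: "p \<in> P" "AE x in \<mu>. x \<in> K \<longrightarrow> v x = p x"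
        using v by (auto simp: piecewise_def)
      have "R1 m \<in> span (R1 ` B')" using linear_span_image_subset[OF lin(1) order_refl] m(1) by blast
      moreover have "R2 p \<in> span (R2 ` B)" using linear_span_image_subset[OF lin(2) B(2)] p(1) by blast
      ultimately have "R1 m + R2 p \<in> span (R1 ` B' \<union> R2 ` B)"
        using span_mono[of "R1 ` B'" "R1 ` B' \<union> R2 ` B"] span_mono[of "R2 ` B" "R1 ` B' \<union> R2 ` B"]
        by (intro span_add) auto
      moreover have "AE x in \<mu>. x \<in> \<Union>(insert K F) \<longrightarrow> v x = (R1 m + R2 p) x"
        using m(2) p(2) by eventually_elim (auto simp: R1_def R2_def)
      ultimately show ?thesis by blast
    qed
    then show ?case using B'(1) B(1) by (intro exI[of _ "R1 ` B' \<union> R2 ` B"]) auto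
  qed
  then obtain B' where B': "finite B'"
    "\<And>v. v \<in> piecewise \<Omega> \<T> P \<Longrightarrow> \<exists>m\<in>span B'. AE x in \<mu>. x \<in> \<Union>\<T> \<longrightarrow> v x = m x" by blast
  have "\<exists>m\<in>span B'. ae v m" if v: "v \<in> piecewise \<Omega> \<T> P" for v
  proof -
    obtain m where m: "m \<in> span B'" "AE x in \<mu>. x \<in> \<Union>\<T> \<longrightarrow> v x = m x" using B'(2)[OF v] by blast
    have "AE x in \<mu>. x \<in> \<Omega>" by (rule AE_I2) simp
    with m(2) have "AE x in \<mu>. v x = m x" by eventually_elim (use cover in auto)
    then show ?thesis using m(1) by (auto simp: ae_eq_def)
  qed
  then show ?thesis using B'(1) unfolding finite_dim_modulo_def by (auto simp: ae_eq_diff_0_iff)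
qed

lemma simplicial_mesh_finite_cover:
  assumes "simplicial_mesh \<Omega> \<T>"
  shows "finite \<T>" "\<Omega> \<subseteq> \<Union>\<T>"
  using assms closure_subset by (auto simp: simplicial_mesh_def triangulation_def)

lemma standard_fe_complex_local_spaces:
  assumes "standard_fe_complex \<Omega> \<T> G E D L"
  obtains PE PD PL where "local_space PE" "local_space PD" "local_space PL"
    "E = Hcurl_0 \<Omega> \<inter> piecewise \<Omega> \<T> PE" "D = Hdiv_0 \<Omega> \<inter> piecewise \<Omega> \<T> PD"
    "L = L2_0 \<Omega> \<inter> piecewise \<Omega> \<T> PL"
proof -
  have "\<exists>P. local_space P \<and> E = Hcurl_0 \<Omega> \<inter> piecewise \<Omega> \<T> P"
    using assms local_space_ned_local local_space_vec_of[OF local_space_polys]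
    unfolding standard_fe_complex_def nedelec1_def nedelec2_def by metis
  moreover have "\<exists>P. local_space P \<and> D = Hdiv_0 \<Omega> \<inter> piecewise \<Omega> \<T> P"
    using assms local_space_rt_local local_space_vec_of[OF local_space_polys]
    unfolding standard_fe_complex_def raviart_thomas_def bdm_def by metis
  moreover have "\<exists>P. local_space P \<and> L = L2_0 \<Omega> \<inter> piecewise \<Omega> \<T> P"
    using assms local_space_polys unfolding standard_fe_complex_def discontinuous_def by metis
  ultimately show ?thesis using that by blast
qed

lemma subspace_L2_0:
  shows "subspace (L2_0 \<Omega>)"
proof -
  have one: "(\<lambda>x. 1 :: real) \<in> L2 \<Omega>" by (rule L2_bounded[OF dom(2,1), where M = 1]) (simp_all add: AE_I2)
  have "L2_0 \<Omega> = {q \<in> L2 \<Omega>. ip q (\<lambda>x. 1) = 0}" by (simp add: L2_0_def L2_inner_def)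
  moreover have lin: "linear_form_on (L2 \<Omega>) (\<lambda>q. ip q (\<lambda>x. 1 :: real))"
    using bilinear_form_on_L2_inner one by (auto simp: bilinear_form_on_def)
  moreover have "ip 0 (\<lambda>x. 1 :: real) = 0" by (simp add: L2_inner_def)
  ultimately show ?thesis
    by (auto simp only: linear_form_on_def mem_Collect_eq intro!: subspaceI L2_add L2_scaleR subspace_0[OF subspace_L2])
qed

end

section \<open>The linearized problem\<close>

lemma sqrt_form_scaleR:
  assumes "bilinear_form_on W Q" "subspace W" "x \<in> W"
  shows "sqrt (Q (c *\<^sub>R x) (c *\<^sub>R x)) = \<bar>c\<bar> * sqrt (Q x x)"
proof -
  have "c *\<^sub>R x \<in> W" using assms by (simp add: subspace_scale)
  then have "Q (c *\<^sub>R x) (c *\<^sub>R x) = c\<^sup>2 * Q x x"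
    using assms by (simp add: bilinear_form_on_def linear_form_on_def power2_eq_square)
  then show ?thesis by (simp add: real_sqrt_mult)
qed

context bounded_domain
begin

lemma L2_inner_ae_0:
  assumes "f \<in> L2 \<Omega>" "g \<in> L2 \<Omega>"
  shows "ae f 0 \<Longrightarrow> ip f g = 0" "ae g 0 \<Longrightarrow> ip f g = 0"
proof -
  show "ip f g = 0" if "ae f 0"
    using L2_inner_ae_cong[OF assms(1) subspace_0[OF subspace_L2] assms(2) assms(2) that ae_eq_refl] by (simp add: L2_inner_def)
  show "ip f g = 0" if "ae g 0"
    using L2_inner_ae_cong[OF assms(1) assms(1) assms(2) subspace_0[OF subspace_L2] ae_eq_refl that] by (simp add: L2_inner_def)
qed

lemma curl_ae_0:
  assumes "F \<in> Hcurl_0 \<Omega>" "ae F 0"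
  shows "ae (curl \<Omega> F) 0"
  using weak_derivs_unique(2)[OF Hcurl_0_has_curl[OF assms(1)] weak_derivs_0(2) assms(2)] .

lemma dvg_ae_0:
  assumes "has_div \<Omega> C g" "ae C 0"
  shows "ae (dvg \<Omega> C) 0"
  using weak_derivs_unique(3)[OF weak_derivs_selected(3)[OF assms(1)] weak_derivs_0(3) assms(2)] .

lemma jac_component: "(\<lambda>x. jac \<Omega> u x $ i) = grad \<Omega> (\<lambda>y. u y $ i)"
  by (simp add: jac_def)

lemma jac_ae_0:
  assumes "u \<in> H1_0_vec \<Omega>" "ae u 0"
  shows "ae (jac \<Omega> u) 0"
  unfolding ae_eq_0_components[of "jac \<Omega> u"] jac_component
proof
  fix i
  have "ae (\<lambda>x. u x $ i) 0" using assms(2) ae_eq_0_components by blast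
  then show "ae (grad \<Omega> (\<lambda>x. u x $ i)) 0"
    using assms weak_derivs_unique(1)[OF H1_0_has_grad weak_derivs_0(1)] by (simp add: H1_0_vec_def)
qed

lemma H1_0_vec_zero_if_jac_zero:
  assumes "u \<in> H1_0_vec \<Omega>" "ae (jac \<Omega> u) 0"
  shows "ae u 0"
  unfolding ae_eq_0_components[of u]
proof
  fix i
  have "ae (grad \<Omega> (\<lambda>x. u x $ i)) 0"
    using assms(2) unfolding ae_eq_0_components[of "jac \<Omega> u"] jac_component by blast
  then show "ae (\<lambda>x. u x $ i) 0"
    using H1_0_zero_if_grad_zero assms(1) by (simp add: H1_0_vec_def)
qed

lemma bounded_bilinear_cross3: "bounded_bilinear cross3"
  using bilinear_cross by (simp add: bilinear_conv_bounded_bilinear)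

lemma bounded_bilinear_matrix_vector: "bounded_bilinear ((*v) :: real^3^3 \<Rightarrow> real^3 \<Rightarrow> real^3)"
  unfolding bilinear_conv_bounded_bilinear[symmetric]
  by (auto simp: bilinear_def matrix_vector_mult_add_rdistrib scaleR_matrix_vector_assoc
      intro!: linearI[where f = "\<lambda>A :: real^3^3. A *v _"] matrix_vector_mul_linear)

end

text \<open>The problem on one mesh for given \<open>um\<close> and \<open>Bm\<close>, reduced to the facts about finite element spaces
that the proof needs: they are conforming, finite-dimensional up to null sets, bounded (for \<open>um\<close>
and \<open>Bm\<close>), exact from the face space on, and inf-sup stable in the weak sense that only the zero
pressure is orthogonal to all divergences.\<close>

locale mhd_step = bounded_domain +
  fixes E D V :: "vfield set" and L Q :: "sfield set"
    and Rey Rmag S :: real and um Bm :: vfield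
  assumes coeffs: "Rey > 0" "Rmag > 0" "S > 0"
    and spaces: "subspace V" "subspace E" "subspace D" "subspace Q" "subspace L"
    and conforming: "V \<subseteq> H1_0_vec \<Omega>" "E \<subseteq> Hcurl_0 \<Omega>" "D \<subseteq> Hdiv_0 \<Omega>" "Q \<subseteq> L2 \<Omega>" "L \<subseteq> L2 \<Omega>"
    and findim: "finite_dim_ae V" "finite_dim_ae E" "finite_dim_ae D" "finite_dim_ae Q" "finite_dim_ae L"
    and um: "um \<in> borel_measurable \<mu>" "\<exists>M. AE x in \<mu>. norm (um x) \<le> M"
    and Bm: "Bm \<in> borel_measurable \<mu>" "\<exists>M. AE x in \<mu>. norm (Bm x) \<le> M"
    and dvg_D: "\<And>C. C \<in> D \<Longrightarrow> dvg \<Omega> C \<in> L"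
    and exact_D: "\<And>C. C \<in> D \<Longrightarrow> ae (dvg \<Omega> C) 0 \<Longrightarrow> \<exists>F\<in>E. ae C (curl \<Omega> F)"
    and exact_L: "\<And>s. s \<in> L \<Longrightarrow> \<exists>C\<in>D. ae s (dvg \<Omega> C)"
    and inf_sup: "\<And>q. q \<in> Q \<Longrightarrow> (\<And>v. v \<in> V \<Longrightarrow> ip (dvg \<Omega> v) q = 0) \<Longrightarrow> ae q 0"
begin

abbreviation X where "X \<equiv> V \<times> E \<times> D"
abbreviation Y where "Y \<equiv> Q \<times> L"

abbreviation "a \<equiv> a_form \<Omega> Rey Rmag S um Bm"
abbreviation "b \<equiv> b_form \<Omega>"
abbreviation "saddle \<equiv> saddle_solution \<Omega> Rey Rmag S um Bm X Y"
abbreviation "picard f \<equiv> picard_solution \<Omega> Rey Rmag S f um Bm X Y"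

definition
  "current U = fst (snd U) + cross_field (fst U) Bm"

lemma subspace_X: "subspace X" and subspace_Y: "subspace Y"
  using spaces by (auto intro!: subspace_Times)

lemma V_L2: "V \<subseteq> L2 \<Omega>"
  using conforming H1_0_vec_L2 by blast

lemma E_L2: "E \<subseteq> L2 \<Omega>" and D_L2: "D \<subseteq> L2 \<Omega>"
  using conforming Hcurl_0_has_curl Hdiv_0_has_div by (auto simp: has_curl_def has_div_def)

lemma ae_linear_velocity: "ae_linear_on X (\<lambda>U. fst U)"
  by (rule ae_linear_on_compose[OF ae_linear_on_id[OF V_L2]]) auto

lemma ae_linear_electric: "ae_linear_on X (\<lambda>U. fst (snd U))"
  by (rule ae_linear_on_compose[OF ae_linear_on_id[OF E_L2]]) auto

lemma ae_linear_magnetic: "ae_linear_on X (\<lambda>U. snd (snd U))"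
  by (rule ae_linear_on_compose[OF ae_linear_on_id[OF D_L2]]) auto

lemma ae_linear_velocity_jac: "ae_linear_on X (\<lambda>U. jac \<Omega> (fst U))"
  by (rule ae_linear_on_compose[OF ae_linear_on_jac]) (use conforming in auto)

lemma ae_linear_convect: "ae_linear_on X (\<lambda>U. convect \<Omega> um (fst U))"
proof -
  obtain M where "AE x in \<mu>. norm (um x) \<le> M" using um by blast
  then show ?thesis unfolding convect_def
    by (rule ae_linear_on_bounded_bilinear[OF bounded_bilinear_matrix_vector ae_linear_velocity_jac um(1)])
qed

lemma ae_linear_current: "ae_linear_on X current"
proof -
  obtain M where "AE x in \<mu>. norm (Bm x) \<le> M" using Bm by blast
  then have "ae_linear_on X (\<lambda>U. cross_field (fst U) Bm)" unfolding cross_field_def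
    by (rule ae_linear_on_bounded_bilinear[OF bounded_bilinear_cross3 ae_linear_velocity Bm(1)])
  then show ?thesis unfolding current_def by (intro ae_linear_on_add ae_linear_electric)
qed

lemma E_has_curl: "F \<in> E \<Longrightarrow> \<exists>g. has_curl \<Omega> F g"
  using Hcurl_0_has_curl conforming by blast

lemma ae_linear_electric_curl: "ae_linear_on X (\<lambda>U. curl \<Omega> (fst (snd U)))"
  by (rule ae_linear_on_compose[OF ae_linear_on_operators(2)])
    (use E_has_curl in auto)

lemma V_has_div: "v \<in> V \<Longrightarrow> \<exists>g. has_div \<Omega> v g"
  using H1_0_vec_has_div conforming by blast

lemma D_has_div: "C \<in> D \<Longrightarrow> \<exists>g. has_div \<Omega> C g"
  using Hdiv_0_has_div conforming by blast

lemma ae_linear_velocity_dvg: "ae_linear_on X (\<lambda>U. dvg \<Omega> (fst U))"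
  by (rule ae_linear_on_compose[OF ae_linear_on_operators(3)]) (use V_has_div in auto)

lemma ae_linear_magnetic_dvg: "ae_linear_on X (\<lambda>U. dvg \<Omega> (snd (snd U)))"
  by (rule ae_linear_on_compose[OF ae_linear_on_operators(3)]) (use D_has_div in auto)

lemma ae_linear_pressures: "ae_linear_on Y (\<lambda>y. fst y)" "ae_linear_on Y (\<lambda>y. snd y)"
  using ae_linear_on_compose[OF ae_linear_on_id[OF conforming(4)], of Y fst]
    ae_linear_on_compose[OF ae_linear_on_id[OF conforming(5)], of Y snd] by auto

text \<open>In this form bilinearity can be read off term by term.\<close>

lemma a_eq: "a U W = (1/2) * ip (convect \<Omega> um (fst U)) (fst W)
    + (-1/2) * ip (convect \<Omega> um (fst W)) (fst U)
    + inverse Rey * ip (jac \<Omega> (fst U)) (jac \<Omega> (fst W))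
    + S * ip (current U) (current W)
    + (- (S / Rmag)) * ip (snd (snd U)) (curl \<Omega> (fst (snd W)))
    + (S / Rmag) * ip (curl \<Omega> (fst (snd U))) (snd (snd W))"
  by (simp add: a_form_def current_def trilinear_def split_beta diff_divide_distrib)

lemma b_eq: "b W y = (-1) * ip (dvg \<Omega> (fst W)) (fst y) + ip (dvg \<Omega> (snd (snd W))) (snd y)"
  by (simp add: b_form_def split_beta)

lemma bilinear_a: "bilinear_form_on X a"
  unfolding a_eq
  by (intro bilinear_form_on_add bilinear_form_on_cmult
      bilinear_form_on_L2_inner_ae_linear[OF subspace_X]
      bilinear_form_on_swap[of X "\<lambda>U W. ip (convect \<Omega> um (fst U)) (fst W)"]
      ae_linear_convect ae_linear_velocity ae_linear_velocity_jac ae_linear_current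
      ae_linear_magnetic ae_linear_electric_curl)

text \<open>The semi-inner products behind \<open>X_norm\<close> and \<open>Y_norm\<close>; the triangle inequality for these norms
comes from them.\<close>

definition
  "X_form U W = ip (fst U) (fst W) + ip (jac \<Omega> (fst U)) (jac \<Omega> (fst W))
     + ip (curl \<Omega> (fst (snd U))) (curl \<Omega> (fst (snd W))) + ip (current U) (current W)
     + ip (snd (snd U)) (snd (snd W)) + ip (dvg \<Omega> (snd (snd U))) (dvg \<Omega> (snd (snd W)))"

definition Y_form :: "sfield \<times> sfield \<Rightarrow> sfield \<times> sfield \<Rightarrow> real" where
  "Y_form x y = ip (fst x) (fst y) + ip (snd x) (snd y)"

lemma X_norm_eq: "X_norm \<Omega> Bm U = sqrt (X_form U U)"
  by (simp add: X_norm_def X_form_def current_def split_beta L2_norm_power2)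

lemma Y_norm_eq: "Y_norm \<Omega> y = sqrt (Y_form y y)"
  by (simp add: Y_norm_def Y_form_def split_beta L2_norm_power2)

lemma bilinear_X_form: "bilinear_form_on X X_form"
  unfolding X_form_def
  by (intro bilinear_form_on_add bilinear_form_on_L2_inner_ae_linear[OF subspace_X]
      ae_linear_velocity ae_linear_velocity_jac ae_linear_current
      ae_linear_magnetic ae_linear_electric_curl ae_linear_magnetic_dvg)

lemma bilinear_Y_form: "bilinear_form_on Y Y_form"
  unfolding Y_form_def
  by (intro bilinear_form_on_add bilinear_form_on_L2_inner_ae_linear[OF subspace_Y] ae_linear_pressures)

lemma X_form_sym: "X_form U W = X_form W U" and X_form_psd: "0 \<le> X_form U U"
  by (simp_all add: X_form_def L2_inner_commute L2_inner_self_nonneg)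

lemma Y_form_sym: "Y_form x y = Y_form y x" and Y_form_psd: "0 \<le> Y_form x x"
  by (simp_all add: Y_form_def L2_inner_commute L2_inner_self_nonneg)

abbreviation "Z \<equiv> X \<times> Y"

text \<open>The two equations of the saddle point problem added up. Nothing is lost, since the test functions
\<open>W\<close> and \<open>y\<close> vary independently.\<close>

definition
  "A z w = a (fst z) (fst w) + b (fst w) (snd z) + b (fst z) (snd w)"

definition Null :: "((vfield \<times> vfield \<times> vfield) \<times> sfield \<times> sfield) set" where
  "Null = ({f. ae f 0} \<times> {f. ae f 0} \<times> {f. ae f 0}) \<times> {f. ae f 0} \<times> {f. ae f 0}"

lemma subspace_Z: "subspace Z"
  using subspace_X subspace_Y by (rule subspace_Times)

lemma mem_Null: "z \<in> Null \<longleftrightarrow> ae (fst (fst z)) 0 \<and> ae (fst (snd (fst z))) 0 \<and>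
    ae (snd (snd (fst z))) 0 \<and> ae (fst (snd z)) 0 \<and> ae (snd (snd z)) 0"
  by (auto simp: Null_def mem_Times_iff)

lemma subspace_null_fields: "subspace {f :: real^3 \<Rightarrow> 'c::real_vector. ae f 0}"
proof (rule subspaceI)
  show "f + g \<in> {f. ae f 0}" if "f \<in> {f. ae f 0}" "g \<in> {f. ae f 0}" for f g :: "real^3 \<Rightarrow> 'c"
    using ae_eq_add[of f 0 g 0] that by simp
  show "c *\<^sub>R f \<in> {f. ae f 0}" if "f \<in> {f. ae f 0}" for c and f :: "real^3 \<Rightarrow> 'c"
    using ae_eq_scaleR[of f 0 c] that by simp
qed simp

lemma subspace_Null: "subspace Null"
  unfolding Null_def by (intro subspace_Times subspace_null_fields)

lemma finite_dim_Z: "finite_dim_modulo Null Z"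
  unfolding Null_def by (intro finite_dim_modulo_Times findim)

lemma bilinear_b: "bilinear_form_on Z (\<lambda>z w. b (fst w) (snd z))"
proof -
  have "bilinear_form_on Z (\<lambda>w z. b (fst w) (snd z))"
    unfolding b_eq
    by (intro bilinear_form_on_add bilinear_form_on_cmult bilinear_form_on_L2_inner_ae_linear[OF subspace_Z]
        ae_linear_on_compose[OF ae_linear_velocity_dvg] ae_linear_on_compose[OF ae_linear_magnetic_dvg]
        ae_linear_on_compose[OF ae_linear_pressures(1)] ae_linear_on_compose[OF ae_linear_pressures(2)]) auto
  then show ?thesis by (rule bilinear_form_on_swap)
qed

lemma bilinear_A: "bilinear_form_on Z A"
proof -
  have "bilinear_form_on Z (\<lambda>z w. a (fst z) (fst w))"
    using bilinear_a unfolding bilinear_form_on_def linear_form_on_def by auto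
  then show ?thesis unfolding A_def
    using bilinear_b bilinear_form_on_swap[OF bilinear_b] by (intro bilinear_form_on_add)
qed

lemma L2_of_X:
  assumes "U \<in> X"
  shows "fst U \<in> L2 \<Omega>" "snd (snd U) \<in> L2 \<Omega>" "jac \<Omega> (fst U) \<in> L2 \<Omega>" "convect \<Omega> um (fst U) \<in> L2 \<Omega>"
    "current U \<in> L2 \<Omega>" "curl \<Omega> (fst (snd U)) \<in> L2 \<Omega>" "dvg \<Omega> (fst U) \<in> L2 \<Omega>" "dvg \<Omega> (snd (snd U)) \<in> L2 \<Omega>"
  by (rule ae_linear_on_L2[OF ae_linear_velocity assms] ae_linear_on_L2[OF ae_linear_magnetic assms]
    ae_linear_on_L2[OF ae_linear_velocity_jac assms] ae_linear_on_L2[OF ae_linear_convect assms]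
    ae_linear_on_L2[OF ae_linear_current assms] ae_linear_on_L2[OF ae_linear_electric_curl assms]
    ae_linear_on_L2[OF ae_linear_velocity_dvg assms] ae_linear_on_L2[OF ae_linear_magnetic_dvg assms])+

lemma L2_of_Y:
  assumes "y \<in> Y"
  shows "fst y \<in> L2 \<Omega>" "snd y \<in> L2 \<Omega>"
  by (rule ae_linear_on_L2[OF ae_linear_pressures(1) assms] ae_linear_on_L2[OF ae_linear_pressures(2) assms])+

lemma velocity_ae_0:
  assumes "U \<in> X" "ae (fst U) 0"
  shows "ae (jac \<Omega> (fst U)) 0" "ae (convect \<Omega> um (fst U)) 0" "ae (dvg \<Omega> (fst U)) 0"
    "ae (cross_field (fst U) Bm) 0"
proof -
  show j: "ae (jac \<Omega> (fst U)) 0"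
    using assms conforming by (intro jac_ae_0) auto
  then show "ae (convect \<Omega> um (fst U)) 0"
    unfolding ae_eq_def convect_def by eventually_elim simp
  show "ae (dvg \<Omega> (fst U)) 0"
    using assms V_has_div dvg_ae_0 by (metis mem_Times_iff)
  show "ae (cross_field (fst U) Bm) 0"
    using assms(2) unfolding ae_eq_def cross_field_def by eventually_elim simp
qed

lemma electric_ae_0: "U \<in> X \<Longrightarrow> ae (fst (snd U)) 0 \<Longrightarrow> ae (curl \<Omega> (fst (snd U))) 0"
  using conforming by (intro curl_ae_0) auto

lemma magnetic_ae_0: "U \<in> X \<Longrightarrow> ae (snd (snd U)) 0 \<Longrightarrow> ae (dvg \<Omega> (snd (snd U))) 0"
  using D_has_div dvg_ae_0 by (metis mem_Times_iff)

lemma current_ae_0: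
  assumes "U \<in> X" "ae (fst U) 0"
  shows "ae (current U) (fst (snd U))"
  using ae_eq_add[OF ae_eq_refl velocity_ae_0(4)[OF assms], of "fst (snd U)"] by (simp add: current_def)

lemma Null_ae_0:
  assumes "n \<in> Z \<inter> Null"
  shows "fst n \<in> X" "snd n \<in> Y" "ae (fst (fst n)) 0" "ae (snd (snd (fst n))) 0" "ae (jac \<Omega> (fst (fst n))) 0"
    "ae (convect \<Omega> um (fst (fst n))) 0" "ae (current (fst n)) 0" "ae (curl \<Omega> (fst (snd (fst n)))) 0"
    "ae (dvg \<Omega> (fst (fst n))) 0" "ae (dvg \<Omega> (snd (snd (fst n)))) 0" "ae (fst (snd n)) 0" "ae (snd (snd n)) 0"
proof -
  show nX: "fst n \<in> X" "snd n \<in> Y" using assms by auto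
  show n0: "ae (fst (fst n)) 0" "ae (snd (snd (fst n))) 0" "ae (fst (snd n)) 0" "ae (snd (snd n)) 0"
    using assms by (auto simp: mem_Null)
  have e0: "ae (fst (snd (fst n))) 0" using assms by (auto simp: mem_Null)
  show "ae (jac \<Omega> (fst (fst n))) 0" "ae (convect \<Omega> um (fst (fst n))) 0" "ae (dvg \<Omega> (fst (fst n))) 0"
    using velocity_ae_0[OF nX(1) n0(1)] by blast+
  show "ae (curl \<Omega> (fst (snd (fst n)))) 0" using electric_ae_0[OF nX(1) e0] .
  show "ae (dvg \<Omega> (snd (snd (fst n)))) 0" using magnetic_ae_0[OF nX(1) n0(2)] .
  show "ae (current (fst n)) 0" using ae_eq_trans[OF current_ae_0[OF nX(1) n0(1)] e0] .
qed

lemma A_Null: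
  assumes z: "z \<in> Z" and n: "n \<in> Z \<inter> Null"
  shows "A z n = 0"
proof -
  have zX: "fst z \<in> X" "snd z \<in> Y" using z by auto
  note n0 = Null_ae_0[OF n]
  note Lz = L2_of_X[OF zX(1)] L2_of_Y[OF zX(2)] and Ln = L2_of_X[OF n0(1)] L2_of_Y[OF n0(2)]
  show ?thesis
    unfolding A_def a_eq b_eq by (simp add: L2_inner_ae_0 Lz Ln n0)
qed

text \<open>Testing with the solution, with the pressures reversed, leaves the viscous and the Ohmic
dissipation, so velocity and electric field vanish. The remaining unknowns are reached by exactness
of the complex and by the inf-sup condition.\<close>

lemma A_injective:
  assumes z: "z \<in> Z" and hom: "\<And>w. w \<in> Z \<Longrightarrow> A z w = 0"
  shows "z \<in> Null"
proof -
  obtain u F B p r where z_eq: "z = ((u, F, B), (p, r))" by (metis prod.collapse)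
  have mem: "u \<in> V" "F \<in> E" "B \<in> D" "p \<in> Q" "r \<in> L" using z by (auto simp: z_eq)
  have zX: "fst z \<in> X" "snd z \<in> Y" using z by auto
  note Lz = L2_of_X[OF zX(1)] L2_of_Y[OF zX(2)]
  have zero: "0 \<in> V" "0 \<in> E" "0 \<in> D" "0 \<in> Q" "0 \<in> L" using spaces by (auto intro: subspace_0)
  \<comment> \<open>reversing the sign of the pressures cancels the constraint terms\<close>
  have "((u, F, B), (- p, - r)) \<in> Z" using mem spaces by (auto intro: subspace_neg)
  then have "A z ((u, F, B), (- p, - r)) = 0" by (rule hom)
  moreover have "ip g (- h) = - ip g h" for g h :: sfield
    by (simp add: L2_inner_def)
  ultimately have "inverse Rey * ip (jac \<Omega> u) (jac \<Omega> u) + S * ip (current (fst z)) (current (fst z)) = 0"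
    unfolding A_def a_eq b_eq by (simp add: z_eq L2_inner_commute[of "curl \<Omega> F" B])
  moreover have "0 \<le> inverse Rey * ip (jac \<Omega> u) (jac \<Omega> u)"
    "0 \<le> S * ip (current (fst z)) (current (fst z))"
    using coeffs by (auto intro!: mult_nonneg_nonneg L2_inner_self_nonneg)
  ultimately have "inverse Rey * ip (jac \<Omega> u) (jac \<Omega> u) = 0"
    "S * ip (current (fst z)) (current (fst z)) = 0" by linarith+
  then have "ae (jac \<Omega> u) 0" and j0: "ae (current (fst z)) 0"
    using coeffs L2_inner_self_eq_0_iff[OF Lz(3)] L2_inner_self_eq_0_iff[OF Lz(5)] by (auto simp: z_eq)
  then have u0: "ae u 0"
    using conforming mem by (intro H1_0_vec_zero_if_jac_zero) auto
  then have F0: "ae F 0"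
    using ae_eq_trans[OF ae_eq_sym[OF current_ae_0[OF zX(1)]] j0] by (simp add: z_eq)
  \<comment> \<open>the system that is left for \<open>B\<close>, \<open>p\<close>, \<open>r\<close> once \<open>u\<close> and \<open>E\<close> vanish\<close>
  have reduced: "(- (S / Rmag)) * ip B (curl \<Omega> F') - ip (dvg \<Omega> v) p + ip (dvg \<Omega> C) r
      + ip (dvg \<Omega> B) s = 0"
    if w: "v \<in> V" "F' \<in> E" "C \<in> D" "s \<in> L" for v F' C s
  proof -
    let ?w = "((v, F', C), (0 :: sfield, s))"
    have wZ: "?w \<in> Z" using w zero by simp
    then have wX: "fst ?w \<in> X" "snd ?w \<in> Y" by auto
    note Lw = L2_of_X[OF wX(1)] L2_of_Y[OF wX(2)]
    have u0': "ae (fst (fst z)) 0" and F0': "ae (fst (snd (fst z))) 0" using u0 F0 by (simp_all add: z_eq)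
    note v0 = velocity_ae_0[OF zX(1) u0']
    note e0 = electric_ae_0[OF zX(1) F0']
    have "A z ?w = 0" using wZ by (rule hom)
    then show ?thesis
      unfolding A_def a_eq b_eq
      using L2_inner_ae_0(1)[OF Lz(4) Lw(1) v0(2)] L2_inner_ae_0(2)[OF Lw(4) Lz(1) u0']
        L2_inner_ae_0(1)[OF Lz(3) Lw(3) v0(1)] L2_inner_ae_0(1)[OF Lz(5) Lw(5) j0]
        L2_inner_ae_0(1)[OF Lz(6) Lw(2) e0] L2_inner_ae_0(1)[OF Lz(7) Lw(9) v0(3)]
      by (simp add: z_eq)
  qed
  have z0: "(0, 0, 0) \<in> X" using zero by simp
  have d0: "ae (dvg \<Omega> (0 :: vfield)) 0" "ae (curl \<Omega> (0 :: vfield)) 0"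
    using velocity_ae_0(3)[OF z0] electric_ae_0[OF z0] by simp_all
  have d0L: "dvg \<Omega> (0 :: vfield) \<in> L2 \<Omega>" "curl \<Omega> (0 :: vfield) \<in> L2 \<Omega>"
    using L2_of_X(6,7)[OF z0] by simp_all
  \<comment> \<open>the terms that drop out when test functions are set to \<open>0\<close>\<close>
  have kill: "ip B (curl \<Omega> 0) = 0" "ip (dvg \<Omega> 0) p = 0" "ip (dvg \<Omega> 0) r = 0"
    "ip (dvg \<Omega> B) 0 = 0"
    using Lz d0 d0L by (auto simp: z_eq intro: L2_inner_ae_0) (simp add: L2_inner_def)
  have "ip (dvg \<Omega> B) (dvg \<Omega> B) = 0"
    using reduced[OF zero(1,2,3) dvg_D[OF mem(3)]] kill by simp
  then have "ae (dvg \<Omega> B) 0"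
    using L2_inner_self_eq_0_iff[OF Lz(8)] by (simp add: z_eq)
  then obtain F' where F': "F' \<in> E" "ae B (curl \<Omega> F')" using exact_D mem by blast
  have "ip B (curl \<Omega> F') = 0"
    using reduced[OF zero(1) F'(1) zero(3,5)] kill coeffs by simp
  moreover have "(0, F', 0) \<in> X" using zero F' by simp
  from L2_of_X(6)[OF this] have "curl \<Omega> F' \<in> L2 \<Omega>" by simp
  ultimately have "ip B B = 0"
    using L2_inner_ae_cong[OF Lz(2) Lz(2) Lz(2) _ ae_eq_refl, of "curl \<Omega> F'"] F' by (simp add: z_eq)
  then have B0: "ae B 0" using L2_inner_self_eq_0_iff[OF Lz(2)] by (simp add: z_eq)
  obtain C where C: "C \<in> D" "ae r (dvg \<Omega> C)" using exact_L mem by blast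
  have "ip (dvg \<Omega> C) r = 0"
    using reduced[OF zero(1,2) C(1) zero(5)] kill by simp
  moreover have "(0, 0, C) \<in> X" using zero C by simp
  from L2_of_X(8)[OF this] have "dvg \<Omega> C \<in> L2 \<Omega>" by simp
  ultimately have "ip r r = 0"
    using L2_inner_ae_cong[OF Lz(10) _ Lz(10) Lz(10) _ ae_eq_refl, of "dvg \<Omega> C"] C by (simp add: z_eq)
  then have r0: "ae r 0" using L2_inner_self_eq_0_iff[OF Lz(10)] by (simp add: z_eq)
  have "ip (dvg \<Omega> v) p = 0" if "v \<in> V" for v
    using reduced[OF that zero(2,3,5)] kill by simp
  then have "ae p 0" using inf_sup mem by blast
  then show ?thesis using u0 F0 B0 r0 by (simp add: mem_Null z_eq)
qed

lemma X_norm_nonneg: "0 \<le> X_norm \<Omega> Bm U" and Y_norm_nonneg: "0 \<le> Y_norm \<Omega> y"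
  by (simp_all add: X_norm_eq Y_norm_eq X_form_psd Y_form_psd)

lemma X_norm_scale: "U \<in> X \<Longrightarrow> X_norm \<Omega> Bm (c *\<^sub>R U) = \<bar>c\<bar> * X_norm \<Omega> Bm U"
  unfolding X_norm_eq by (rule sqrt_form_scaleR[OF bilinear_X_form subspace_X])

lemma Y_norm_scale: "y \<in> Y \<Longrightarrow> Y_norm \<Omega> (c *\<^sub>R y) = \<bar>c\<bar> * Y_norm \<Omega> y"
  unfolding Y_norm_eq by (rule sqrt_form_scaleR[OF bilinear_Y_form subspace_Y])

lemma norm_Null:
  assumes n: "n \<in> Z \<inter> Null"
  shows "X_norm \<Omega> Bm (fst n) + Y_norm \<Omega> (snd n) = 0"
proof -
  note n0 = Null_ae_0[OF n]
  show ?thesis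
    unfolding X_norm_eq Y_norm_eq X_form_def Y_form_def
    by (simp add: L2_inner_ae_0 L2_of_X[OF n0(1)] L2_of_Y[OF n0(2)] n0)
qed

text \<open>The test function \<open>y = 0\<close> isolates the first equation, and the second is then the difference.\<close>

lemma saddle_solution_iff:
  assumes hf: "hf \<in> dual_space X (X_norm \<Omega> Bm)" and gf: "gf \<in> dual_space Y (Y_norm \<Omega>)"
  shows "saddle hf gf U x \<longleftrightarrow>
    (U, x) \<in> Z \<and> (\<forall>w\<in>Z. A (U, x) w = hf (fst w) + gf (snd w))"
proof
  assume "saddle hf gf U x"
  then show "(U, x) \<in> Z \<and> (\<forall>w\<in>Z. A (U, x) w = hf (fst w) + gf (snd w))"
    unfolding saddle_solution_def A_def by (metis fst_conv snd_conv mem_Times_iff)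
next
  assume sol: "(U, x) \<in> Z \<and> (\<forall>w\<in>Z. A (U, x) w = hf (fst w) + gf (snd w))"
  have y0: "0 \<in> Y" using subspace_0[OF subspace_Y] .
  have gs: "\<forall>c. \<forall>x\<in>Y. gf (c *\<^sub>R x) = c * gf x" using gf unfolding dual_space_def by blast
  have "gf (0 *\<^sub>R 0) = 0 * gf 0" by (rule bspec[OF spec[OF gs] y0])
  then have g0: "gf 0 = 0" by simp
  have b0: "b U 0 = 0" by (simp add: b_eq L2_inner_def)
  have eq: "a U W + b W x + b U y = hf W + gf y" if "W \<in> X" "y \<in> Y" for W y
    using sol that by (auto simp: A_def)
  have first: "a U W + b W x = hf W" if "W \<in> X" for W
    using eq[OF that y0] g0 b0 by simp
  have "b U y = gf y" if "W \<in> X" "y \<in> Y" for W y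
    using eq[OF that] first[OF that(1)] by simp
  then show "saddle hf gf U x"
    using sol first unfolding saddle_solution_def by auto
qed

lemma difference_in_Null:
  assumes "z \<in> Z" "z' \<in> Z" "\<And>w. w \<in> Z \<Longrightarrow> A z w = A z' w"
  shows "X_eq \<Omega> (fst z) (fst z') \<and> Y_eq \<Omega> (snd z) (snd z')"
proof -
  have "z - z' \<in> Null"
  proof (rule A_injective)
    show "z - z' \<in> Z" using subspace_Z assms by (simp add: subspace_diff)
    fix w assume w: "w \<in> Z"
    then have "linear_form_on Z (\<lambda>z. A z w)" using bilinear_A unfolding bilinear_form_on_def by blast
    from linear_form_on_diff[OF subspace_Z this assms(1,2)] show "A (z - z') w = 0" using assms(3)[OF w] by simp
  qed
  then show ?thesis
    unfolding mem_Null X_eq_def Y_eq_def split_beta by (simp add: ae_eq_diff_0_iff)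
qed

theorem saddle_well_posed:
  "\<exists>c>0. \<forall>hf\<in>dual_space X (X_norm \<Omega> Bm). \<forall>gf\<in>dual_space Y (Y_norm \<Omega>).
     \<exists>U x. saddle hf gf U x \<and>
       (\<forall>U' x'. saddle hf gf U' x' \<longrightarrow> X_eq \<Omega> U' U \<and> Y_eq \<Omega> x' x) \<and>
       X_norm \<Omega> Bm U + Y_norm \<Omega> x
         \<le> c * (dual_norm X (X_norm \<Omega> Bm) hf + dual_norm Y (Y_norm \<Omega>) gf)"
  (is "\<exists>c>0. \<forall>hf\<in>_. \<forall>gf\<in>_. ?well_posed c hf gf")
proof -
  let ?N = "\<lambda>z. X_norm \<Omega> Bm (fst z) + Y_norm \<Omega> (snd z)"
  have "\<exists>c>0. \<forall>\<phi> d. linear_form_on Z \<phi> \<longrightarrow> (\<forall>w\<in>Z. \<bar>\<phi> w\<bar> \<le> d * ?N w) \<longrightarrow> 0 \<le> d \<longrightarrow>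
           (\<exists>z\<in>Z. (\<forall>w\<in>Z. A z w = \<phi> w) \<and> ?N z \<le> c * d)"
  proof (rule injective_form_solvable[OF subspace_Z subspace_Null finite_dim_Z bilinear_A A_Null A_injective])
    show "0 \<le> ?N z" for z using X_norm_nonneg Y_norm_nonneg by simp
    show "?N (z + w) \<le> ?N z + ?N w" if "z \<in> Z" "w \<in> Z" for z w
      using psd_triangle[OF subspace_X bilinear_X_form X_form_sym X_form_psd, of "fst z" "fst w"]
        psd_triangle[OF subspace_Y bilinear_Y_form Y_form_sym Y_form_psd, of "snd z" "snd w"] that
      unfolding X_norm_eq Y_norm_eq by (auto simp: mem_Times_iff)
    show "?N (c *\<^sub>R z) = \<bar>c\<bar> * ?N z" if "z \<in> Z" for c z
      using that X_norm_scale[of "fst z" c] Y_norm_scale[of "snd z" c] by (auto simp: mem_Times_iff distrib_left)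
    show "?N n = 0" if "n \<in> Z \<inter> Null" for n using norm_Null[OF that] .
  qed
  then obtain c where c: "c > 0" and solve: "\<forall>\<phi> d. linear_form_on Z \<phi> \<longrightarrow>
      (\<forall>w\<in>Z. \<bar>\<phi> w\<bar> \<le> d * ?N w) \<longrightarrow> 0 \<le> d \<longrightarrow> (\<exists>z\<in>Z. (\<forall>w\<in>Z. A z w = \<phi> w) \<and> ?N z \<le> c * d)"
    by (elim exE conjE)
  show ?thesis
  proof (intro exI[of _ c] conjI ballI c)
    fix hf gf assume hf: "hf \<in> dual_space X (X_norm \<Omega> Bm)" and gf: "gf \<in> dual_space Y (Y_norm \<Omega>)"
    let ?dh = "dual_norm X (X_norm \<Omega> Bm) hf" and ?dg = "dual_norm Y (Y_norm \<Omega>) gf"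
    note hb = dual_norm_bound[OF subspace_X hf X_norm_nonneg X_norm_scale]
    note gb = dual_norm_bound[OF subspace_Y gf Y_norm_nonneg Y_norm_scale]
    have "\<exists>z\<in>Z. (\<forall>w\<in>Z. A z w = hf (fst w) + gf (snd w)) \<and> ?N z \<le> c * (?dh + ?dg)"
    proof (rule solve[rule_format])
      show "linear_form_on Z (\<lambda>w. hf (fst w) + gf (snd w))"
        using hf gf unfolding dual_space_def linear_form_on_def mem_Times_iff
        by (simp add: algebra_simps)
      show "0 \<le> ?dh + ?dg" using hb(2) gb(2) by simp
      fix w assume w: "w \<in> Z"
      have "\<bar>hf (fst w) + gf (snd w)\<bar> \<le> ?dh * X_norm \<Omega> Bm (fst w) + ?dg * Y_norm \<Omega> (snd w)"
        using hb(1)[of "fst w"] gb(1)[of "snd w"] w by (auto simp: mem_Times_iff)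
      also have "\<dots> \<le> (?dh + ?dg) * ?N w"
        using mult_nonneg_nonneg[OF hb(2) Y_norm_nonneg[of "snd w"]]
          mult_nonneg_nonneg[OF gb(2) X_norm_nonneg[of "fst w"]] by (simp add: algebra_simps)
      finally show "\<bar>hf (fst w) + gf (snd w)\<bar> \<le> (?dh + ?dg) * ?N w" .
    qed
    then obtain U x where sol: "(U, x) \<in> Z" "\<And>w. w \<in> Z \<Longrightarrow> A (U, x) w = hf (fst w) + gf (snd w)"
      and bd: "X_norm \<Omega> Bm U + Y_norm \<Omega> x \<le> c * (?dh + ?dg)" by auto
    have uniq: "X_eq \<Omega> U' U \<and> Y_eq \<Omega> x' x" if "saddle hf gf U' x'" for U' x'
      using that sol difference_in_Null[of "(U', x')" "(U, x)"] unfolding saddle_solution_iff[OF hf gf] by auto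
    have "saddle hf gf U x"
      unfolding saddle_solution_iff[OF hf gf] using sol by auto
    then show "?well_posed c hf gf"
      using uniq bd by blast
  qed
qed

text \<open>Here \<open>M\<close>, \<open>N\<close> and \<open>P\<close> are the parts of \<open>a U\<close> that depend on the velocity, electric and magnetic
test function. Each vanishes at \<open>0\<close>, so testing with one nonzero component yields one
equation of the Picard step. For weak derivatives of the zero field this is not a matter of
computation, because they are determined only up to null sets.\<close>

lemma picard_solution_iff_saddle_solution:
  assumes f0: "f 0 = 0"
  shows "picard f U x \<longleftrightarrow>
    saddle (\<lambda>W. f (fst W)) (\<lambda>_. 0) U x"
proof -
  obtain u F0 B p r where eqs: "U = (u, F0, B)" "x = (p, r)" by (metis prod.collapse)
  let ?j = "current U"
  define M where "M v = trilinear \<Omega> um u v + inverse Rey * ip (jac \<Omega> u) (jac \<Omega> v)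
      - S * ip (cross_field ?j Bm) v" for v
  define N where "N F = S * ip ?j F - S / Rmag * ip B (curl \<Omega> F)" for F
  define P where "P C = S / Rmag * ip (curl \<Omega> F0) C" for C
  have zero: "0 \<in> V" "0 \<in> E" "0 \<in> D" "0 \<in> Q" "0 \<in> L" using spaces by (auto intro: subspace_0)
  have pic: "picard f U x \<longleftrightarrow> U \<in> X \<and> x \<in> Y \<and>
     (\<forall>v\<in>V. \<forall>F\<in>E. \<forall>C\<in>D. \<forall>q\<in>Q. \<forall>s\<in>L. M v - ip (dvg \<Omega> v) p = f v \<and> N F = 0 \<and>
        P C + ip (dvg \<Omega> C) r = 0 \<and> - ip (dvg \<Omega> u) q = 0 \<and> ip (dvg \<Omega> B) s = 0)"
    unfolding picard_solution_def eqs M_def N_def P_def current_def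
    by (auto simp: Let_def L2_inner_commute[of p] L2_inner_commute[of r])
  show ?thesis
  proof (cases "U \<in> X \<and> x \<in> Y")
    case False
    then show ?thesis by (auto simp: pic saddle_solution_def)
  next
    case True
    then have UX: "U \<in> X" and xY: "x \<in> Y" by auto
    note LU = L2_of_X[OF UX] and Lx = L2_of_Y[OF xY]
    \<comment> \<open>the triple product turns the symmetric term into the Lorentz force\<close>
    have lor: "ip ?j (cross_field v Bm) = - ip (cross_field ?j Bm) v" for v
    proof -
      have "i \<bullet> cross3 y c = - (cross3 i c \<bullet> y)" for i y c :: "real^3"
        by (simp add: cross3_def inner_vec_def sum_3 algebra_simps)
      then show ?thesis by (simp add: L2_inner_def cross_field_def)
    qed
    have split: "a U (v, F, C) = M v + N F + P C" if W: "v \<in> V" "F \<in> E" "C \<in> D" for v F C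
    proof -
      have "(v, 0, C) \<in> X" "(0 :: vfield) = fst (snd (v, 0, C))" using W zero by auto
      then have cv: "cross_field v Bm \<in> L2 \<Omega>" using L2_of_X(5)[of "(v, 0, C)"] by (simp add: current_def)
      have "ip ?j (F + cross_field v Bm) = ip ?j F + ip ?j (cross_field v Bm)"
        using bilinear_form_on_L2_inner LU(5) cv W E_L2 unfolding bilinear_form_on_def linear_form_on_def by blast
      then show ?thesis
        unfolding M_def N_def P_def using lor[of v]
        by (simp add: a_form_def eqs current_def distrib_left right_diff_distrib)
    qed
    have z0: "(0, 0, 0) \<in> X" using zero by simp
    note L0 = L2_of_X[OF z0, simplified]
    note v0 = velocity_ae_0[OF z0, simplified]
    have c0: "ae (curl \<Omega> 0) 0" using electric_ae_0[OF z0] by simp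
    have r0: "ip g 0 = 0" for g :: "real^3 \<Rightarrow> 'c::euclidean_space" by (simp add: L2_inner_def)
    have "trilinear \<Omega> um u 0 = 0"
      unfolding trilinear_def using L2_inner_ae_0(1)[OF L0(4) LU(1) v0(2)] by (simp add: r0 eqs)
    moreover have "ip (jac \<Omega> u) (jac \<Omega> 0) = 0"
      using L2_inner_ae_0(2)[OF LU(3) L0(3) v0(1)] by (simp add: eqs)
    ultimately have M0: "M 0 = 0" by (simp add: M_def r0)
    have N0: "N 0 = 0" using L2_inner_ae_0(2)[OF LU(2) L0(6) c0] by (simp add: N_def r0 eqs)
    have P0: "P 0 = 0" by (simp add: P_def r0)
    have d0: "ip (dvg \<Omega> 0) p = 0" "ip (dvg \<Omega> 0) r = 0"
      using L2_inner_ae_0(1)[OF L0(7) Lx(1) v0(3)] L2_inner_ae_0(1)[OF L0(7) Lx(2) v0(3)] by (simp_all add: eqs)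
    have sad: "saddle (\<lambda>W. f (fst W)) (\<lambda>_. 0) U x \<longleftrightarrow> (\<forall>v\<in>V. \<forall>F\<in>E. \<forall>C\<in>D. \<forall>q\<in>Q. \<forall>s\<in>L.
        M v + N F + P C - ip (dvg \<Omega> v) p + ip (dvg \<Omega> C) r = f v \<and>
        - ip (dvg \<Omega> u) q + ip (dvg \<Omega> B) s = 0)"
      unfolding saddle_solution_def using UX xY
      by (simp add: split b_form_def eqs(2) cong: ball_cong) (simp add: eqs(1) algebra_simps)
    show ?thesis
    proof
      assume "picard f U x"
      then have *: "M v - ip (dvg \<Omega> v) p = f v" "N F = 0"
          "P C + ip (dvg \<Omega> C) r = 0" "ip (dvg \<Omega> u) q = 0" "ip (dvg \<Omega> B) s = 0"
        if "v \<in> V" "F \<in> E" "C \<in> D" "q \<in> Q" "s \<in> L" for v F C q s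
        unfolding pic using that by auto
      show "saddle (\<lambda>W. f (fst W)) (\<lambda>_. 0) U x"
        unfolding sad
      proof (intro ballI conjI)
        fix v F C q s assume "v \<in> V" "F \<in> E" "C \<in> D" "q \<in> Q" "s \<in> L"
        note * = *[OF this]
        show "M v + N F + P C - ip (dvg \<Omega> v) p + ip (dvg \<Omega> C) r = f v"
          "- ip (dvg \<Omega> u) q + ip (dvg \<Omega> B) s = 0" using * by linarith+
      qed
    next
      assume "saddle (\<lambda>W. f (fst W)) (\<lambda>_. 0) U x"
      then have *: "M v + N F + P C - ip (dvg \<Omega> v) p + ip (dvg \<Omega> C) r = f v"
        "- ip (dvg \<Omega> u) q + ip (dvg \<Omega> B) s = 0"
        if "v \<in> V" "F \<in> E" "C \<in> D" "q \<in> Q" "s \<in> L" for v F C q s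
        unfolding sad using that by auto
      show "picard f U x"
        unfolding pic
      proof (intro ballI conjI UX xY)
        fix v F C q s assume w: "v \<in> V" "F \<in> E" "C \<in> D" "q \<in> Q" "s \<in> L"
        show "M v - ip (dvg \<Omega> v) p = f v"
          using *(1)[OF w(1) zero(2,3,4,5)] by (simp add: N0 P0 d0)
        show "N F = 0" using *(1)[OF zero(1) w(2) zero(3,4,5)] by (simp add: M0 P0 d0 f0)
        show "P C + ip (dvg \<Omega> C) r = 0" using *(1)[OF zero(1,2) w(3) zero(4,5)] by (simp add: M0 N0 d0 f0)
        show "- ip (dvg \<Omega> u) q = 0" using *(2)[OF w(1-4) zero(5)] by (simp add: r0)
        show "ip (dvg \<Omega> B) s = 0" using *(2)[OF w(1-3) zero(4) w(5)] by (simp add: r0)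
      qed
    qed
  qed
qed

theorem picard_well_posed:
  assumes f: "f \<in> dual_space (H1_0_vec \<Omega>) (H1_norm \<Omega>)"
  shows "\<exists>U x. picard f U x \<and>
    (\<forall>U' x'. picard f U' x' \<longrightarrow> X_eq \<Omega> U' U \<and> Y_eq \<Omega> x' x)"
proof -
  have zero: "0 \<in> H1_0_vec \<Omega>" using conforming spaces subspace_0 by blast
  have add: "f (v + w) = f v + f w" if "v \<in> V" "w \<in> V" for v w
    using f that conforming unfolding dual_space_def by blast
  have scale: "f (c *\<^sub>R v) = c * f v" if "v \<in> H1_0_vec \<Omega>" for c v
    using f that unfolding dual_space_def by blast
  obtain M where M: "\<And>v. v \<in> V \<Longrightarrow> \<bar>f v\<bar> \<le> M * H1_norm \<Omega> v"
    using f conforming unfolding dual_space_def by blast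
  have "\<bar>f (fst W)\<bar> \<le> \<bar>M\<bar> * X_norm \<Omega> Bm W" if W: "W \<in> X" for W
  proof -
    have "H1_norm \<Omega> (fst W) \<le> X_norm \<Omega> Bm W"
      unfolding H1_norm_def X_norm_def split_beta by (rule real_sqrt_le_mono) simp
    moreover have "0 \<le> H1_norm \<Omega> (fst W)" by (simp add: H1_norm_def)
    ultimately have "M * H1_norm \<Omega> (fst W) \<le> \<bar>M\<bar> * X_norm \<Omega> Bm W" by (intro mult_mono) auto
    then show ?thesis using M[of "fst W"] W by (auto simp: mem_Times_iff)
  qed
  then have h: "(\<lambda>W. f (fst W)) \<in> dual_space X (X_norm \<Omega> Bm)"
    using add scale conforming unfolding dual_space_def
    by (intro CollectI conjI exI[of _ "\<bar>M\<bar>"]) (auto simp: mem_Times_iff)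
  have g: "(\<lambda>_. 0) \<in> dual_space Y (Y_norm \<Omega>)"
    unfolding dual_space_def by (auto intro!: exI[of _ 0])
  have "f 0 = 0" using scale[OF zero, of 0] by simp
  note iff = picard_solution_iff_saddle_solution[of f, OF this]
  show ?thesis unfolding iff using saddle_well_posed h g by blast
qed

end

section \<open>Well-posedness for finite element discretizations\<close>

text \<open>If \<open>q\<close> is orthogonal to all divergences, the supremum in the inf-sup condition is \<open>0\<close>, whence
\<open>q = 0\<close>.\<close>

lemma mhd_step_intro:
  assumes poly: "lipschitz_polyhedron \<Omega>" and bdd: "bounded \<Omega>"
    and coeffs: "Rey > 0" "Rmag > 0" "S > 0"
    and mesh: "simplicial_mesh \<Omega> \<T>"
    and cplx: "standard_fe_complex \<Omega> \<T> G E D L" and exact: "exact_complex \<Omega> G E D L"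
    and stokes: "stokes_fe_pair \<Omega> \<T> k V Q"
    and inf_sup: "\<beta> > 0" "\<And>q. q \<in> Q \<Longrightarrow>
      \<beta> * L2_norm \<Omega> q \<le> (SUP v\<in>V. L2_inner \<Omega> (dvg \<Omega> v) q / H1_norm \<Omega> v)"
    and um: "um \<in> V" and Bm: "Bm \<in> D"
  shows "mhd_step \<Omega> E D V L Q Rey Rmag S um Bm"
proof -
  interpret bounded_domain \<Omega>
    using poly bdd by unfold_locales (auto simp: lipschitz_polyhedron_def)
  note cover = simplicial_mesh_finite_cover[OF mesh]
  obtain PE PD PL where loc: "local_space PE" "local_space PD" "local_space PL"
    and spaces: "E = Hcurl_0 \<Omega> \<inter> piecewise \<Omega> \<T> PE" "D = Hdiv_0 \<Omega> \<inter> piecewise \<Omega> \<T> PD"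
    "L = L2_0 \<Omega> \<inter> piecewise \<Omega> \<T> PL"
    by (rule standard_fe_complex_local_spaces[OF cplx]) blast
  have V: "subspace V" "V \<subseteq> H1_0_vec \<Omega>" and Q: "subspace Q" "Q \<subseteq> L2_0 \<Omega>"
    using stokes by (auto simp: stokes_fe_pair_def)
  obtain \<T>' where mesh': "simplicial_mesh \<Omega> \<T>'"
    and VQ: "V \<subseteq> piecewise \<Omega> \<T>' (vec_of (polys k))" "Q \<subseteq> piecewise \<Omega> \<T>' (polys k)"
    using stokes unfolding stokes_fe_pair_def by blast
  note cover' = simplicial_mesh_finite_cover[OF mesh']
  have Q_L2: "Q \<subseteq> L2 \<Omega>" and L_L2: "L \<subseteq> L2 \<Omega>" using Q spaces by (auto simp: L2_0_def)
  have sub: "subspace P" if "local_space P" for P :: "(real^3 \<Rightarrow> 'b::euclidean_space) set"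
    using that by (simp add: local_space_def)
  show ?thesis
  proof
    show "0 < Rey" "0 < Rmag" "0 < S" "subspace V" "subspace Q"
      "V \<subseteq> H1_0_vec \<Omega>" "Q \<subseteq> L2 \<Omega>" "L \<subseteq> L2 \<Omega>" by fact+
    show "subspace E" "subspace D" "subspace L"
      unfolding spaces
      by (intro subspace_inter subspace_Hcurl_0 subspace_Hdiv_0 subspace_L2_0 subspace_piecewise
          loc[THEN sub])+
    show "E \<subseteq> Hcurl_0 \<Omega>" "D \<subseteq> Hdiv_0 \<Omega>" using spaces by auto
    show "finite_dim_ae V"
      by (rule finite_dim_modulo_subset[OF finite_dim_ae_piecewise[OF cover' local_space_vec_of[OF local_space_polys]] VQ(1)])
    show "finite_dim_ae Q"
      by (rule finite_dim_modulo_subset[OF finite_dim_ae_piecewise[OF cover' local_space_polys] VQ(2)])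
    show "finite_dim_ae E" "finite_dim_ae D" "finite_dim_ae L"
      using finite_dim_modulo_subset[OF finite_dim_ae_piecewise[OF cover loc(1)], of E]
        finite_dim_modulo_subset[OF finite_dim_ae_piecewise[OF cover loc(2)], of D]
        finite_dim_modulo_subset[OF finite_dim_ae_piecewise[OF cover loc(3)], of L] spaces by auto
    have "um \<in> L2 \<Omega>" using um V(2) H1_0_vec_L2 by blast
    then show "um \<in> borel_measurable (lebesgue_on \<Omega>)" by (rule L2_measurable)
    have "um \<in> piecewise \<Omega> \<T>' (vec_of (polys k))" using um VQ(1) by blast
    then show "\<exists>M. AE x in lebesgue_on \<Omega>. norm (um x) \<le> M"
      by (rule piecewise_AE_bounded[OF cover' local_space_vec_of[OF local_space_polys]]) blast
    have "Bm \<in> Hdiv_0 \<Omega>" and pB: "Bm \<in> piecewise \<Omega> \<T> PD" using Bm spaces by auto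
    then have "Bm \<in> L2 \<Omega>" using Hdiv_0_has_div unfolding has_div_def by blast
    then show "Bm \<in> borel_measurable (lebesgue_on \<Omega>)" by (rule L2_measurable)
    show "\<exists>M. AE x in lebesgue_on \<Omega>. norm (Bm x) \<le> M"
      by (rule piecewise_AE_bounded[OF cover loc(2) pB]) blast
    show "dvg \<Omega> C \<in> L" if "C \<in> D" for C using exact that unfolding exact_complex_def by blast
    show "\<exists>F\<in>E. ae_eq \<Omega> C (curl \<Omega> F)" if "C \<in> D" "ae_eq \<Omega> (dvg \<Omega> C) 0" for C
      using exact that unfolding exact_complex_def by blast
    show "\<exists>C\<in>D. ae_eq \<Omega> s (dvg \<Omega> C)" if "s \<in> L" for s
      using exact that unfolding exact_complex_def by blast
    show "ae_eq \<Omega> q 0" if q: "q \<in> Q" and orth: "\<And>v. v \<in> V \<Longrightarrow> L2_inner \<Omega> (dvg \<Omega> v) q = 0" for q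
    proof -
      have "V \<noteq> {}" using subspace_0[OF V(1)] by blast
      then have "(SUP v\<in>V. L2_inner \<Omega> (dvg \<Omega> v) q / H1_norm \<Omega> v) = 0" using orth by simp
      then have "\<beta> * L2_norm \<Omega> q \<le> 0" using inf_sup(2)[OF q] by simp
      then have "L2_norm \<Omega> q \<le> 0" using inf_sup(1) by (simp add: mult_le_0_iff)
      then have "L2_norm \<Omega> q = 0" using L2_norm_nonneg[of q] by linarith
      moreover have "q \<in> L2 \<Omega>" using q Q_L2 by blast
      ultimately show ?thesis using L2_norm_eq_0_iff by blast
    qed
  qed
qed

theorem theorem7:
  fixes \<Omega> :: "(real^3) set"
    and \<T> :: "'i \<Rightarrow> (real^3) set set"
    and H_grad L_h Q :: "'i \<Rightarrow> sfield set"
    and H_curl H_div V :: "'i \<Rightarrow> vfield set"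
    and X :: "'i \<Rightarrow> (vfield \<times> vfield \<times> vfield) set"
    and Y :: "'i \<Rightarrow> (sfield \<times> sfield) set"
    and Rey Rmag S :: real
    and k :: nat
    and f :: "vfield \<Rightarrow> real"
  assumes "lipschitz_polyhedron \<Omega>" and "bounded \<Omega>" and "contractible \<Omega>"
    and "Rey > 0" and "Rmag > 0" and "S > 0"
    and "f \<in> dual_space (H1_0_vec \<Omega>) (H1_norm \<Omega>)"
    and "\<And>h. simplicial_mesh \<Omega> (\<T> h)" and "shape_regular \<T>" and "quasi_uniform \<T>"
    and "\<And>h. standard_fe_complex \<Omega> (\<T> h) (H_grad h) (H_curl h) (H_div h) (L_h h)"
    and "\<And>h. exact_complex \<Omega> (H_grad h) (H_curl h) (H_div h) (L_h h)"
    and "\<And>h. stokes_fe_pair \<Omega> (\<T> h) k (V h) (Q h)" and "inf_sup_stable \<Omega> V Q"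
    and "\<And>h. X h = V h \<times> H_curl h \<times> H_div h" and "\<And>h. Y h = Q h \<times> L_h h"
  shows "(\<forall>h. \<forall>um\<in>V h. \<forall>Bm\<in>H_div h. \<exists>c>0.
           \<forall>hf\<in>dual_space (X h) (X_norm \<Omega> Bm). \<forall>gf\<in>dual_space (Y h) (Y_norm \<Omega>).
             \<exists>U x. saddle_solution \<Omega> Rey Rmag S um Bm (X h) (Y h) hf gf U x \<and>
               (\<forall>U' x'. saddle_solution \<Omega> Rey Rmag S um Bm (X h) (Y h) hf gf U' x' \<longrightarrow>
                  X_eq \<Omega> U' U \<and> Y_eq \<Omega> x' x) \<and>
               X_norm \<Omega> Bm U + Y_norm \<Omega> x
                 \<le> c * (dual_norm (X h) (X_norm \<Omega> Bm) hf + dual_norm (Y h) (Y_norm \<Omega>) gf))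
       \<and> (\<forall>h. \<forall>um\<in>V h. \<forall>Bm\<in>H_div h.
             \<exists>U x. picard_solution \<Omega> Rey Rmag S f um Bm (X h) (Y h) U x \<and>
               (\<forall>U' x'. picard_solution \<Omega> Rey Rmag S f um Bm (X h) (Y h) U' x' \<longrightarrow>
                  X_eq \<Omega> U' U \<and> Y_eq \<Omega> x' x))"
proof -
  obtain \<beta> where \<beta>: "\<beta> > 0" "\<And>h q. q \<in> Q h \<Longrightarrow>
      \<beta> * L2_norm \<Omega> q \<le> (SUP v\<in>V h. L2_inner \<Omega> (dvg \<Omega> v) q / H1_norm \<Omega> v)"
    using assms(14) unfolding inf_sup_stable_def by blast
  have step: "mhd_step \<Omega> (H_curl h) (H_div h) (V h) (L_h h) (Q h) Rey Rmag S um Bm"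
    if "um \<in> V h" "Bm \<in> H_div h" for h um Bm
    by (rule mhd_step_intro[OF assms(1,2,4-6) assms(8)[of h] assms(11)[of h] assms(12)[of h] assms(13)[of h] \<beta> that])
  show ?thesis
    unfolding assms(15,16)
    using mhd_step.saddle_well_posed[OF step] mhd_step.picard_well_posed[OF step assms(7)] by blast
qed

end
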